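(* Let $G$ be a finitely generated infinite group with a fixed finite symmetric generating set, and let $f$ be a Floyd function. Let $\mu$ be a probability measure on $G$ whose support generates $G$ as a semigroup and whose random walk is transient. Assume that either (a) the support of $\mu$ is finite, or (b) $\mu$ has superexponential moment and $x^{2+\alpha}f(x)\to0$ as $x\to\infty$ for some $\alpha>0$. Then there is a function $R:(0,\infty)\times(0,\infty)\to(0,\infty)$, decreasing in each variable, such that for every $\varepsilon>0$ and all $x,y,w\in G$ with $x\ne y$, $$P_{x,y}\Big(\gamma\in \mathrm{Traj}(x,y):\ \gamma \text{ meets the ball } \{g\in G: d(g,w)\le R(\varepsilon,\delta^f_w(x,y))\}\Big)>1-\varepsilon .$$
   Context: $d$ is the word metric on $G$ for the fixed finite symmetric generating set, and $\|g\|=d(e,g)$. The measure $\mu$ has superexponential moment if $\sum_{g\in G}c^{\|g\|}\mu(g)<\infty$ for every $c>1$. Trajectories: $\mathrm{Traj}(x,y)$ is the set of finite sequences $g_0=x,g_1,\dots,g_n=y$ in $G$ ($n\ge 0$) with $\mu(g_i^{-1}g_{i+1})>0$ for all $i$; the weight is $w(\alpha)=\prod_{i=0}^{n-1}\mu(g_i^{-1}g_{i+1})$. The Green function is $\mathcal G(x,y)=\sum_{\alpha\in \mathrm{Traj}(x,y)}w(\alpha)$; transient means it is finite for all $x,y$. $P_{x,y}$ is the probability measure on $\mathrm{Traj}(x,y)$ given by $P_{x,y}(V)=\frac1{\mathcal G(x,y)}\sum_{\alpha\in V}w(\alpha)$. Floyd function: a nonincreasing function $f:[0,\infty)\to(0,\infty)$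 with $\sum_{k\ge0}f(k)<\infty$ and such that there is $\kappa\ge1$ with $f(n)/f(n+1)\le\kappa$ for all $n\in\mathbb N$. Floyd distance: for a vertex $v\in G$, an edge $\{a,b\}$ of the Cayley graph has $(f,v)$-length $f(\min(d(v,a),d(v,b)))$; the $(f,v)$-length of an edge path is the sum of the lengths of its edges; $\delta^f_v(x,y)$ is the minimal $(f,v)$-length of an edge path from $x$ to $y$. *)

theory Defs
  imports "HOL-Probability.Probability" "HOL-Algebra.Generated_Groups"
begin

definition symmetric_generating_set :: "('a, 'b) monoid_scheme \<Rightarrow> 'a set \<Rightarrow> bool" where
  "symmetric_generating_set G S \<longleftrightarrow>
     S \<subseteq> carrier G \<and> (\<forall>s\<in>S. inv\<^bsub>G\<^esub> s \<in> S) \<and> generate G S = carrier G"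

definition word_prod :: "('a, 'b) monoid_scheme \<Rightarrow> 'a list \<Rightarrow> 'a" where
  "word_prod G xs = foldr (\<lambda>a b. a \<otimes>\<^bsub>G\<^esub> b) xs \<one>\<^bsub>G\<^esub>"

(* Inverses of letters are not allowed: the definition is meant for symmetric S. *)
definition word_length :: "('a, 'b) monoid_scheme \<Rightarrow> 'a set \<Rightarrow> 'a \<Rightarrow> nat" where
  "word_length G S g = (LEAST n. \<exists>xs. length xs = n \<and> set xs \<subseteq> S \<and> word_prod G xs = g)"

definition word_dist :: "('a, 'b) monoid_scheme \<Rightarrow> 'a set \<Rightarrow> 'a \<Rightarrow> 'a \<Rightarrow> nat" where
  "word_dist G S x y = word_length G S (inv\<^bsub>G\<^esub> x \<otimes>\<^bsub>G\<^esub> y)"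

definition generates_as_semigroup :: "('a, 'b) monoid_scheme \<Rightarrow> 'a set \<Rightarrow> bool" where
  "generates_as_semigroup G A \<longleftrightarrow>
     carrier G = {word_prod G xs | xs. xs \<noteq> [] \<and> set xs \<subseteq> A}"

definition superexponential_moment ::
    "('a, 'b) monoid_scheme \<Rightarrow> 'a set \<Rightarrow> 'a pmf \<Rightarrow> bool" where
  "superexponential_moment G S \<mu> \<longleftrightarrow>
     (\<forall>c::real. c > 1 \<longrightarrow>
        (\<lambda>g. c ^ word_dist G S \<one>\<^bsub>G\<^esub> g * pmf \<mu> g) summable_on carrier G)"

(* A sequence g_0, ..., g_n is encoded as the nonempty list of its n + 1 terms;
   the case n = 0 is a singleton list, of weight 1. *)
definition Traj :: "('a, 'b) monoid_scheme \<Rightarrow> 'a pmf \<Rightarrow> 'a \<Rightarrow> 'a \<Rightarrow> 'a list set" where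
  "Traj G \<mu> x y =
     {\<alpha>. \<alpha> \<noteq> [] \<and> set \<alpha> \<subseteq> carrier G \<and> hd \<alpha> = x \<and> last \<alpha> = y \<and>
        successively (\<lambda>a b. pmf \<mu> (inv\<^bsub>G\<^esub> a \<otimes>\<^bsub>G\<^esub> b) > 0) \<alpha>}"

definition traj_weight :: "('a, 'b) monoid_scheme \<Rightarrow> 'a pmf \<Rightarrow> 'a list \<Rightarrow> real" where
  "traj_weight G \<mu> \<alpha> = (\<Prod>i<length \<alpha> - 1. pmf \<mu> (inv\<^bsub>G\<^esub> (\<alpha> ! i) \<otimes>\<^bsub>G\<^esub> (\<alpha> ! Suc i)))"

definition Green :: "('a, 'b) monoid_scheme \<Rightarrow> 'a pmf \<Rightarrow> 'a \<Rightarrow> 'a \<Rightarrow> ennreal" where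
  "Green G \<mu> x y = (\<integral>\<^sup>+\<alpha>. ennreal (traj_weight G \<mu> \<alpha>) \<partial>count_space (Traj G \<mu> x y))"

definition transient_walk :: "('a, 'b) monoid_scheme \<Rightarrow> 'a pmf \<Rightarrow> bool" where
  "transient_walk G \<mu> \<longleftrightarrow> (\<forall>x\<in>carrier G. \<forall>y\<in>carrier G. Green G \<mu> x y < \<infinity>)"

definition traj_measure ::
    "('a, 'b) monoid_scheme \<Rightarrow> 'a pmf \<Rightarrow> 'a \<Rightarrow> 'a \<Rightarrow> 'a list measure" where
  "traj_measure G \<mu> x y =
     point_measure (Traj G \<mu> x y) (\<lambda>\<alpha>. ennreal (traj_weight G \<mu> \<alpha>) / Green G \<mu> x y)"

lemma emeasure_traj_measure:
  assumes "V \<subseteq> Traj G \<mu> x y"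
  shows "emeasure (traj_measure G \<mu> x y) V =
           (\<integral>\<^sup>+\<alpha>. ennreal (traj_weight G \<mu> \<alpha>) \<partial>count_space V) / Green G \<mu> x y"
proof -
  have "emeasure (traj_measure G \<mu> x y) V =
      (\<integral>\<^sup>+\<alpha>. ennreal (traj_weight G \<mu> \<alpha>) / Green G \<mu> x y * indicator V \<alpha>
         \<partial>count_space (Traj G \<mu> x y))"
    unfolding traj_measure_def point_measure_def using assms by (subst emeasure_density) auto
  also have "\<dots> = (\<integral>\<^sup>+\<alpha>. ennreal (traj_weight G \<mu> \<alpha>) / Green G \<mu> x y \<partial>count_space V)"
    using assms by (auto simp: nn_integral_count_space_indicator indicator_def
        intro!: nn_integral_cong)
  also have "\<dots> = (\<integral>\<^sup>+\<alpha>. ennreal (traj_weight G \<mu> \<alpha>) \<partial>count_space V) / Green G \<mu> x y"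
    by (rule nn_integral_divide) simp
  finally show ?thesis .
qed

definition floyd_function :: "(real \<Rightarrow> real) \<Rightarrow> bool" where
  "floyd_function f \<longleftrightarrow>
     (\<forall>t\<ge>0. f t > 0) \<and> antimono_on {0..} f \<and> summable (\<lambda>k::nat. f (real k)) \<and>
     (\<exists>\<kappa>\<ge>1. \<forall>n::nat. f (real n) / f (real (n + 1)) \<le> \<kappa>)"

(* Edge paths are encoded as nonempty vertex lists.  If the unit lies in S there are also
   loops; traversing one only increases the length of a path. *)
definition edge_paths :: "('a, 'b) monoid_scheme \<Rightarrow> 'a set \<Rightarrow> 'a \<Rightarrow> 'a \<Rightarrow> 'a list set" where
  "edge_paths G S x y =
     {p. p \<noteq> [] \<and> set p \<subseteq> carrier G \<and> hd p = x \<and> last p = y \<and>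
        successively (\<lambda>a b. inv\<^bsub>G\<^esub> a \<otimes>\<^bsub>G\<^esub> b \<in> S) p}"

definition floyd_length ::
    "('a, 'b) monoid_scheme \<Rightarrow> 'a set \<Rightarrow> (real \<Rightarrow> real) \<Rightarrow> 'a \<Rightarrow> 'a list \<Rightarrow> real" where
  "floyd_length G S f v p =
     (\<Sum>i<length p - 1. f (real (min (word_dist G S v (p ! i)) (word_dist G S v (p ! Suc i)))))"

(* An infimum, since a path of minimal length need not exist in general. *)
definition floyd_dist ::
    "('a, 'b) monoid_scheme \<Rightarrow> 'a set \<Rightarrow> (real \<Rightarrow> real) \<Rightarrow> 'a \<Rightarrow> 'a \<Rightarrow> 'a \<Rightarrow> real" where
  "floyd_dist G S f v x y = (INF p \<in> edge_paths G S x y. floyd_length G S f v p)"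

end

theory Submission
  imports Defs
begin

text \<open>
  Filling in the jumps of a trajectory from \<open>x\<close> to \<open>y\<close> gives an edge path. If the trajectory avoids a
  large ball around \<open>w\<close>, makes no long jumps and visits only \<open>O(n)\<close> points of each ball of radius
  \<open>n\<close> around \<open>w\<close>, then this path has small Floyd length. So it suffices to show that long jumps and
  too many visits are unlikely. The Green function satisfies
  \<open>\<G>(x,a) \<G>(a,b) \<G>(b,y) \<le> \<G>(\<one>,\<one>)\<^sup>2 \<G>(x,y)\<close> and \<open>\<G>(a,b)\<close> decays at most exponentially in \<open>d(a,b)\<close>,
  hence the probability that a trajectory contains a segment of a given kind from \<open>a\<close> to \<open>b\<close> is at
  most exponential in \<open>d(a,b)\<close> times the total weight of these segments. This excludes long jumps,
  and it bounds the number of visits if the transition probabilities decay exponentially in time.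

  They do so unless the Floyd geometry is degenerate. If there is at most one boundary point, then
  the Floyd distance of \<open>x\<close> and \<open>y\<close> is small whenever both are far from \<open>w\<close>, and there is nothing to
  prove. If there is a second boundary point and some boundary point has a finite orbit, then the
  group has linear growth and the bound on visits is trivial. Otherwise the convergence dynamics
  yields three elements playing ping-pong on disjoint sets, which gives a spectral gap.
\<close>


section \<open>The word metric\<close>

text \<open>The segment estimate loses a factor \<open>1 / q ^ wd a b\<close> with a constant
  \<open>q\<close> that is not under control, so every gain must be exponential at an arbitrarily
  large rate. For long jumps the superexponential moment provides it. For visits the factor
  \<open>K\<close> in the allowed number \<open>K * n\<close> is free, and segments of at least
  \<open>K * n\<close> steps have weight of order \<open>\<rho> ^ (K * n)\<close>. The exponent
  \<open>2 + \<alpha>\<close> arises because steps of length up to \<open>n / 2\<close> stay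
  possible at distance \<open>n\<close> from \<open>w\<close>: their Floyd length is of order
  \<open>n * f (n / 2)\<close>, and this has to be summable over the radii. No symmetry of
  \<open>\<mu>\<close> is assumed, so the gap is not read off a spectrum. Convolution lowers the
  squared l^2 norm of a distribution by a sum of variances, and ping-pong bounds these from below. A
  power of \<open>\<mu>\<close> may miss the elements that play ping-pong, for reasons of
  periodicity; hence the detour through the lazy walk, which costs only a linear factor on the way
  back.\<close>

context group
begin

lemma mult_cancel_inv:
  "\<lbrakk>g \<in> carrier G; y \<in> carrier G\<rbrakk> \<Longrightarrow> inv g \<otimes> (g \<otimes> y) = y"
  "\<lbrakk>g \<in> carrier G; y \<in> carrier G\<rbrakk> \<Longrightarrow> g \<otimes> (inv g \<otimes> y) = y"
  by (simp_all add: m_assoc[symmetric])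

lemma inv_mult_cancel:
  "\<lbrakk>x \<in> carrier G; y \<in> carrier G; z \<in> carrier G\<rbrakk> \<Longrightarrow> (inv x \<otimes> y) \<otimes> (inv y \<otimes> z) = inv x \<otimes> z"
  by (simp add: m_assoc mult_cancel_inv)

lemma inv_mult_left:
  "\<lbrakk>g \<in> carrier G; x \<in> carrier G; y \<in> carrier G\<rbrakk> \<Longrightarrow> inv (g \<otimes> x) \<otimes> (g \<otimes> y) = inv x \<otimes> y"
  by (simp add: inv_mult_group m_assoc mult_cancel_inv)

lemma word_prod_Nil [simp]: "word_prod G [] = \<one>"
  and word_prod_Cons [simp]: "word_prod G (x # xs) = x \<otimes> word_prod G xs"
  by (simp_all add: word_prod_def)

lemma word_prod_closed [simp]: "set xs \<subseteq> carrier G \<Longrightarrow> word_prod G xs \<in> carrier G"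
  by (induction xs) auto

lemma word_prod_append [simp]:
  "\<lbrakk>set xs \<subseteq> carrier G; set ys \<subseteq> carrier G\<rbrakk> \<Longrightarrow>
     word_prod G (xs @ ys) = word_prod G xs \<otimes> word_prod G ys"
  by (induction xs) (auto simp: m_assoc)

lemma word_prod_inv:
  "set xs \<subseteq> carrier G \<Longrightarrow> word_prod G (rev (map (\<lambda>x. inv x) xs)) = inv (word_prod G xs)"
proof (induction xs)
  case (Cons a xs)
  have "set (rev (map (\<lambda>x. inv x) xs)) \<subseteq> carrier G" "set [inv a] \<subseteq> carrier G"
    using Cons.prems by auto
  from word_prod_append[OF this] show ?case using Cons by (simp add: inv_mult_group)
qed simp

end

locale marked_group = group G for G (structure) +
  fixes S :: "'a set"
  assumes finite_S: "finite S" and gen_S: "symmetric_generating_set G S"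
begin

abbreviation len :: "'a \<Rightarrow> nat" where "len \<equiv> word_length G S"
abbreviation wd :: "'a \<Rightarrow> 'a \<Rightarrow> nat" where "wd \<equiv> word_dist G S"

lemma S_carrier: "s \<in> S \<Longrightarrow> s \<in> carrier G" and S_inv: "s \<in> S \<Longrightarrow> inv s \<in> S"
  using gen_S by (auto simp: symmetric_generating_set_def)

lemma S_sub: "S \<subseteq> carrier G"
  using S_carrier by blast

lemma word_ex: "g \<in> carrier G \<Longrightarrow> \<exists>xs. set xs \<subseteq> S \<and> word_prod G xs = g"
proof -
  assume "g \<in> carrier G"
  then have "g \<in> generate G S" using gen_S by (simp add: symmetric_generating_set_def)
  then show ?thesis
  proof induction
    case one show ?case by (rule exI[of _ "[]"]) simp
  next
    case (incl h) then show ?case by (intro exI[of _ "[h]"]) (simp add: S_carrier)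
  next
    case (inv h) then show ?case by (intro exI[of _ "[inv h]"]) (simp add: S_carrier S_inv)
  next
    case (eng h1 h2)
    then obtain xs ys where "set xs \<subseteq> S" "word_prod G xs = h1" "set ys \<subseteq> S" "word_prod G ys = h2"
      by blast
    then show ?case using S_sub by (intro exI[of _ "xs @ ys"]) (auto simp: subset_trans[OF _ S_sub])
  qed
qed

lemma len_word:
  assumes "g \<in> carrier G"
  obtains xs where "length xs = len g" "set xs \<subseteq> S" "word_prod G xs = g"
proof -
  have "\<exists>n xs. length xs = n \<and> set xs \<subseteq> S \<and> word_prod G xs = g" using word_ex[OF assms] by blast
  then have "\<exists>xs. length xs = len g \<and> set xs \<subseteq> S \<and> word_prod G xs = g"
    unfolding word_length_def by (rule LeastI_ex)
  then show ?thesis using that by blast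
qed

lemma len_le: "set xs \<subseteq> S \<Longrightarrow> len (word_prod G xs) \<le> length xs"
  unfolding word_length_def by (rule Least_le) blast

lemma len_one [simp]: "len \<one> = 0"
  using len_le[of "[]"] by simp

lemma len_eq_0: "g \<in> carrier G \<Longrightarrow> len g = 0 \<longleftrightarrow> g = \<one>"
  by (metis len_one len_word length_0_conv word_prod_Nil)

lemma len_mult:
  assumes "g \<in> carrier G" "h \<in> carrier G" shows "len (g \<otimes> h) \<le> len g + len h"
proof -
  obtain xs ys where "length xs = len g" "set xs \<subseteq> S" "word_prod G xs = g"
     "length ys = len h" "set ys \<subseteq> S" "word_prod G ys = h"
    using assms len_word by metis
  then show ?thesis using len_le[of "xs @ ys"] by (auto simp: subset_trans[OF _ S_sub])
qed

lemma len_inv_le: assumes "g \<in> carrier G" shows "len (inv g) \<le> len g"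
proof -
  obtain xs where xs: "length xs = len g" "set xs \<subseteq> S" "word_prod G xs = g"
    using assms len_word by metis
  have "set (rev (map (\<lambda>x. inv x) xs)) \<subseteq> S" using xs(2) S_inv by auto
  from len_le[OF this] show ?thesis using xs S_sub by (simp add: word_prod_inv subset_trans[OF _ S_sub])
qed

lemma len_inv [simp]: "g \<in> carrier G \<Longrightarrow> len (inv g) = len g"
  using len_inv_le[of g] len_inv_le[of "inv g"] by simp

lemma wd_one [simp]: "x \<in> carrier G \<Longrightarrow> wd \<one> x = len x"
  by (simp add: word_dist_def)

lemma wd_commute: "\<lbrakk>x \<in> carrier G; y \<in> carrier G\<rbrakk> \<Longrightarrow> wd x y = wd y x"
  unfolding word_dist_def using len_inv[of "inv x \<otimes> y"] by (simp add: inv_mult_group)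

lemma wd_triangle: "\<lbrakk>x \<in> carrier G; y \<in> carrier G; z \<in> carrier G\<rbrakk> \<Longrightarrow> wd x z \<le> wd x y + wd y z"
  unfolding word_dist_def using len_mult[of "inv x \<otimes> y" "inv y \<otimes> z"] by (simp add: inv_mult_cancel)

lemma wd_left [simp]:
  "\<lbrakk>g \<in> carrier G; x \<in> carrier G; y \<in> carrier G\<rbrakk> \<Longrightarrow> wd (g \<otimes> x) (g \<otimes> y) = wd x y"
  by (simp add: word_dist_def inv_mult_left)

lemma wd_right_mult:
  "\<lbrakk>x \<in> carrier G; y \<in> carrier G\<rbrakk> \<Longrightarrow> wd x (x \<otimes> y) = len y"
  by (simp add: word_dist_def m_assoc[symmetric])

definition wball :: "nat \<Rightarrow> 'a set" where "wball n = {g \<in> carrier G. len g \<le> n}"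

lemma wball_card: "finite (wball n) \<and> card (wball n) \<le> (card S + 1) ^ n"
proof (induction n)
  case 0
  have "wball 0 = {\<one>}" by (auto simp: wball_def len_eq_0)
  then show ?case by simp
next
  case (Suc n)
  \<comment> \<open>The unit is adjoined so that the empty word, too, is a letter times an element
    of the smaller ball.\<close>
  let ?T = "insert \<one> S \<times> wball n"
  have sub: "wball (Suc n) \<subseteq> (\<lambda>(a, b). a \<otimes> b) ` ?T"
  proof
    fix g assume g: "g \<in> wball (Suc n)"
    then obtain xs where xs: "length xs = len g" "set xs \<subseteq> S" "word_prod G xs = g"
      using len_word by (auto simp: wball_def)
    show "g \<in> (\<lambda>(a, b). a \<otimes> b) ` ?T"
    proof (cases xs)
      case Nil
      then have "g = (\<lambda>(a, b). a \<otimes> b) (\<one>, \<one>)" using xs by auto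
      then show ?thesis by (rule image_eqI) (simp add: wball_def)
    next
      case (Cons a ys)
      then have "len (word_prod G ys) \<le> n" using xs len_le[of ys] g by (auto simp: wball_def)
      then have "(a, word_prod G ys) \<in> ?T" using xs Cons
        by (auto simp: wball_def subset_trans[OF _ S_sub])
      moreover have "g = (\<lambda>(a, b). a \<otimes> b) (a, word_prod G ys)" using xs Cons by simp
      ultimately show ?thesis by (rule rev_image_eqI)
    qed
  qed
  have fin: "finite ?T" using Suc finite_S by auto
  then have "card (wball (Suc n)) \<le> card ?T"
    using sub by (meson card_image_le card_mono finite_imageI order_trans)
  also have "\<dots> \<le> (card S + 1) * card (wball n)"
    using finite_S by (simp add: card_cartesian_product card_insert_if)
  also have "\<dots> \<le> (card S + 1) * (card S + 1) ^ n" using Suc by (intro mult_left_mono) auto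
  finally show ?case using fin sub by (auto intro: finite_subset)
qed

lemma finite_wball [simp]: "finite (wball n)"
  using wball_card by blast

lemma wball_around:
  assumes "w \<in> carrier G"
  shows "{g \<in> carrier G. wd w g \<le> n} = (\<lambda>g. w \<otimes> g) ` wball n"
proof (intro equalityI subsetI)
  fix g assume "g \<in> {g \<in> carrier G. wd w g \<le> n}"
  then show "g \<in> (\<lambda>g. w \<otimes> g) ` wball n" using assms
    by (intro image_eqI[of _ _ "inv w \<otimes> g"]) (auto simp: wball_def word_dist_def mult_cancel_inv)
qed (use assms in \<open>auto simp: wball_def wd_right_mult\<close>)

lemma finite_wball_around [simp]: "w \<in> carrier G \<Longrightarrow> finite {g \<in> carrier G. wd w g \<le> n}"
  by (simp add: wball_around)

lemma card_wball_around: "w \<in> carrier G \<Longrightarrow> card {g \<in> carrier G. wd w g \<le> n} = card (wball n)"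
  unfolding wball_around by (rule card_image) (auto intro!: inj_onI simp: wball_def)

lemma countable_carrier: "countable (carrier G)"
proof -
  have "carrier G = (\<Union>n. wball n)" by (auto simp: wball_def)
  then show ?thesis by (auto intro!: countable_UN simp: countable_finite)
qed

text \<open>Only the vertices \<open>p 0, \<dots>, p n\<close> matter; \<open>n\<close> is then the distance of the end points.\<close>

definition geodesic :: "(nat \<Rightarrow> 'a) \<Rightarrow> nat \<Rightarrow> bool" where
  "geodesic p n \<longleftrightarrow> (\<forall>i\<le>n. p i \<in> carrier G) \<and> (\<forall>i<n. inv (p i) \<otimes> p (Suc i) \<in> S) \<and>
     (\<forall>i j. i \<le> j \<longrightarrow> j \<le> n \<longrightarrow> wd (p i) (p j) = j - i)"

text \<open>The vertices are the prefixes of a shortest word: two prefixes closer than the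
  difference of their indices would shorten the whole word.\<close>

lemma geodesic_ex:
  assumes "x \<in> carrier G" "y \<in> carrier G"
  obtains p where "geodesic p (wd x y)" "p 0 = x" "p (wd x y) = y"
proof -
  obtain xs where xs: "length xs = wd x y" "set xs \<subseteq> S" "word_prod G xs = inv x \<otimes> y"
    using assms len_word[of "inv x \<otimes> y"] by (auto simp: word_dist_def)
  define p where "p i = x \<otimes> word_prod G (take i xs)" for i
  have sub: "set (take i xs) \<subseteq> S" "set (drop i xs) \<subseteq> S" for i
    using xs(2) by (meson set_take_subset set_drop_subset subset_trans)+
  have subc: "set xs \<subseteq> carrier G" "\<And>i. set (take i xs) \<subseteq> carrier G" "\<And>i. set (drop i xs) \<subseteq> carrier G" 
    using S_sub sub xs(2) by blast+
  have pc: "p i \<in> carrier G" for i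
    using subc(2)[of i] assms by (simp add: p_def)
  have p0: "p 0 = x" and pn: "p (wd x y) = y"
    using assms xs by (auto simp: p_def m_assoc[symmetric])
  have diff: "inv (p i) \<otimes> p j = word_prod G (take (j - i) (drop i xs))" if "i \<le> j" for i j
  proof -
    have "take j xs = take i xs @ take (j - i) (drop i xs)"
      using that by (metis le_add_diff_inverse take_add)
    moreover have "set (take (j - i) (drop i xs)) \<subseteq> carrier G"
      using subc(3)[of i] by (meson set_take_subset subset_trans)
    ultimately have "p j = p i \<otimes> word_prod G (take (j - i) (drop i xs))"
      using subc assms by (simp add: p_def m_assoc)
    then show ?thesis using pc \<open>set (take (j - i) (drop i xs)) \<subseteq> carrier G\<close>
      by (simp add: m_assoc[symmetric])
  qed
  have le: "wd (p i) (p j) \<le> j - i" if "i \<le> j" for i j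
  proof -
    have "set (take (j - i) (drop i xs)) \<subseteq> S"
      using sub(2)[of i] by (meson set_take_subset subset_trans)
    from len_le[OF this] show ?thesis using diff[OF that] by (simp add: word_dist_def)
  qed
  have "wd (p i) (p j) = j - i" if "i \<le> j" "j \<le> wd x y" for i j
  proof -
    have "wd x y \<le> wd x (p i) + (wd (p i) (p j) + wd (p j) y)"
      using wd_triangle[of x "p i" y] wd_triangle[of "p i" "p j" y] pc assms by fastforce
    moreover have "wd x (p i) \<le> i" using le[of 0 i] p0 by simp
    moreover have "wd (p j) y \<le> wd x y - j" using le[of j "wd x y"] pn that by simp
    ultimately show ?thesis using le[of i j] that by linarith
  qed
  moreover have "inv (p i) \<otimes> p (Suc i) \<in> S" if "i < wd x y" for i
  proof -
    have "take 1 (drop i xs) = [xs ! i]" using that xs(1) by (simp add: take_Suc hd_drop_conv_nth)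
    then have "inv (p i) \<otimes> p (Suc i) = xs ! i"
      using diff[of i "Suc i"] xs that subc by (auto simp: subset_iff)
    then show ?thesis using xs that by auto
  qed
  ultimately have "geodesic p (wd x y)" using pc by (simp add: geodesic_def)
  then show ?thesis using that p0 pn by blast
qed

end

section \<open>The Floyd metric\<close>

text \<open>The terms from \<open>n div 2\<close> up to \<open>n\<close> are all at least
  \<open>g n\<close>, so half of \<open>n * g n\<close> is bounded by a Cauchy tail of the
  series.\<close>

lemma antimono_summable_imp_mult_tendsto_0:
  fixes g :: "nat \<Rightarrow> real"
  assumes anti: "antimono g" and nonneg: "\<And>n. g n \<ge> 0" and summ: "summable g"
  shows "(\<lambda>n. real n * g n) \<longlonglongrightarrow> 0"
proof (rule LIMSEQ_I)
  fix e :: real assume "e > 0"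
  then obtain N where N: "\<And>m n. m \<ge> N \<Longrightarrow> norm (sum g {m..<n}) < e / 2"
    using summ unfolding summable_Cauchy by (meson half_gt_zero)
  show "\<exists>no. \<forall>n\<ge>no. norm (real n * g n - 0) < e"
  proof (intro exI[of _ "2 * N"] allI impI)
    fix n assume n: "n \<ge> 2 * N"
    have "real n / 2 * g n \<le> real (n - n div 2) * g n" using nonneg by (intro mult_right_mono) auto
    also have "\<dots> = (\<Sum>k=n div 2..<n. g n)" by simp
    also have "\<dots> \<le> sum g {n div 2..<n}" by (intro sum_mono antimonoD[OF anti]) auto
    also have "\<dots> < e / 2" using N[of "n div 2" n] n by fastforce
    finally show "norm (real n * g n - 0) < e" using nonneg by simp
  qed
qed

locale floyd_group = marked_group +
  fixes f :: "real \<Rightarrow> real"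
  assumes floyd_f: "floyd_function f"
begin

abbreviation fd :: "'a \<Rightarrow> 'a \<Rightarrow> 'a \<Rightarrow> real" where "fd \<equiv> floyd_dist G S f"
abbreviation fl :: "'a \<Rightarrow> 'a list \<Rightarrow> real" where "fl \<equiv> floyd_length G S f"
abbreviation fn :: "nat \<Rightarrow> real" where "fn n \<equiv> f (real n)"

lemma fn_pos [simp]: "fn n > 0" and fn_nonneg [simp]: "fn n \<ge> 0"
  using floyd_f by (auto simp: floyd_function_def less_imp_le)

lemma fn_antimono: "m \<le> n \<Longrightarrow> fn n \<le> fn m"
  using floyd_f by (auto simp: floyd_function_def monotone_on_def)

lemma antimono_fn: "antimono fn"
  using fn_antimono by (auto simp: antimono_def)

lemma fn_summable: "summable fn"
  using floyd_f by (auto simp: floyd_function_def)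

lemma fn_shift:
  obtains \<kappa> where "\<kappa> \<ge> 1" "\<And>n k. fn n \<le> \<kappa> ^ k * fn (n + k)"
proof -
  obtain \<kappa> where \<kappa>: "\<kappa> \<ge> 1" "\<And>n. fn n / fn (n + 1) \<le> \<kappa>"
    using floyd_f by (auto simp: floyd_function_def)
  have "fn n \<le> \<kappa> ^ k * fn (n + k)" for n k
  proof (induction k)
    case (Suc k)
    have "fn (n + k) \<le> \<kappa> * fn (n + Suc k)"
      using \<kappa>(2)[of "n + k"] fn_pos[of "n + k + 1"] by (simp add: divide_le_eq)
    then have "\<kappa> ^ k * fn (n + k) \<le> \<kappa> ^ k * (\<kappa> * fn (n + Suc k))"
      using \<kappa>(1) by (intro mult_left_mono) auto
    then show ?case using Suc by (simp add: mult_ac)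
  qed simp
  then show ?thesis using \<kappa>(1) that by blast
qed

section \<open>Edge paths and the Floyd distance as a left-invariant family of metrics\<close>

lemma fl_simps [simp]:
  "fl v [x] = 0"
  "fl v (x # y # p) = fn (min (wd v x) (wd v y)) + fl v (y # p)"
  by (simp_all add: floyd_length_def sum.lessThan_Suc_shift del: sum.lessThan_Suc)

lemma fl_nonneg: "fl v p \<ge> 0"
  unfolding floyd_length_def by (intro sum_nonneg) auto

lemma edge_pathsI:
  assumes "\<And>i. i \<le> n \<Longrightarrow> p i \<in> carrier G" "\<And>i. i < n \<Longrightarrow> inv (p i) \<otimes> p (Suc i) \<in> S"
  shows "map p [0..<Suc n] \<in> edge_paths G S (p 0) (p n)"
  using assms by (auto simp: edge_paths_def successively_conv_nth hd_map last_map nth_append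
      simp del: upt_Suc)

lemma edge_paths_ne: "\<lbrakk>x \<in> carrier G; y \<in> carrier G\<rbrakk> \<Longrightarrow> edge_paths G S x y \<noteq> {}"
  using edge_pathsI geodesic_ex[of x y] unfolding geodesic_def
  by (metis empty_iff)

lemma fd_le: "p \<in> edge_paths G S x y \<Longrightarrow> fd v x y \<le> fl v p"
  unfolding floyd_dist_def
  by (rule cINF_lower) (auto intro!: bdd_belowI[of _ 0] simp: fl_nonneg)

lemma fd_greatest:
  "\<lbrakk>x \<in> carrier G; y \<in> carrier G; \<And>p. p \<in> edge_paths G S x y \<Longrightarrow> c \<le> fl v p\<rbrakk> \<Longrightarrow> c \<le> fd v x y"
  unfolding floyd_dist_def by (rule cINF_greatest[OF edge_paths_ne])

lemma fd_nonneg: "\<lbrakk>x \<in> carrier G; y \<in> carrier G\<rbrakk> \<Longrightarrow> fd v x y \<ge> 0"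
  by (rule fd_greatest) (auto simp: fl_nonneg)

lemma fd_self [simp]: "x \<in> carrier G \<Longrightarrow> fd v x x = 0"
  using fd_le[of "[x]" x x v] fd_nonneg[of x x v] by (simp add: edge_paths_def)

lemma fl_rev: "fl v (rev p) = fl v p"
proof -
  let ?n = "length p - 1"
  have "fl v (rev p) = (\<Sum>i<?n. fn (min (wd v (p ! Suc (?n - Suc i))) (wd v (p ! (?n - Suc i)))))"
    unfolding floyd_length_def length_rev
    by (intro sum.cong) (auto simp: rev_nth Suc_diff_Suc)
  also have "\<dots> = (\<Sum>i<?n. fn (min (wd v (p ! Suc i)) (wd v (p ! i))))"
    by (rule sum.nat_diff_reindex)
  finally show ?thesis by (simp add: floyd_length_def min.commute)
qed

lemma fd_commute:
  assumes "x \<in> carrier G" "y \<in> carrier G" shows "fd v x y = fd v y x"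
proof -
  have "fd v x y \<le> fd v y x" if xy: "x \<in> carrier G" "y \<in> carrier G" for x y
  proof (rule fd_greatest[OF xy(2,1)])
    fix p assume p: "p \<in> edge_paths G S y x"
    have "inv b \<otimes> a \<in> S" if "inv a \<otimes> b \<in> S" "a \<in> carrier G" "b \<in> carrier G" for a b
      using S_inv[OF that(1)] that by (simp add: inv_mult_group)
    then have "rev p \<in> edge_paths G S x y"
      using p by (auto simp: edge_paths_def hd_rev last_rev elim!: successively_mono)
    then show "fd v x y \<le> fl v p" using fd_le fl_rev by metis
  qed
  then show ?thesis using assms by (intro antisym) auto
qed

lemma fl_append: "p \<noteq> [] \<Longrightarrow> fl v (p @ q) = fl v p + fl v (last p # q)"
proof (induction p)
  case (Cons a p)
  then show ?case by (cases p) auto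
qed simp

lemma fd_triangle:
  assumes "x \<in> carrier G" "y \<in> carrier G" "z \<in> carrier G"
  shows "fd v x z \<le> fd v x y + fd v y z"
proof -
  have "fd v x z \<le> fl v p + fl v q"
    if p: "p \<in> edge_paths G S x y" and q: "q \<in> edge_paths G S y z" for p q
  proof -
    obtain q' where q': "q = y # q'" using q by (cases q) (auto simp: edge_paths_def)
    have "p @ q' \<in> edge_paths G S x z"
      using p q by (auto simp: edge_paths_def q' successively_append_iff successively_Cons
          split: if_splits)
    from fd_le[OF this, of v] show ?thesis using p by (simp add: fl_append q' edge_paths_def)
  qed
  then have "fd v x z - fl v p \<le> fd v y z" if "p \<in> edge_paths G S x y" for p
    using that assms by (intro fd_greatest) (force simp: diff_le_eq add.commute)+
  then have "fd v x z - fd v y z \<le> fd v x y"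
    using assms by (intro fd_greatest) (auto simp: algebra_simps)
  then show ?thesis by simp
qed

lemma fd_edge:
  assumes "a \<in> carrier G" "b \<in> carrier G" "inv a \<otimes> b \<in> S"
  shows "fd v a b \<le> fn (min (wd v a) (wd v b))"
  using fd_le[of "[a, b]" a b v] assms by (simp add: edge_paths_def)

lemma fd_path:
  assumes "\<And>i. i \<le> n \<Longrightarrow> p i \<in> carrier G" "\<And>i. i < n \<Longrightarrow> inv (p i) \<otimes> p (Suc i) \<in> S"
  shows "fd v (p 0) (p n) \<le> (\<Sum>i<n. fn (min (wd v (p i)) (wd v (p (Suc i)))))"
  using assms
proof (induction n)
  case (Suc n)
  have "fd v (p 0) (p (Suc n)) \<le> fd v (p 0) (p n) + fd v (p n) (p (Suc n))"
    using Suc.prems by (intro fd_triangle) auto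
  moreover have "fd v (p n) (p (Suc n)) \<le> fn (min (wd v (p n)) (wd v (p (Suc n))))"
    using Suc.prems by (intro fd_edge) auto
  moreover have "fd v (p 0) (p n) \<le> (\<Sum>i<n. fn (min (wd v (p i)) (wd v (p (Suc i)))))"
    using Suc.prems by (intro Suc.IH) auto
  ultimately show ?case by simp
qed simp

lemma fd_left_le:
  assumes "g \<in> carrier G" "v \<in> carrier G" "x \<in> carrier G" "y \<in> carrier G"
  shows "fd (g \<otimes> v) (g \<otimes> x) (g \<otimes> y) \<le> fd v x y"
proof (rule fd_greatest)
  fix p assume p: "p \<in> edge_paths G S x y"
  have "map (\<lambda>z. g \<otimes> z) p \<in> edge_paths G S (g \<otimes> x) (g \<otimes> y)"
    using p assms by (auto simp: edge_paths_def hd_map last_map successively_map inv_mult_left subset_iff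
        elim!: successively_mono)
  moreover have "fl (g \<otimes> v) (map (\<lambda>z. g \<otimes> z) p) = fl v p"
    unfolding floyd_length_def length_map
  proof (rule sum.cong)
    fix i assume "i \<in> {..<length p - 1}"
    then have "i < length p" "Suc i < length p" "p ! i \<in> carrier G" "p ! Suc i \<in> carrier G"
      using p by (auto simp: edge_paths_def subset_iff)
    then show "fn (min (wd (g \<otimes> v) (map (\<lambda>z. g \<otimes> z) p ! i)) (wd (g \<otimes> v) (map (\<lambda>z. g \<otimes> z) p ! Suc i))) =
       fn (min (wd v (p ! i)) (wd v (p ! Suc i)))"
      using assms by simp
  qed simp
  ultimately show "fd (g \<otimes> v) (g \<otimes> x) (g \<otimes> y) \<le> fl v p"
    using fd_le by metis
qed (use assms in auto)

lemma fd_left [simp]: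
  assumes "g \<in> carrier G" "v \<in> carrier G" "x \<in> carrier G" "y \<in> carrier G"
  shows "fd (g \<otimes> v) (g \<otimes> x) (g \<otimes> y) = fd v x y"
  using fd_left_le[OF assms] fd_left_le[of "inv g" "g \<otimes> v" "g \<otimes> x" "g \<otimes> y"] assms
  by (simp add: mult_cancel_inv)

lemma fd_translate:
  assumes "g \<in> carrier G" "x \<in> carrier G" "y \<in> carrier G"
  shows "fd g x y = fd \<one> (inv g \<otimes> x) (inv g \<otimes> y)"
  using fd_left[of "inv g" g x y] assms by simp

text \<open>Moving the base point shifts the distance of every edge by at most
  \<open>wd v w\<close>, which by \<open>fn_shift\<close> costs at most the factor
  \<open>\<kappa> ^ wd v w\<close> per edge. This is where the bounded ratio of a Floyd function
  lets the group act on the completion.\<close>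

lemma fd_change_base:
  obtains \<kappa> where "\<kappa> \<ge> 1"
    "\<And>v w x y. \<lbrakk>v \<in> carrier G; w \<in> carrier G; x \<in> carrier G; y \<in> carrier G\<rbrakk> \<Longrightarrow>
        fd v x y \<le> \<kappa> ^ wd v w * fd w x y"
proof -
  obtain \<kappa> where \<kappa>: "\<kappa> \<ge> 1" "\<And>n k. fn n \<le> \<kappa> ^ k * fn (n + k)" using fn_shift by blast
  have "fd v x y \<le> \<kappa> ^ wd v w * fd w x y"
    if c: "v \<in> carrier G" "w \<in> carrier G" "x \<in> carrier G" "y \<in> carrier G" for v w x y
  proof -
    have "fd v x y / \<kappa> ^ wd v w \<le> fl w p" if p: "p \<in> edge_paths G S x y" for p
    proof -
      have "fd v x y \<le> fl v p" using p by (rule fd_le)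
      also have "\<dots> \<le> (\<Sum>i<length p - 1. \<kappa> ^ wd v w * fn (min (wd w (p ! i)) (wd w (p ! Suc i))))"
        unfolding floyd_length_def
      proof (rule sum_mono)
        fix i assume i: "i \<in> {..<length p - 1}"
        then have "p ! i \<in> carrier G" "p ! Suc i \<in> carrier G"
          using p by (auto simp: edge_paths_def subset_iff)
        then have le: "min (wd w (p ! i)) (wd w (p ! Suc i)) \<le> min (wd v (p ! i)) (wd v (p ! Suc i)) + wd v w"
          using wd_triangle[of w v "p ! i"] wd_triangle[of w v "p ! Suc i"] c wd_commute[of v w] by auto
        have "fn (min (wd v (p ! i)) (wd v (p ! Suc i))) \<le>
            \<kappa> ^ wd v w * fn (min (wd v (p ! i)) (wd v (p ! Suc i)) + wd v w)"
          by (rule \<kappa>(2))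
        also have "\<dots> \<le> \<kappa> ^ wd v w * fn (min (wd w (p ! i)) (wd w (p ! Suc i)))"
          using \<kappa>(1) le by (intro mult_left_mono fn_antimono) auto
        finally show "fn (min (wd v (p ! i)) (wd v (p ! Suc i))) \<le>
            \<kappa> ^ wd v w * fn (min (wd w (p ! i)) (wd w (p ! Suc i)))" .
      qed
      also have "\<dots> = \<kappa> ^ wd v w * fl w p" by (simp add: floyd_length_def sum_distrib_left)
      finally show ?thesis using \<kappa>(1) by (simp add: divide_le_eq mult.commute)
    qed
    then have "fd v x y / \<kappa> ^ wd v w \<le> fd w x y" using c by (intro fd_greatest) auto
    then show ?thesis using \<kappa>(1) by (simp add: divide_le_eq mult.commute)
  qed
  then show ?thesis using \<kappa>(1) that by blast
qed

text \<open>An infimum of positive lengths might vanish, but every path from \<open>x\<close> to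
  another point starts with an edge at distance at most \<open>wd v x\<close>, of length at least
  \<open>fn (wd v x)\<close>.\<close>

lemma fd_pos:
  assumes "x \<in> carrier G" "y \<in> carrier G" "x \<noteq> y" shows "fd v x y > 0"
proof -
  have "fn (wd v x) \<le> fd v x y"
  proof (rule fd_greatest)
    fix p assume p: "p \<in> edge_paths G S x y"
    obtain a b q where q: "p = a # b # q"
      using p assms(3) by (cases p rule: remdups_adj.cases) (auto simp: edge_paths_def)
    then have "a = x" using p by (simp add: edge_paths_def)
    have "fn (wd v x) \<le> fn (min (wd v x) (wd v b))" by (rule fn_antimono) simp
    also have "\<dots> \<le> fl v p" using fl_nonneg[of v "b # q"] by (simp add: q \<open>a = x\<close>)
    finally show "fn (wd v x) \<le> fl v p" .
  qed (use assms in auto)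
  then show ?thesis using fn_pos[of "wd v x"] by linarith
qed

text \<open>Edge \<open>i\<close> lies at distance at least \<open>max \<rho> (i - \<rho>)\<close>
  from \<open>v\<close>. The first \<open>2 * \<rho>\<close> edges cost at most
  \<open>fn \<rho>\<close> each, the later ones run through a tail of the series; both parts are
  small for large \<open>\<rho>\<close>.\<close>

lemma fd_escaping_path:
  assumes "\<And>i. i \<le> n \<Longrightarrow> q i \<in> carrier G" "\<And>i. i < n \<Longrightarrow> inv (q i) \<otimes> q (Suc i) \<in> S"
    and lower: "\<And>i. i \<le> n \<Longrightarrow> wd v (q i) \<ge> \<rho>" "\<And>i. i \<le> n \<Longrightarrow> wd v (q i) + \<rho> \<ge> i"
  shows "fd v (q 0) (q n) \<le> 2 * (real \<rho> * fn \<rho>) + sum fn {\<rho>..<\<rho> + n}"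
proof -
  have "fd v (q 0) (q n) \<le> (\<Sum>i<n. fn (min (wd v (q i)) (wd v (q (Suc i)))))"
    using assms(1,2) by (rule fd_path)
  also have "\<dots> \<le> (\<Sum>i<n. fn (max \<rho> (i - \<rho>)))"
  proof (rule sum_mono)
    fix i assume "i \<in> {..<n}"
    then show "fn (min (wd v (q i)) (wd v (q (Suc i)))) \<le> fn (max \<rho> (i - \<rho>))"
      using lower[of i] lower[of "Suc i"] by (intro fn_antimono) auto
  qed
  also have "\<dots> \<le> (\<Sum>i\<in>{..<2 * \<rho>} \<union> {2 * \<rho>..<2 * \<rho> + n}. fn (max \<rho> (i - \<rho>)))"
    by (intro sum_mono2) auto
  also have "\<dots> = (\<Sum>i<2 * \<rho>. fn (max \<rho> (i - \<rho>))) + (\<Sum>i=2 * \<rho>..<2 * \<rho> + n. fn (max \<rho> (i - \<rho>)))"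
    by (intro sum.union_disjoint) auto
  also have "(\<Sum>i<2 * \<rho>. fn (max \<rho> (i - \<rho>))) \<le> (\<Sum>i<2 * \<rho>. fn \<rho>)"
    by (intro sum_mono fn_antimono) auto
  also have "(\<Sum>i=2 * \<rho>..<2 * \<rho> + n. fn (max \<rho> (i - \<rho>))) = (\<Sum>i=\<rho>..<\<rho> + n. fn i)"
    by (rule sum.reindex_bij_witness[of _ "\<lambda>i. i + \<rho>" "\<lambda>i. i - \<rho>"]) (auto simp: max_def)
  finally show ?thesis by simp
qed

text \<open>Karlsson's lemma: a geodesic far from \<open>w\<close> is short as seen from
  \<open>w\<close>. Cut at its point closest to \<open>w\<close>, it falls into two branches
  escaping from \<open>w\<close>, and the bound involves only the distance \<open>\<rho>\<close> of
  that point; so \<open>R\<close> is uniform in \<open>w\<close>.\<close>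

lemma karlsson:
  assumes "\<delta> > 0"
  obtains R where "\<And>w p n. \<lbrakk>w \<in> carrier G; geodesic p n; fd w (p 0) (p n) \<ge> \<delta>\<rbrakk> \<Longrightarrow>
     \<exists>i\<le>n. wd w (p i) \<le> R"
proof -
  \<comment> \<open>With sixths, each branch costs less than 2/6 + 1/6, that is half of
    \<open>\<delta>\<close>.\<close>
  obtain N1 where N1: "\<And>m n. m \<ge> N1 \<Longrightarrow> norm (sum fn {m..<n}) < \<delta> / 6"
    using fn_summable assms unfolding summable_Cauchy by (meson zero_less_divide_iff zero_less_numeral)
  obtain N2 where N2: "\<And>m. m \<ge> N2 \<Longrightarrow> norm (real m * fn m - 0) < \<delta> / 6"
    using LIMSEQ_D[OF antimono_summable_imp_mult_tendsto_0[OF antimono_fn fn_nonneg fn_summable], of "\<delta> / 6"] assms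
    by auto
  show ?thesis
  proof (rule that[of "max N1 N2"], rule ccontr)
    fix w p n assume w: "w \<in> carrier G" and p: "geodesic p n" and \<delta>: "fd w (p 0) (p n) \<ge> \<delta>"
      and "\<not> (\<exists>i\<le>n. wd w (p i) \<le> max N1 N2)"
    then have far: "wd w (p i) > max N1 N2" if "i \<le> n" for i using that by auto
    have pc: "p i \<in> carrier G" if "i \<le> n" for i using p that by (auto simp: geodesic_def)
    obtain j where j: "j \<le> n" "\<And>i. i \<le> n \<Longrightarrow> wd w (p j) \<le> wd w (p i)"
      using arg_min_nat_lemma[of "\<lambda>i. i \<le> n" 0 "\<lambda>i. wd w (p i)"] by auto
    define \<rho> where "\<rho> = wd w (p j)"
    have \<rho>: "\<rho> \<ge> N1" "\<rho> \<ge> N2" using far[OF j(1)] by (auto simp: \<rho>_def)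
    \<comment> \<open>The closest point is at distance \<open>\<rho>\<close> from \<open>w\<close>,
      so a vertex \<open>i\<close> steps away from it along the geodesic is at least
      \<open>i - \<rho>\<close> from \<open>w\<close>.\<close>
    have tri: "i \<le> wd w (p k) + \<rho>" if "k \<le> n" "wd (p k) (p j) = i" for i k
      using wd_triangle[of "p k" w "p j"] w pc[OF that(1)] pc[OF j(1)] that wd_commute[of w "p k"]
      by (simp add: \<rho>_def)
    have g: "wd (p i) (p k) = k - i" if "i \<le> k" "k \<le> n" for i k
      using p that by (auto simp: geodesic_def)
    have st: "inv (p i) \<otimes> p (Suc i) \<in> S" if "i < n" for i
      using p that by (auto simp: geodesic_def)
    have st': "inv (p (Suc i)) \<otimes> p i \<in> S" if "i < n" for i
      using S_inv[OF st[OF that]] pc that by (simp add: inv_mult_group)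
    have small: "2 * (real \<rho> * fn \<rho>) + sum fn {\<rho>..<\<rho> + m} < \<delta> / 2" for m
      using N1[OF \<rho>(1), of "\<rho> + m"] N2[OF \<rho>(2)] by (auto simp: abs_less_iff)
    \<comment> \<open>Both branches are read away from the closest point, as
      \<open>q i = p (j + i)\<close> here and \<open>q i = p (j - i)\<close> below; the summand 0
      makes the end points match.\<close>
    have "fd w (p (j + 0)) (p (j + (n - j))) \<le> 2 * (real \<rho> * fn \<rho>) + sum fn {\<rho>..<\<rho> + (n - j)}"
    proof (rule fd_escaping_path)
      fix i assume i: "i \<le> n - j"
      show "i \<le> wd w (p (j + i)) + \<rho>"
        using i j g[of j "j + i"] wd_commute[OF pc pc, of "j + i" j] by (intro tri) auto
    qed (use j pc st in \<open>auto simp: \<rho>_def\<close>)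
    moreover have "fd w (p (j - 0)) (p (j - j)) \<le> 2 * (real \<rho> * fn \<rho>) + sum fn {\<rho>..<\<rho> + j}"
    proof (rule fd_escaping_path)
      fix i assume i: "i < j"
      then have "j - i = Suc (j - Suc i)" by simp
      then show "inv (p (j - i)) \<otimes> p (j - Suc i) \<in> S" using st'[of "j - Suc i"] i j by simp
    next
      fix i assume i: "i \<le> j"
      show "i \<le> wd w (p (j - i)) + \<rho>"
        using i j g[of "j - i" j] by (intro tri) auto
    qed (use j pc in \<open>auto simp: \<rho>_def\<close>)
    ultimately have "fd w (p 0) (p n) < \<delta>"
      using small[of j] small[of "n - j"] fd_triangle[OF pc[of 0] pc[OF j(1)] pc[of n], of w]
        fd_commute[OF pc[of 0] pc[OF j(1)], of w] j(1) by simp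
    then show False using \<delta> by simp
  qed
qed

text \<open>On a geodesic issuing from the base point, edge \<open>k\<close> has length exactly
  \<open>fn k\<close>.\<close>

lemma fd_geodesic_tail:
  assumes p: "geodesic p n" "p 0 = v" and i: "i \<le> n"
  shows "fd v (p i) (p n) \<le> sum fn {i..<n}"
proof -
  have d: "wd v (p k) = k" if "k \<le> n" for k
    using p that by (auto simp: geodesic_def)
  have "fd v (p (i + 0)) (p (i + (n - i))) \<le>
      (\<Sum>k<n - i. fn (min (wd v (p (i + k))) (wd v (p (i + Suc k)))))"
    by (rule fd_path) (use p i in \<open>auto simp: geodesic_def\<close>)
  also have "\<dots> = (\<Sum>k<n - i. fn (i + k))"
    by (intro sum.cong) (auto simp: d)
  also have "\<dots> = sum fn {i..<n}"
    by (rule sum.reindex_bij_witness[of _ "\<lambda>k. k - i" "\<lambda>k. i + k"]) auto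
  finally show ?thesis using i by simp
qed

text \<open>A geodesic from \<open>x\<close> to \<open>y\<close> stays within \<open>wd x y\<close>
  of \<open>x\<close>. Truncated subtraction is harmless, since \<open>fn 0\<close> is the largest
  value.\<close>

lemma fd_near:
  assumes "x \<in> carrier G" "y \<in> carrier G" "v \<in> carrier G"
  shows "fd v x y \<le> real (wd x y) * fn (wd v x - wd x y)"
proof -
  obtain p where p: "geodesic p (wd x y)" "p 0 = x" "p (wd x y) = y"
    using geodesic_ex assms by metis
  have far: "wd v x - wd x y \<le> wd v (p i)" if "i \<le> wd x y" for i
  proof -
    have "p i \<in> carrier G" "wd x (p i) = i" using p that by (auto simp: geodesic_def)
    then show ?thesis using wd_triangle[of v "p i" x] wd_commute[of x "p i"] assms that by simp
  qed
  have "fd v (p 0) (p (wd x y)) \<le> (\<Sum>i<wd x y. fn (min (wd v (p i)) (wd v (p (Suc i)))))"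
    by (rule fd_path) (use p in \<open>auto simp: geodesic_def\<close>)
  also have "\<dots> \<le> (\<Sum>i<wd x y. fn (wd v x - wd x y))"
    using far by (intro sum_mono fn_antimono) auto
  finally show ?thesis using p by simp
qed

text \<open>The convergence property: far-out elements contract the complement of a neighbourhood of
  their repelling point \<open>inv g\<close> to a neighbourhood of their attracting point \<open>g\<close>.\<close>

lemma contraction:
  assumes "r > 0"
  obtains N where "\<And>g h. \<lbrakk>g \<in> carrier G; h \<in> carrier G; len g \<ge> N; fd \<one> h (inv g) \<ge> r\<rbrakk> \<Longrightarrow>
     fd \<one> (g \<otimes> h) g < r"
proof -
  obtain R where R: "\<And>w p n. \<lbrakk>w \<in> carrier G; geodesic p n; fd w (p 0) (p n) \<ge> r\<rbrakk> \<Longrightarrow>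
     \<exists>i\<le>n. wd w (p i) \<le> R" using karlsson[OF assms] by blast
  obtain N1 where N1: "\<And>m n. m \<ge> N1 \<Longrightarrow> norm (sum fn {m..<n}) < r / 2"
    using fn_summable assms unfolding summable_Cauchy by (meson half_gt_zero)
  have "fn \<longlonglongrightarrow> 0" by (rule summable_LIMSEQ_zero[OF fn_summable])
  then have "(\<lambda>n. real R * fn n) \<longlonglongrightarrow> 0" by (rule tendsto_mult_right_zero)
  from LIMSEQ_D[OF this, of "r / 2"] obtain N2 where N2: "\<And>m. m \<ge> N2 \<Longrightarrow> real R * fn m < r / 2"
    using assms by (auto simp: abs_less_iff)
  show ?thesis
  \<comment> \<open>The geodesic from \<open>\<one>\<close> to \<open>g \<otimes> h\<close> will
    pass within \<open>R\<close> of \<open>g\<close> at some index \<open>i\<close>. This length of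
    \<open>g\<close> forces \<open>i \<ge> N1\<close>, and keeps a geodesic from \<open>g\<close> to
    that vertex at distance at least \<open>N2\<close> from \<open>\<one>\<close>.\<close>
  proof (rule that[of "N1 + N2 + R"])
    fix g h assume g: "g \<in> carrier G" and h: "h \<in> carrier G" and len: "len g \<ge> N1 + N2 + R"
      and r: "fd \<one> h (inv g) \<ge> r"
    let ?y = "g \<otimes> h"
    obtain p where p: "geodesic p (wd \<one> ?y)" "p 0 = \<one>" "p (wd \<one> ?y) = ?y"
      using geodesic_ex[of \<one> ?y] g h by auto
    \<comment> \<open>Translated by \<open>g\<close>, the hypothesis says that \<open>\<one>\<close>
      and \<open>g \<otimes> h\<close> are far apart as seen from \<open>g\<close>: the input for
      \<open>karlsson\<close>.\<close>
    have "fd g \<one> ?y \<ge> r"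
      using r fd_commute[of h "inv g" \<one>] fd_translate[of g \<one> ?y] g h by (simp add: mult_cancel_inv)
    then obtain i where i: "i \<le> wd \<one> ?y" "wd g (p i) \<le> R" using R[OF g p(1)] p by auto
    have "wd (p 0) (p i) = i - 0" using p(1) i(1) unfolding geodesic_def by blast
    then have pi: "p i \<in> carrier G" "wd \<one> (p i) = i"
      using p i by (auto simp: geodesic_def)
    have "len g \<le> i + R"
      using wd_triangle[of \<one> "p i" g] wd_commute[OF g pi(1)] pi g i by simp
    then have iN: "i \<ge> N1" "len g - wd g (p i) \<ge> N2" using len i by auto
    have "fd \<one> g (p i) \<le> real (wd g (p i)) * fn (len g - wd g (p i))"
      using fd_near[OF g pi(1) one_closed] g by simp
    also have "\<dots> \<le> real R * fn (len g - wd g (p i))" using i by (intro mult_right_mono) auto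
    also have "\<dots> < r / 2" using N2 iN by simp
    finally have "fd \<one> g (p i) < r / 2" .
    moreover have "fd \<one> (p i) ?y < r / 2"
      using fd_geodesic_tail[OF p(1,2) i(1)] N1[OF iN(1), of "wd \<one> ?y"] p(3) by (auto simp: abs_less_iff)
    ultimately have "fd \<one> g ?y < r" using fd_triangle[OF g pi(1), of ?y \<one>] g h by simp
    then show "fd \<one> ?y g < r" using fd_commute[of g ?y \<one>] g h by simp
  qed
qed

end

section \<open>Thin boundary, linear growth or ping-pong\<close>

context floyd_group
begin

section \<open>Points of the Floyd boundary as Cauchy sequences\<close>

abbreviation to_infinity :: "(nat \<Rightarrow> 'a) \<Rightarrow> bool" where
  "to_infinity x \<equiv> filterlim (\<lambda>n. len (x n)) at_top sequentially"

text \<open>Cauchy sequences stand for points of the Floyd completion, with \<open>fsim\<close> as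
  equality of limits and \<open>act\<close> as the extended action; those with
  \<open>to_infinity\<close> are the boundary points. The completion itself is never formed.\<close>

definition fcauchy :: "(nat \<Rightarrow> 'a) \<Rightarrow> bool" where
  "fcauchy x \<longleftrightarrow> range x \<subseteq> carrier G \<and> (\<forall>e>0. \<exists>N. \<forall>m\<ge>N. \<forall>n\<ge>N. fd \<one> (x m) (x n) < e)"

definition fsim :: "(nat \<Rightarrow> 'a) \<Rightarrow> (nat \<Rightarrow> 'a) \<Rightarrow> bool" where
  "fsim x y \<longleftrightarrow> (\<lambda>n. fd \<one> (x n) (y n)) \<longlonglongrightarrow> 0"

definition act :: "'a \<Rightarrow> (nat \<Rightarrow> 'a) \<Rightarrow> nat \<Rightarrow> 'a" where
  "act s x = (\<lambda>n. s \<otimes> x n)"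

lemma wball_sub: "wball n \<subseteq> carrier G"
  by (simp add: wball_def)

lemma fcauchyD: "fcauchy x \<Longrightarrow> x n \<in> carrier G"
  by (auto simp: fcauchy_def)

lemma fcauchyE:
  assumes "fcauchy x" "e > 0"
  obtains N where "\<And>m n. \<lbrakk>m \<ge> N; n \<ge> N\<rbrakk> \<Longrightarrow> fd \<one> (x m) (x n) < e"
proof -
  have "\<exists>N. \<forall>m\<ge>N. \<forall>n\<ge>N. fd \<one> (x m) (x n) < e"
    using assms by (simp add: fcauchy_def)
  then obtain N where "\<forall>m\<ge>N. \<forall>n\<ge>N. fd \<one> (x m) (x n) < e" ..
  then show ?thesis by (intro that[of N]) auto
qed

lemma fsimD: "\<lbrakk>fsim x y; e > 0\<rbrakk> \<Longrightarrow> \<forall>\<^sub>F n in sequentially. fd \<one> (x n) (y n) < e"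
  unfolding fsim_def by (auto dest: order_tendstoD)

lemma fsim_commute:
  "\<lbrakk>range x \<subseteq> carrier G; range y \<subseteq> carrier G; fsim x y\<rbrakk> \<Longrightarrow> fsim y x"
  unfolding fsim_def by (subst fd_commute) (auto simp: range_subsetD)

lemma fsim_trans:
  assumes "range x \<subseteq> carrier G" "range y \<subseteq> carrier G" "range z \<subseteq> carrier G" "fsim x y" "fsim y z"
  shows "fsim x z"
  unfolding fsim_def
proof (rule tendsto_sandwich[OF _ _ tendsto_const])
  show "(\<lambda>n. fd \<one> (x n) (y n) + fd \<one> (y n) (z n)) \<longlonglongrightarrow> 0"
    using tendsto_add assms(4,5) unfolding fsim_def by fastforce
qed (use assms in \<open>auto simp: range_subsetD intro!: always_eventually fd_nonneg fd_triangle\<close>)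

lemma range_act: "\<lbrakk>s \<in> carrier G; range x \<subseteq> carrier G\<rbrakk> \<Longrightarrow> range (act s x) \<subseteq> carrier G"
  by (auto simp: act_def range_subsetD)

lemma act_act:
  "\<lbrakk>s \<in> carrier G; t \<in> carrier G; range x \<subseteq> carrier G\<rbrakk> \<Longrightarrow> act s (act t x) = act (s \<otimes> t) x"
  by (auto simp: act_def range_subsetD m_assoc)

lemma act_one: "range x \<subseteq> carrier G \<Longrightarrow> act \<one> x = x"
  by (auto simp: act_def range_subsetD)

text \<open>Acting by \<open>s\<close> amounts to moving the base point from \<open>\<one>\<close>
  to \<open>inv s\<close>, so \<open>fd_change_base\<close> applies.\<close>

lemma act_lipschitz:
  assumes "s \<in> carrier G"
  obtains L where "L > 0"
    "\<And>x y. \<lbrakk>x \<in> carrier G; y \<in> carrier G\<rbrakk> \<Longrightarrow> fd \<one> (s \<otimes> x) (s \<otimes> y) \<le> L * fd \<one> x y"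
proof -
  obtain \<kappa> where \<kappa>: "\<kappa> \<ge> 1"
    "\<And>v w x y. \<lbrakk>v \<in> carrier G; w \<in> carrier G; x \<in> carrier G; y \<in> carrier G\<rbrakk> \<Longrightarrow>
        fd v x y \<le> \<kappa> ^ wd v w * fd w x y" using fd_change_base by blast
  show ?thesis
  proof (rule that[of "\<kappa> ^ wd (inv s) \<one>"])
    fix x y assume "x \<in> carrier G" "y \<in> carrier G"
    then show "fd \<one> (s \<otimes> x) (s \<otimes> y) \<le> \<kappa> ^ wd (inv s) \<one> * fd \<one> x y"
      using \<kappa>(2)[of "inv s" \<one> x y] fd_left[of "inv s" \<one> "s \<otimes> x" "s \<otimes> y"] assms
      by (simp add: mult_cancel_inv)
  qed (use \<kappa>(1) in auto)
qed

lemma fsim_act: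
  assumes "s \<in> carrier G" "range x \<subseteq> carrier G" "range y \<subseteq> carrier G" "fsim x y"
  shows "fsim (act s x) (act s y)"
proof -
  obtain L where L: "\<And>x y. \<lbrakk>x \<in> carrier G; y \<in> carrier G\<rbrakk> \<Longrightarrow>
      fd \<one> (s \<otimes> x) (s \<otimes> y) \<le> L * fd \<one> x y" using act_lipschitz[OF assms(1)] by blast
  show ?thesis unfolding fsim_def
  proof (rule tendsto_sandwich[OF _ _ tendsto_const])
    show "(\<lambda>n. L * fd \<one> (x n) (y n)) \<longlonglongrightarrow> 0"
      using assms(4) unfolding fsim_def by (rule tendsto_mult_right_zero)
  qed (use assms L in \<open>auto simp: act_def range_subsetD intro!: always_eventually fd_nonneg\<close>)
qed

lemma fcauchy_act:
  assumes s: "s \<in> carrier G" and x: "fcauchy x" shows "fcauchy (act s x)"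
proof -
  obtain L where L: "L > 0" "\<And>x y. \<lbrakk>x \<in> carrier G; y \<in> carrier G\<rbrakk> \<Longrightarrow>
      fd \<one> (s \<otimes> x) (s \<otimes> y) \<le> L * fd \<one> x y" using act_lipschitz[OF s] by blast
  have "\<exists>N. \<forall>m\<ge>N. \<forall>n\<ge>N. fd \<one> (act s x m) (act s x n) < e" if e: "e > 0" for e
  proof -
    obtain N where N: "\<And>m n. m \<ge> N \<Longrightarrow> n \<ge> N \<Longrightarrow> fd \<one> (x m) (x n) < e / L"
      using fcauchyE[OF x divide_pos_pos[OF e L(1)]] by blast
    show ?thesis
    proof (intro exI[of _ N] allI impI)
      fix m n assume "m \<ge> N" "n \<ge> N"
      then have "L * fd \<one> (x m) (x n) < e" using N L(1) by (simp add: pos_less_divide_eq mult.commute)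
      then show "fd \<one> (act s x m) (act s x n) < e"
        using L(2)[OF fcauchyD[OF x] fcauchyD[OF x], of m n] by (simp add: act_def)
    qed
  qed
  moreover have "range (act s x) \<subseteq> carrier G" using x by (intro range_act s) (simp add: fcauchy_def)
  ultimately show ?thesis unfolding fcauchy_def by simp
qed

lemma fcauchyI:
  assumes "\<And>n. x n \<in> carrier G"
    "\<And>e. e > 0 \<Longrightarrow> \<exists>N. \<forall>m\<ge>N. \<forall>n\<ge>N. fd \<one> (x m) (x n) < e"
  shows "fcauchy x"
  using assms by (simp add: fcauchy_def image_subset_iff)

lemma fcauchy_subseq:
  assumes x: "fcauchy x" and r: "strict_mono r" shows "fcauchy (x \<circ> r)"
proof (rule fcauchyI)
  fix e :: real assume "e > 0"
  then obtain N where N: "\<And>m n. \<lbrakk>m \<ge> N; n \<ge> N\<rbrakk> \<Longrightarrow> fd \<one> (x m) (x n) < e"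
    using fcauchyE[OF x] by blast
  show "\<exists>N. \<forall>m\<ge>N. \<forall>n\<ge>N. fd \<one> ((x \<circ> r) m) ((x \<circ> r) n) < e"
  proof (intro exI[of _ N] allI impI)
    fix m n assume "m \<ge> N" "n \<ge> N"
    then show "fd \<one> ((x \<circ> r) m) ((x \<circ> r) n) < e"
      using N[of "r m" "r n"] seq_suble[OF r, of m] seq_suble[OF r, of n] by simp
  qed
qed (use fcauchyD[OF x] in simp)

lemma to_infinity_subseq: "\<lbrakk>to_infinity x; strict_mono r\<rbrakk> \<Longrightarrow> to_infinity (x \<circ> r)"
  using filterlim_compose[OF _ filterlim_subseq] by (auto simp: o_def)

text \<open>The Floyd metric is totally bounded: a geodesic from \<open>\<one>\<close> to
  \<open>g\<close>, cut at radius \<open>N\<close>, leaves a remainder bounded by a tail of the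
  series, so the finite ball \<open>wball N\<close> is an \<open>\<epsilon>\<close>-net.\<close>

lemma fcauchy_subseq_ex:
  fixes x :: "nat \<Rightarrow> 'a"
  assumes "range x \<subseteq> carrier G"
  obtains r where "strict_mono r" "fcauchy (x \<circ> r)"
proof -
  \<comment> \<open>\<open>Metric_space\<close> asks for nonnegativity and symmetry off the carrier
    as well, hence the default value 0.\<close>
  define d where "d x y = (if x \<in> carrier G \<and> y \<in> carrier G then fd \<one> x y else 0)" for x y
  interpret FM: Metric_space "carrier G" d
  proof
    fix x y z
    show "0 \<le> d x y" by (simp add: d_def fd_nonneg)
    show "d x y = d y x" by (simp add: d_def fd_commute)
    show "(d x y = 0) = (x = y)" if "x \<in> carrier G" "y \<in> carrier G"
      by (cases "x = y") (use fd_pos[of x y \<one>] that in \<open>auto simp: d_def\<close>)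
    show "d x z \<le> d x y + d y z" if "x \<in> carrier G" "y \<in> carrier G" "z \<in> carrier G"
      using that by (simp add: d_def fd_triangle)
  qed
  have "FM.mtotally_bounded (carrier G)"
    unfolding FM.mtotally_bounded_def
  proof (intro allI impI)
    fix \<epsilon> :: real assume "\<epsilon> > 0"
    then obtain N where N: "\<And>m n. m \<ge> N \<Longrightarrow> norm (sum fn {m..<n}) < \<epsilon>"
      using fn_summable unfolding summable_Cauchy by meson
    have "carrier G \<subseteq> (\<Union>x\<in>wball N. FM.mball x \<epsilon>)"
    proof
      fix g assume g: "g \<in> carrier G"
      obtain p where p: "geodesic p (wd \<one> g)" "p 0 = \<one>" "p (wd \<one> g) = g"
        using geodesic_ex[of \<one> g] g by auto
      define i where "i = min N (len g)"
      have i: "i \<le> wd \<one> g" using g by (simp add: i_def)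
      have pi: "p i \<in> carrier G" "len (p i) \<le> N"
      proof -
        have "wd (p 0) (p i) = i - 0" using p(1) i(1) unfolding geodesic_def by blast
        moreover show "p i \<in> carrier G" using p(1) i(1) unfolding geodesic_def by blast
        ultimately show "len (p i) \<le> N" using p(2) by (simp add: i_def)
      qed
      have "fd \<one> (p i) g < \<epsilon>"
      proof (cases "len g \<le> N")
        case True
        then show ?thesis using p(3) g \<open>\<epsilon> > 0\<close> by (simp add: i_def)
      next
        case False
        then show ?thesis using fd_geodesic_tail[OF p(1,2) i] N[of i "wd \<one> g"] p(3)
          by (auto simp: i_def)
      qed
      then show "g \<in> (\<Union>x\<in>wball N. FM.mball x \<epsilon>)"
        using pi g by (auto simp: wball_def FM.in_mball d_def intro!: bexI[of _ "p i"])
    qed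
    then show "\<exists>K. finite K \<and> K \<subseteq> carrier G \<and> carrier G \<subseteq> (\<Union>x\<in>K. FM.mball x \<epsilon>)"
      using wball_sub[of N] finite_wball[of N] by blast
  qed
  then have "\<forall>\<sigma>::nat \<Rightarrow> 'a. range \<sigma> \<subseteq> carrier G \<longrightarrow> (\<exists>r. strict_mono r \<and> FM.MCauchy (\<sigma> \<circ> r))"
    by (rule FM.mtotally_bounded_sequentially[THEN iffD1, THEN conjunct2])
  from this[rule_format, OF assms] obtain r where r: "strict_mono r" "FM.MCauchy (x \<circ> r)"
    by metis
  have "fcauchy (x \<circ> r)"
  proof (rule fcauchyI)
    have xc: "x n \<in> carrier G" for n using assms by (rule range_subsetD)
    then show "(x \<circ> r) n \<in> carrier G" for n by simp
    fix e :: real assume "e > 0"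
    then have "\<exists>N. \<forall>n n'. N \<le> n \<longrightarrow> N \<le> n' \<longrightarrow> d ((x \<circ> r) n) ((x \<circ> r) n') < e"
      using r(2) by (simp add: FM.MCauchy_def)
    then show "\<exists>N. \<forall>m\<ge>N. \<forall>n\<ge>N. fd \<one> ((x \<circ> r) m) ((x \<circ> r) n) < e"
      using xc by (simp add: d_def)
  qed
  then show ?thesis using that r(1) by blast
qed

text \<open>Sequences that are \<open>e\<close> apart infinitely often and move by less than
  \<open>e / 4\<close> from some index on stay \<open>e / 2\<close> apart, even at unequal
  indices.\<close>

lemma not_fsim:
  assumes x: "fcauchy x" and y: "fcauchy y" and ns: "\<not> fsim x y"
  obtains r N where "r > 0" "\<And>m n. m \<ge> N \<Longrightarrow> n \<ge> N \<Longrightarrow> fd \<one> (x m) (y n) \<ge> r"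
proof -
  note xc = fcauchyD[OF x] and yc = fcauchyD[OF y]
  obtain e where e: "e > 0" "\<And>N. \<exists>n\<ge>N. fd \<one> (x n) (y n) \<ge> e"
    using ns unfolding fsim_def LIMSEQ_iff by (auto simp: not_less fd_nonneg xc yc)
  have e4: "e / 4 > 0" using e(1) by simp
  obtain N1 where N1: "\<And>m n. m \<ge> N1 \<Longrightarrow> n \<ge> N1 \<Longrightarrow> fd \<one> (x m) (x n) < e / 4"
    using fcauchyE[OF x e4] by blast
  obtain N2 where N2: "\<And>m n. m \<ge> N2 \<Longrightarrow> n \<ge> N2 \<Longrightarrow> fd \<one> (y m) (y n) < e / 4"
    using fcauchyE[OF y e4] by blast
  show ?thesis
  proof (rule that[of "e / 2" "max N1 N2"])
    fix m n assume mn: "m \<ge> max N1 N2" "n \<ge> max N1 N2"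
    obtain k where k: "k \<ge> max N1 N2" "fd \<one> (x k) (y k) \<ge> e" using e(2) by blast
    have "fd \<one> (x k) (y k) \<le> fd \<one> (x k) (x m) + (fd \<one> (x m) (y n) + fd \<one> (y n) (y k))"
      using fd_triangle[of "x k" "x m" "y k" \<one>] fd_triangle[of "x m" "y n" "y k" \<one>] xc yc by simp
    then show "fd \<one> (x m) (y n) \<ge> e / 2"
      using N1[of k m] N2[of n k] k mn by simp
  qed (use e in auto)
qed

text \<open>A path of bounded word length becomes negligible far out. In particular right
  multiplication by elements of bounded length does not change a boundary point.\<close>

lemma fsim_near:
  assumes x: "range x \<subseteq> carrier G" and y: "range y \<subseteq> carrier G" and inf: "to_infinity x"
    and near: "\<And>n. wd (x n) (y n) \<le> C"
  shows "fsim x y"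
  unfolding fsim_def
proof (rule tendsto_sandwich[OF _ _ tendsto_const])
  have "filterlim (\<lambda>n. len (x n) - C) at_top sequentially"
    unfolding filterlim_at_top
  proof
    fix Z
    have "\<forall>\<^sub>F n in sequentially. Z + C \<le> len (x n)" using inf unfolding filterlim_at_top by (rule spec)
    then show "\<forall>\<^sub>F n in sequentially. Z \<le> len (x n) - C" by (rule eventually_mono) simp
  qed
  moreover have "fn \<longlonglongrightarrow> 0" by (rule summable_LIMSEQ_zero[OF fn_summable])
  ultimately have "(\<lambda>n. fn (len (x n) - C)) \<longlonglongrightarrow> 0" by (rule filterlim_compose[rotated])
  then show "(\<lambda>n. real C * fn (len (x n) - C)) \<longlonglongrightarrow> 0" by (rule tendsto_mult_right_zero)
  show "\<forall>\<^sub>F n in sequentially. fd \<one> (x n) (y n) \<le> real C * fn (len (x n) - C)"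
  proof (intro always_eventually allI)
    fix n
    have c: "x n \<in> carrier G" "y n \<in> carrier G" using x y by (auto simp: range_subsetD)
    have "fd \<one> (x n) (y n) \<le> real (wd (x n) (y n)) * fn (len (x n) - wd (x n) (y n))"
      using fd_near[of "x n" "y n" \<one>] c by simp
    also have "\<dots> \<le> real C * fn (len (x n) - C)"
      using near[of n] by (intro mult_mono fn_antimono) auto
    finally show "fd \<one> (x n) (y n) \<le> real C * fn (len (x n) - C)" .
  qed
qed (use x y in \<open>auto simp: range_subsetD intro!: always_eventually fd_nonneg\<close>)

text \<open>The orbit is counted up to \<open>fsim\<close>. The representatives in \<open>F\<close>
  may be any sequences in the group; those that are attained have the same limit as a translate of
  \<open>p\<close>.\<close>

definition finite_orbit :: "(nat \<Rightarrow> 'a) \<Rightarrow> bool" where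
  "finite_orbit p \<longleftrightarrow> (\<exists>F. finite F \<and> (\<forall>y\<in>F. range y \<subseteq> carrier G) \<and>
      (\<forall>s\<in>carrier G. \<exists>y\<in>F. fsim (act s p) y))"

text \<open>The stabiliser \<open>H\<close> of the boundary point \<open>p\<close> has finite index, and approaching a second
  boundary point \<open>q\<close> within \<open>H\<close> shows that \<open>p\<close> is conical: there are \<open>u\<close> in \<open>H\<close> such that
  every geodesic from \<open>\<one>\<close> to \<open>p\<close> passes close to \<open>h \<otimes> u\<close>, for all \<open>h\<close> in a given finite subset of
  \<open>H\<close>. So \<open>h \<mapsto> h \<otimes> u\<close> embeds that set into a neighbourhood of a short geodesic segment.\<close>

lemma finite_orbit_imp_linear_growth:
  assumes p: "fcauchy p" and q: "fcauchy q" and pq: "\<not> fsim p q" and qinf: "to_infinity q"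
    and fo: "finite_orbit p"
  shows "\<exists>C. \<forall>k\<ge>1. card (wball k) \<le> C * k"
proof -
  note pc = fcauchyD[OF p] and qc = fcauchyD[OF q]
  have pr: "range p \<subseteq> carrier G" using pc by auto
  define H where "H = {h \<in> carrier G. fsim (act h p) p}"
  have Hc: "h \<in> carrier G" if "h \<in> H" for h using that by (simp add: H_def)
  have Hmult: "g \<otimes> h \<in> H" if "g \<in> H" "h \<in> H" for g h
  proof -
    have gc: "g \<in> carrier G" "h \<in> carrier G" "fsim (act g p) p" "fsim (act h p) p"
      using that by (auto simp: H_def)
    have a: "fsim (act g (act h p)) (act g p)"
      using gc pr by (intro fsim_act range_act) auto
    have "fsim (act (g \<otimes> h) p) p"
      by (rule fsim_trans[where y = "act g p"]) (use a gc pr in \<open>simp_all add: act_act range_act\<close>)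
    then show ?thesis using gc by (simp add: H_def)
  qed
  have Hinv: "inv h \<in> H" if "h \<in> H" for h
  proof -
    have hc: "h \<in> carrier G" "fsim (act h p) p" using that by (auto simp: H_def)
    have "fsim (act (inv h) (act h p)) (act (inv h) p)"
      using hc pr by (intro fsim_act range_act) auto
    then have "fsim p (act (inv h) p)" using hc pr by (simp add: act_act act_one)
    then have "fsim (act (inv h) p) p"
      by (rule fsim_commute[rotated 2]) (use hc pr in \<open>simp_all add: range_act\<close>)
    then show ?thesis using hc by (simp add: H_def)
  qed
  obtain F where F': "finite F \<and> (\<forall>y\<in>F. range y \<subseteq> carrier G) \<and>
      (\<forall>s\<in>carrier G. \<exists>y\<in>F. fsim (act s p) y)"
    using fo unfolding finite_orbit_def ..
  then have F: "finite F" "\<And>y. y \<in> F \<Longrightarrow> range y \<subseteq> carrier G"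
    "\<And>s. s \<in> carrier G \<Longrightarrow> \<exists>y\<in>F. fsim (act s p) y" by simp_all
  \<comment> \<open>Only attained members of \<open>F\<close> receive a representative:
    \<open>c y\<close> moves \<open>p\<close> to \<open>y\<close>, so the elements
    \<open>c y\<close> meet every left coset of \<open>H\<close>.\<close>
  define F' where "F' = {y \<in> F. \<exists>s\<in>carrier G. fsim (act s p) y}"
  define c where "c y = (SOME s. s \<in> carrier G \<and> fsim (act s p) y)" for y
  have c: "c y \<in> carrier G \<and> fsim (act (c y) p) y" if "y \<in> F'" for y
    unfolding c_def by (rule someI_ex) (use that in \<open>auto simp: F'_def\<close>)
  define C where "C = c ` F'"
  have C: "finite C" "C \<subseteq> carrier G" using F(1) c by (auto simp: C_def F'_def)
  have coset: "\<exists>a\<in>C. inv a \<otimes> g \<in> H" if g: "g \<in> carrier G" for g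
  proof -
    obtain y where y: "y \<in> F" "fsim (act g p) y" using F(3)[OF g] by blast
    then have y': "y \<in> F'" using g by (auto simp: F'_def)
    have cy: "c y \<in> carrier G" "fsim (act (c y) p) y" using c[OF y'] by auto
    have "fsim (act g p) (act (c y) p)"
      by (rule fsim_trans[of _ y]) (use y cy g pr F(2) fsim_commute[OF _ _ cy(2)] in \<open>simp_all add: range_act\<close>)
    then have "fsim (act (inv (c y)) (act g p)) (act (inv (c y)) (act (c y) p))"
      using cy g pr by (intro fsim_act range_act) auto
    then have "inv (c y) \<otimes> g \<in> H" using cy g pr by (simp add: act_act act_one H_def)
    then show ?thesis using y' by (auto simp: C_def)
  qed
  obtain l where l: "\<And>a. a \<in> C \<Longrightarrow> len a \<le> l"
    using C(1) by (metis finite_imageI finite_nat_set_iff_bounded_le imageI)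
  \<comment> \<open>Correcting \<open>inv (q n)\<close> by an element of the finite set
    \<open>C\<close> moves it into \<open>H\<close>. The correction has length at most
    \<open>l\<close>, so the inverses of the resulting \<open>u n\<close> still tend to the boundary
    point of \<open>q\<close>.\<close>
  have "\<exists>a\<in>C. inv a \<otimes> inv (q n) \<in> H" for n using coset qc by simp
  then obtain a where a: "\<And>n. a n \<in> C" "\<And>n. inv (a n) \<otimes> inv (q n) \<in> H" by metis
  have ac: "a n \<in> carrier G" for n using a(1) C(2) by blast
  define u where "u n = inv (a n) \<otimes> inv (q n)" for n
  have u: "u n \<in> H" "inv (u n) = q n \<otimes> a n" "u n \<in> carrier G" for n
    using a qc ac by (auto simp: u_def inv_mult_group)
  obtain r N where r: "r > 0" "\<And>m n. m \<ge> N \<Longrightarrow> n \<ge> N \<Longrightarrow> fd \<one> (p m) (q n) \<ge> r"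
    using not_fsim[OF p q pq] by blast
  have r2: "r / 2 > 0" using r(1) by simp
  obtain R where R: "\<And>w p n. \<lbrakk>w \<in> carrier G; geodesic p n; fd w (p 0) (p n) \<ge> r / 2\<rbrakk> \<Longrightarrow>
     \<exists>i\<le>n. wd w (p i) \<le> R" using karlsson[OF r2] by blast
  define b where "b = card (wball R)"
  have main: "card (H \<inter> wball k) \<le> (2 * k + 2 * R + 1) * b" for k
  proof -
    \<comment> \<open>First \<open>n\<close> is taken so large that all
      \<open>inv (h \<otimes> u n)\<close> with \<open>h\<close> in \<open>?E\<close> are near
      \<open>q n\<close>; then \<open>m\<close>, depending on \<open>n\<close>, so large that these
      finitely many elements of the stabiliser of \<open>p\<close> move \<open>p m\<close> only
      little.\<close>
    let ?E = "H \<inter> wball k"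
    have finE: "finite ?E" by simp
    have Ec: "h \<in> carrier G" if "h \<in> ?E" for h using that Hc by blast
    have "\<forall>\<^sub>F n in sequentially. \<forall>h\<in>?E. fd \<one> (q n) (inv (u n) \<otimes> inv h) < r / 4"
    proof (rule eventually_ball_finite[OF finE], rule ballI)
      fix h assume h: "h \<in> ?E"
      have "fsim q (\<lambda>n. inv (u n) \<otimes> inv h)"
      proof (rule fsim_near[OF _ _ qinf])
        fix n
        have "wd (q n) (inv (u n) \<otimes> inv h) = len (a n \<otimes> inv h)"
          using wd_right_mult[of "q n" "a n \<otimes> inv h"] qc[of n] ac[of n] Ec[OF h] by (simp add: u(2) m_assoc)
        also have "\<dots> \<le> l + k"
          using len_mult[of "a n" "inv h"] l[OF a(1), of n] h ac[of n] Ec[OF h] by (auto simp: wball_def)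
        finally show "wd (q n) (inv (u n) \<otimes> inv h) \<le> l + k" .
      qed (use qc u(3) Ec[OF h] in auto)
      then show "\<forall>\<^sub>F n in sequentially. fd \<one> (q n) (inv (u n) \<otimes> inv h) < r / 4"
        using r(1) by (intro fsimD) auto
    qed
    then have "\<forall>\<^sub>F n in sequentially. n \<ge> N \<and> (\<forall>h\<in>?E. fd \<one> (q n) (inv (u n) \<otimes> inv h) < r / 4)"
      by (intro eventually_conj eventually_ge_at_top)
    then obtain n where n: "n \<ge> N" "\<And>h. h \<in> ?E \<Longrightarrow> fd \<one> (q n) (inv (u n) \<otimes> inv h) < r / 4"
      using eventually_happens'[OF sequentially_bot] by blast
    have "\<forall>\<^sub>F m in sequentially. \<forall>h\<in>?E. fd \<one> ((inv (u n) \<otimes> inv h) \<otimes> p m) (p m) < r / 4"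
    proof (rule eventually_ball_finite[OF finE], rule ballI)
      fix h assume h: "h \<in> ?E"
      then have "inv (u n) \<otimes> inv h \<in> H" using u(1) by (intro Hmult Hinv) auto
      then have "fsim (act (inv (u n) \<otimes> inv h) p) p" by (simp add: H_def)
      then show "\<forall>\<^sub>F m in sequentially. fd \<one> ((inv (u n) \<otimes> inv h) \<otimes> p m) (p m) < r / 4"
        using r(1) fsimD[of "act (inv (u n) \<otimes> inv h) p" p "r / 4"] by (simp add: act_def)
    qed
    then have "\<forall>\<^sub>F m in sequentially. m \<ge> N \<and> (\<forall>h\<in>?E. fd \<one> ((inv (u n) \<otimes> inv h) \<otimes> p m) (p m) < r / 4)"
      by (intro eventually_conj eventually_ge_at_top)
    then obtain m where m: "m \<ge> N" "\<And>h. h \<in> ?E \<Longrightarrow> fd \<one> ((inv (u n) \<otimes> inv h) \<otimes> p m) (p m) < r / 4"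
      using eventually_happens'[OF sequentially_bot] by blast
    obtain P where P: "geodesic P (len (p m))" "P 0 = \<one>" "P (len (p m)) = p m"
      using geodesic_ex[of \<one> "p m"] pc[of m] by auto
    have Pc: "P i \<in> carrier G" "wd \<one> (P i) = i" if "i \<le> len (p m)" for i
    proof -
      have "wd (P 0) (P i) = i - 0" "P i \<in> carrier G" using P(1) that unfolding geodesic_def by blast+
      then show "P i \<in> carrier G" "wd \<one> (P i) = i" using P(2) by auto
    qed
    \<comment> \<open>A vertex \<open>P i\<close> within \<open>R\<close> of
      \<open>h \<otimes> u n\<close> has index within \<open>k + R\<close> of
      \<open>len (u n)\<close>, so the relevant part of the geodesic has length linear in
      \<open>k\<close>.\<close>
    define I where "I = {i. i \<le> len (p m) \<and> len (u n) \<le> i + (k + R) \<and> i \<le> len (u n) + (k + R)}"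
    have "(\<lambda>h. h \<otimes> u n) ` ?E \<subseteq> (\<Union>i\<in>I. {g \<in> carrier G. wd (P i) g \<le> R})"
    proof (rule image_subsetI)
      fix h assume h: "h \<in> ?E"
      note hc = Ec[OF h]
      let ?v = "inv (u n) \<otimes> inv h"
      have v: "?v \<in> carrier G" "inv (h \<otimes> u n) = ?v" using hc u(3)[of n] by (auto simp: inv_mult_group)
      have hu: "h \<otimes> u n \<in> carrier G" using hc u(3)[of n] by simp
      \<comment> \<open>Seen from \<open>\<one>\<close>, \<open>?v\<close> is near
        \<open>q n\<close> and \<open>?v \<otimes> p m\<close> is near \<open>p m\<close>, so these
        two are at least \<open>r - r / 4 - r / 4\<close> apart. Translated by the inverse of
        \<open>?v\<close>, this says that the ends of \<open>P\<close> are far apart as seen from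
        \<open>h \<otimes> u n\<close>.\<close>
      have "fd \<one> (p m) (q n) \<le> fd \<one> (?v \<otimes> p m) (p m) + (fd \<one> ?v (?v \<otimes> p m) + fd \<one> (q n) ?v)"
        using fd_triangle[of "p m" "?v \<otimes> p m" "q n" \<one>] fd_triangle[of "?v \<otimes> p m" "?v" "q n" \<one>]
          fd_commute[of "p m" "?v \<otimes> p m" \<one>] fd_commute[of "?v \<otimes> p m" ?v \<one>] fd_commute[of ?v "q n" \<one>]
          v pc[of m] qc[of n] by simp
      then have "fd \<one> ?v (?v \<otimes> p m) \<ge> r / 2" using r(2)[OF m(1) n(1)] m(2)[OF h] n(2)[OF h] by simp
      moreover have "fd (h \<otimes> u n) \<one> (p m) = fd \<one> ?v (?v \<otimes> p m)"
        using fd_translate[OF hu one_closed pc[of m]] v by simp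
      ultimately obtain i where i: "i \<le> len (p m)" "wd (h \<otimes> u n) (P i) \<le> R"
        using R[OF hu P(1)] P(2,3) by auto
      have "len (h \<otimes> u n) \<le> k + len (u n)" using len_mult[OF hc u(3), of n] h by (auto simp: wball_def)
      moreover have "len (u n) \<le> k + len (h \<otimes> u n)"
        using len_mult[of "inv h" "h \<otimes> u n"] hc u(3)[of n] h by (simp add: mult_cancel_inv wball_def)
      moreover have "i \<le> len (h \<otimes> u n) + R" "len (h \<otimes> u n) \<le> i + R"
        using wd_triangle[of \<one> "h \<otimes> u n" "P i"] wd_triangle[of \<one> "P i" "h \<otimes> u n"]
          wd_commute[of "P i" "h \<otimes> u n"] i Pc[OF i(1)] hu by auto
      ultimately have "i \<in> I" using i by (simp add: I_def)
      moreover have "wd (P i) (h \<otimes> u n) \<le> R" using i wd_commute[OF hu Pc(1)[OF i(1)]] by simp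
      ultimately show "h \<otimes> u n \<in> (\<Union>i\<in>I. {g \<in> carrier G. wd (P i) g \<le> R})" using hu by blast
    qed
    moreover have "inj_on (\<lambda>h. h \<otimes> u n) ?E" using Ec u(3)[of n] by (auto intro!: inj_onI)
    moreover have "finite I" unfolding I_def by simp
    ultimately have "card ?E \<le> card (\<Union>i\<in>I. {g \<in> carrier G. wd (P i) g \<le> R})"
      using Pc(1) by (intro card_inj_on_le[of "\<lambda>h. h \<otimes> u n"]) (auto simp: I_def)
    also have "\<dots> \<le> (\<Sum>i\<in>I. card {g \<in> carrier G. wd (P i) g \<le> R})" using \<open>finite I\<close> by (rule card_UN_le)
    also have "\<dots> = card I * b"
      using Pc(1) by (simp add: I_def card_wball_around b_def)
    also have "card I \<le> card {len (u n) - (k + R)..len (u n) + (k + R)}"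
      by (rule card_mono) (auto simp: I_def)
    also have "\<dots> \<le> 2 * k + 2 * R + 1" by simp
    finally show ?thesis by simp
  qed
  have "card (wball k) \<le> card C * (2 + 2 * l + 2 * R + 1) * b * k" if "k \<ge> 1" for k
  proof -
    \<comment> \<open>The bound passes from \<open>H\<close> to the group: finitely many translates
      of a slightly larger ball of \<open>H\<close> cover \<open>wball k\<close>.\<close>
    have "wball k \<subseteq> (\<Union>c\<in>C. (\<lambda>h. c \<otimes> h) ` (H \<inter> wball (k + l)))"
    proof
      fix g assume g: "g \<in> wball k"
      then have gc: "g \<in> carrier G" by (simp add: wball_def)
      obtain c where cc: "c \<in> C" "inv c \<otimes> g \<in> H" using coset[OF gc] by blast
      then have c: "c \<in> carrier G" using C(2) by blast
      have "len (inv c \<otimes> g) \<le> k + l"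
        using len_mult[of "inv c" g] l[OF cc(1)] g gc c by (simp add: wball_def)
      then have "inv c \<otimes> g \<in> H \<inter> wball (k + l)" using cc gc c by (simp add: wball_def)
      moreover have "g = c \<otimes> (inv c \<otimes> g)" using c gc by (simp add: mult_cancel_inv)
      ultimately show "g \<in> (\<Union>c\<in>C. (\<lambda>h. c \<otimes> h) ` (H \<inter> wball (k + l)))" using cc(1) by blast
    qed
    then have "card (wball k) \<le> card (\<Union>c\<in>C. (\<lambda>h. c \<otimes> h) ` (H \<inter> wball (k + l)))"
      using C(1) by (intro card_mono) auto
    also have "\<dots> \<le> (\<Sum>c\<in>C. card ((\<lambda>h. c \<otimes> h) ` (H \<inter> wball (k + l))))" using C(1) by (rule card_UN_le)
    also have "\<dots> \<le> (\<Sum>c\<in>C. (2 * (k + l) + 2 * R + 1) * b)"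
      using main[of "k + l"] by (intro sum_mono) (meson card_image_le finite_Int finite_wball order_trans)
    also have "\<dots> = card C * ((2 * (k + l) + 2 * R + 1) * b)" by simp
    also have "\<dots> \<le> card C * (((2 + 2 * l + 2 * R + 1) * k) * b)"
    proof (intro mult_left_mono mult_right_mono)
      show "2 * (k + l) + 2 * R + 1 \<le> (2 + 2 * l + 2 * R + 1) * k"
        using that by (cases k) (simp_all add: algebra_simps)
    qed auto
    finally show ?thesis by (simp only: mult_ac)
  qed
  then show ?thesis by (intro exI[of _ "card C * (2 + 2 * l + 2 * R + 1) * b"]) blast
qed

end

text \<open>Three sets, because some \<open>V i\<close> must carry clearly less than half of any
  given mass. With two sets even the group of order two would qualify: take its two singletons, and
  the nontrivial element for both \<open>h i\<close>.\<close>

definition ping_pong :: "('a, 'b) monoid_scheme \<Rightarrow> bool" where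
  "ping_pong G \<longleftrightarrow> (\<exists>V h. disjoint_family_on V {..<3::nat} \<and>
     (\<forall>i<3. V i \<subseteq> carrier G \<and> h i \<in> carrier G \<and>
       (\<forall>x\<in>carrier G - V i. h i \<otimes>\<^bsub>G\<^esub> x \<in> V i)))"

context floyd_group
begin

text \<open>Multiplying \<open>g n\<close> by fixed elements on both sides moves its attracting and its repelling
  point independently within their orbits, so three of these modifications have pairwise disjoint
  neighbourhoods of their fixed points.\<close>

lemma infinite_orbits_imp_ping_pong:
  assumes g: "fcauchy g" and g': "fcauchy (\<lambda>n. inv (g n))" and inf: "to_infinity g"
    and no: "\<not> finite_orbit g" "\<not> finite_orbit (\<lambda>n. inv (g n))"
  shows "ping_pong G"
proof -
  define g' where "g' = (\<lambda>n. inv (g n))"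
  note g'[folded g'_def] no(2)[folded g'_def]
  note gc = fcauchyD[OF g] and g'c = fcauchyD[OF g'[folded g'_def]]
  have gr: "range g \<subseteq> carrier G" "range g' \<subseteq> carrier G" using gc g'c by auto
  have avoid: "\<exists>s\<in>carrier G. \<forall>y\<in>F. \<not> fsim (act s x) y"
    if "\<not> finite_orbit x" "finite F" "\<forall>y\<in>F. range y \<subseteq> carrier G" for x F
  proof (rule ccontr)
    assume "\<not> ?thesis"
    then have "\<forall>s\<in>carrier G. \<exists>y\<in>F. fsim (act s x) y" by simp
    then have "finite_orbit x"
      unfolding finite_orbit_def using that(2,3) by (intro exI[of _ F] conjI)
    then show False using that(1) by simp
  qed
  have ran: "range (act s g) \<subseteq> carrier G" "range (act s g') \<subseteq> carrier G" if "s \<in> carrier G" for s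
    using that gr by (simp_all add: range_act)
  obtain s1 where s1: "s1 \<in> carrier G" "\<forall>y\<in>{g, g'}. \<not> fsim (act s1 g) y"
    using avoid[OF no(1), of "{g, g'}"] gr by auto
  obtain t1 where t1: "t1 \<in> carrier G" "\<forall>y\<in>{g, g'}. \<not> fsim (act t1 g') y"
    using avoid[OF no(2)[folded g'_def], of "{g, g'}"] gr by auto
  \<comment> \<open>The second choice avoids both original points and both points chosen
    first.\<close>
  let ?F = "{g, g', act s1 g, act t1 g'}"
  obtain s2 where s2: "s2 \<in> carrier G" "\<forall>y\<in>?F. \<not> fsim (act s2 g) y"
    using avoid[OF no(1), of ?F] gr ran s1 t1 by auto
  obtain t2 where t2: "t2 \<in> carrier G" "\<forall>y\<in>?F. \<not> fsim (act t2 g') y"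
    using avoid[OF no(2)[folded g'_def], of ?F] gr ran s1 t1 by auto
  define s where "s i = [\<one>, s1, s2] ! i" for i
  define t where "t i = [\<one>, t1, t2] ! i" for i
  have lt3: "i < 3 \<longleftrightarrow> i = 0 \<or> i = 1 \<or> i = (2::nat)" for i by auto
  have st: "s i \<in> carrier G" "t i \<in> carrier G" if "i < 3" for i
    using that s1 t1 s2 t2 by (auto simp: s_def t_def lt3)
  \<comment> \<open>\<open>(True, i)\<close> names the attracting and \<open>(False, i)\<close> the
    repelling point of the modification with index \<open>i\<close>.\<close>
  define X where "X a = (if fst a then act (s (snd a)) g else act (t (snd a)) g')" for a :: "bool \<times> nat"
  have X: "fcauchy (X a)" if "snd a < 3" for a
    using that st g g' by (simp add: X_def fcauchy_act g'_def)
  have Xr: "range (X a) \<subseteq> carrier G" if "snd a < 3" for a using fcauchyD[OF X[OF that]] by auto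
  have X0: "X (True, 0) = g" "X (False, 0) = g'" using gr by (simp_all add: X_def s_def t_def act_one)
  have Xe: "X (True, Suc 0) = act s1 g" "X (False, Suc 0) = act t1 g'"
       "X (True, 2) = act s2 g" "X (False, 2) = act t2 g'" by (simp_all add: X_def s_def t_def)
  have "\<not> fsim (X a) (X b)" if "snd b < snd a" "snd a < 3" for a b
  proof -
    obtain p i q j where ab: "a = (p, i)" "b = (q, j)" by fastforce
    have "j = 0 \<and> i = 1 \<or> j = 0 \<and> i = 2 \<or> j = 1 \<and> i = 2" using that ab by auto
    then show ?thesis using s1 t1 s2 t2 X0 Xe ab by (cases p; cases q) auto
  qed
  then have Xns: "\<not> fsim (X a) (X b)" if "snd a \<noteq> snd b" "snd a < 3" "snd b < 3" for a b
    using that fsim_commute[OF Xr[OF that(2)] Xr[OF that(3)]] by (meson nat_neq_iff)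
  \<comment> \<open>Only points of different index have to differ. The attracting and the repelling
    point of one element may coincide, since a single set \<open>V i\<close> will contain
    neighbourhoods of both.\<close>
  define P :: "((bool \<times> nat) \<times> bool \<times> nat) set"
    where "P = {(a, b). snd a \<noteq> snd b \<and> snd a < 3 \<and> snd b < 3}"
  have "P \<subseteq> (UNIV \<times> {..<3}) \<times> (UNIV \<times> {..<3})" by (auto simp: P_def)
  then have finP: "finite P" by (rule finite_subset) simp
  have "\<exists>r>0. \<forall>\<^sub>F n in sequentially. fd \<one> (X (fst ab) n) (X (snd ab) n) \<ge> r" if "ab \<in> P" for ab
  proof -
    have ab: "snd (fst ab) \<noteq> snd (snd ab)" "snd (fst ab) < 3" "snd (snd ab) < 3"
      using that by (auto simp: P_def)
    obtain r N where "r > 0" "\<And>m n. m \<ge> N \<Longrightarrow> n \<ge> N \<Longrightarrow> fd \<one> (X (fst ab) m) (X (snd ab) n) \<ge> r"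
      using not_fsim[OF X[OF ab(2)] X[OF ab(3)] Xns[OF ab]] by blast
    then show ?thesis unfolding eventually_sequentially by blast
  qed
  then obtain r where r: "\<And>ab. ab \<in> P \<Longrightarrow> r ab > 0"
     "\<And>ab. ab \<in> P \<Longrightarrow> \<forall>\<^sub>F n in sequentially. fd \<one> (X (fst ab) n) (X (snd ab) n) \<ge> r ab" by metis
  have "((True, 0), (True, 1)) \<in> P" by (simp add: P_def)
  then have Pne: "P \<noteq> {}" by blast
  define r0 where "r0 = Min (r ` P)"
  have r0: "r0 > 0" "\<And>ab. ab \<in> P \<Longrightarrow> r0 \<le> r ab" using finP Pne r(1) by (auto simp: r0_def)
  have evP: "\<forall>\<^sub>F n in sequentially. \<forall>ab\<in>P. fd \<one> (X (fst ab) n) (X (snd ab) n) \<ge> r0"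
  proof (rule eventually_ball_finite[OF finP], rule ballI)
    fix ab assume ab: "ab \<in> P"
    show "\<forall>\<^sub>F n in sequentially. fd \<one> (X (fst ab) n) (X (snd ab) n) \<ge> r0"
      using r(2)[OF ab] by (rule eventually_mono) (use r0(2)[OF ab] in linarith)
  qed
  \<comment> \<open>The factor \<open>inv (t i)\<close> on the right leaves the attracting point
    \<open>s i\<close> times \<open>g\<close> unchanged in the limit, and in the inverse
    \<open>inv (s i)\<close> plays the same role; so the two points move independently.\<close>
  define h where "h i n = s i \<otimes> g n \<otimes> inv (t i)" for i n
  define Y where "Y a n = (if fst a then h (snd a) n else inv (h (snd a) n))" for a :: "bool \<times> nat" and n
  have hc: "h i n \<in> carrier G" if "i < 3" for i n using st[OF that] gc by (simp add: h_def)
  have Yc: "Y a n \<in> carrier G" if "snd a < 3" for a n using hc[OF that] by (simp add: Y_def)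
  have inf': "to_infinity g'" using inf gc by (simp add: g'_def)
  have act_inf: "to_infinity (act c x)" if c: "c \<in> carrier G" and x: "range x \<subseteq> carrier G" "to_infinity x" for c x
    unfolding filterlim_at_top
  proof
    fix Z
    have "\<forall>\<^sub>F n in sequentially. Z + len c \<le> len (x n)" using x(2) unfolding filterlim_at_top by (rule spec)
    then show "\<forall>\<^sub>F n in sequentially. Z \<le> len (act c x n)"
    proof (rule eventually_mono)
      fix n assume "Z + len c \<le> len (x n)"
      moreover have "x n \<in> carrier G" using x(1) by auto
      ultimately show "Z \<le> len (act c x n)"
        using len_mult[of "inv c" "c \<otimes> x n"] c by (simp add: act_def mult_cancel_inv)
    qed
  qed
  have XY: "fsim (X a) (Y a)" if a: "snd a < 3" for a
  proof (rule fsim_near[OF Xr[OF a]])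
    show "to_infinity (X a)" using act_inf[OF st(1)[OF a] gr(1) inf] act_inf[OF st(2)[OF a] gr(2) inf']
      by (simp add: X_def)
    show "range (Y a) \<subseteq> carrier G" using Yc[OF a] by auto
    fix n
    show "wd (X a n) (Y a n) \<le> len (s (snd a)) + len (t (snd a))"
    proof (cases "fst a")
      case True
      then have "Y a n = X a n \<otimes> inv (t (snd a))" by (simp add: Y_def X_def h_def act_def)
      then show ?thesis using wd_right_mult[of "X a n" "inv (t (snd a))"] fcauchyD[OF X[OF a]] st[OF a] by simp
    next
      case False
      then have "Y a n = X a n \<otimes> inv (s (snd a))"
        using st[OF a] gc by (simp add: Y_def X_def h_def act_def g'_def inv_mult_group m_assoc)
      then show ?thesis using wd_right_mult[of "X a n" "inv (s (snd a))"] fcauchyD[OF X[OF a]] st[OF a] by simp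
    qed
  qed
  let ?A = "UNIV \<times> {..<3} :: (bool \<times> nat) set"
  have r04: "r0 / 4 > 0" using r0(1) by simp
  have evY: "\<forall>\<^sub>F n in sequentially. \<forall>a\<in>?A. fd \<one> (X a n) (Y a n) < r0 / 4"
  proof (rule eventually_ball_finite, simp, rule ballI)
    fix a assume "a \<in> ?A"
    then show "\<forall>\<^sub>F n in sequentially. fd \<one> (X a n) (Y a n) < r0 / 4"
      by (intro fsimD[OF XY r04]) auto
  qed
  obtain N where N: "\<And>g h. \<lbrakk>g \<in> carrier G; h \<in> carrier G; len g \<ge> N; fd \<one> h (inv g) \<ge> r0 / 4\<rbrakk> \<Longrightarrow>
     fd \<one> (g \<otimes> h) g < r0 / 4" using contraction[OF r04] by blast
  have evN: "\<forall>\<^sub>F n in sequentially. \<forall>i\<in>{..<3}. N \<le> len (h i n)"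
  proof (rule eventually_ball_finite, simp, rule ballI)
    fix i assume i: "i \<in> {..<3::nat}"
    have "\<forall>\<^sub>F n in sequentially. N + len (s i) + len (t i) \<le> len (g n)" using inf unfolding filterlim_at_top by (rule spec)
    then show "\<forall>\<^sub>F n in sequentially. N \<le> len (h i n)"
    proof (rule eventually_mono)
      fix n assume *: "N + len (s i) + len (t i) \<le> len (g n)"
      have c: "s i \<in> carrier G" "t i \<in> carrier G" "g n \<in> carrier G" using st i gc by auto
      have "g n = inv (s i) \<otimes> (h i n \<otimes> t i)"
        using c by (simp add: h_def m_assoc mult_cancel_inv)
      then have "len (g n) \<le> len (s i) + (len (h i n) + len (t i))"
        using len_mult[of "inv (s i)" "h i n \<otimes> t i"] len_mult[of "h i n" "t i"] c hc[of i n] i by simp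
      then show "N \<le> len (h i n)" using * by simp
    qed
  qed
  have "\<forall>\<^sub>F n in sequentially. (\<forall>ab\<in>P. fd \<one> (X (fst ab) n) (X (snd ab) n) \<ge> r0) \<and>
     (\<forall>a\<in>?A. fd \<one> (X a n) (Y a n) < r0 / 4) \<and> (\<forall>i\<in>{..<3}. N \<le> len (h i n))"
    using evP evY evN by (intro eventually_conj)
  then obtain n where n: "\<And>ab. ab \<in> P \<Longrightarrow> fd \<one> (X (fst ab) n) (X (snd ab) n) \<ge> r0"
    "\<And>a. a \<in> ?A \<Longrightarrow> fd \<one> (X a n) (Y a n) < r0 / 4" "\<And>i. i < 3 \<Longrightarrow> N \<le> len (h i n)"
    using eventually_happens'[OF sequentially_bot] by blast
  have sep: "fd \<one> (Y a n) (Y b n) \<ge> r0 / 2" if "snd a \<noteq> snd b" "snd a < 3" "snd b < 3" for a b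
  proof -
    have c: "X a n \<in> carrier G" "X b n \<in> carrier G" "Y a n \<in> carrier G" "Y b n \<in> carrier G"
      using fcauchyD X Yc that by auto
    have "r0 \<le> fd \<one> (X a n) (X b n)" using n(1)[of "(a, b)"] that by (simp add: P_def)
    also have "\<dots> \<le> fd \<one> (X a n) (Y a n) + (fd \<one> (Y a n) (Y b n) + fd \<one> (X b n) (Y b n))"
      using fd_triangle[of "X a n" "Y a n" "X b n" \<one>] fd_triangle[of "Y a n" "Y b n" "X b n" \<one>]
        fd_commute[of "Y b n" "X b n" \<one>] c by simp
    finally show ?thesis using n(2)[of a] n(2)[of b] that by (simp add: mem_Times_iff)
  qed
  \<comment> \<open>Radius \<open>r0 / 4\<close> fits on both sides: the centres of different index
    are \<open>r0 / 2\<close> apart, and \<open>contraction\<close> sends points at least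
    \<open>r0 / 4\<close> from the repelling point to within \<open>r0 / 4\<close> of the attracting
    one.\<close>
  define V where "V i = {x \<in> carrier G. \<exists>p. fd \<one> x (Y (p, i) n) < r0 / 4}" for i
  show ?thesis
    unfolding ping_pong_def
  proof (intro exI conjI allI impI ballI)
    show "disjoint_family_on V {..<3}"
      unfolding disjoint_family_on_def
    proof (intro ballI impI equals0I)
      fix i j x assume ij: "i \<in> {..<3::nat}" "j \<in> {..<3::nat}" "i \<noteq> j" and "x \<in> V i \<inter> V j"
      then obtain p q where x: "x \<in> carrier G" "fd \<one> x (Y (p, i) n) < r0 / 4" "fd \<one> x (Y (q, j) n) < r0 / 4"
        by (auto simp: V_def)
      have "fd \<one> (Y (p, i) n) (Y (q, j) n) < r0 / 2"
        using fd_triangle[of "Y (p, i) n" x "Y (q, j) n" \<one>] fd_commute[of x "Y (p, i) n" \<one>]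
          Yc[of "(p, i)" n] Yc[of "(q, j)" n] x ij by simp
      then show False using sep[of "(p, i)" "(q, j)"] ij by simp
    qed
    fix i assume i: "i < (3::nat)"
    show "V i \<subseteq> carrier G" by (auto simp: V_def)
    show "h i n \<in> carrier G" using hc[OF i] .
    fix x assume x: "x \<in> carrier G - V i"
    then have "fd \<one> x (Y (False, i) n) \<ge> r0 / 4" by (auto simp: V_def not_less)
    then have "fd \<one> (h i n \<otimes> x) (Y (True, i) n) < r0 / 4"
      using N[OF hc[OF i], of x n] n(3)[OF i] x by (simp add: Y_def)
    then show "h i n \<otimes> x \<in> V i" using x hc[OF i] by (auto simp: V_def)
  qed
qed

text \<open>If the boundary is not thin, compactness yields two distinct boundary points. Any point
  differs from one of them, which can then serve as the second point in the linear growth lemma. So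
  without linear growth all orbits are infinite, in particular those of the limits of a sequence and
  of its inverses.\<close>

lemma trichotomy:
  shows "(\<forall>\<delta>>0. \<exists>N. \<forall>x\<in>carrier G. \<forall>y\<in>carrier G. len x \<ge> N \<longrightarrow> len y \<ge> N \<longrightarrow> fd \<one> x y < \<delta>) \<or>
    (\<exists>C. \<forall>k\<ge>1. card (wball k) \<le> C * k) \<or> ping_pong G"
proof (rule disjCI, rule ccontr)
  assume "\<not> ((\<exists>C. \<forall>k\<ge>1. card (wball k) \<le> C * k) \<or> ping_pong G)"
  then have nolin: "\<not> (\<exists>C. \<forall>k\<ge>1. card (wball k) \<le> C * k)" and nopp: "\<not> ping_pong G" by auto
  assume "\<not> (\<forall>\<delta>>0. \<exists>N. \<forall>x\<in>carrier G. \<forall>y\<in>carrier G. len x \<ge> N \<longrightarrow> len y \<ge> N \<longrightarrow> fd \<one> x y < \<delta>)"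
  then have "\<exists>\<delta>>0. \<forall>N. \<exists>x\<in>carrier G. \<exists>y\<in>carrier G. len x \<ge> N \<and> len y \<ge> N \<and> fd \<one> x y \<ge> \<delta>"
    by (simp add: not_less)
  then obtain \<delta> where \<delta>: "\<delta> > 0"
    "\<forall>N. \<exists>x\<in>carrier G. \<exists>y\<in>carrier G. len x \<ge> N \<and> len y \<ge> N \<and> fd \<one> x y \<ge> \<delta>"
    by (elim exE conjE)
  from \<delta>(2) obtain a b where ab: "\<And>n. a n \<in> carrier G" "\<And>n. b n \<in> carrier G" "\<And>n. len (a n) \<ge> n"
    "\<And>n. len (b n) \<ge> n" "\<And>n. fd \<one> (a n) (b n) \<ge> \<delta>" by metis
  have abinf: "to_infinity a" "to_infinity b"
    by (rule filterlim_at_top_mono[OF filterlim_ident]; use ab in simp)+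
  obtain r1 where r1: "strict_mono r1" "fcauchy (a \<circ> r1)" using fcauchy_subseq_ex[of a] ab by auto
  obtain r2 where r2: "strict_mono r2" "fcauchy ((b \<circ> r1) \<circ> r2)" using fcauchy_subseq_ex[of "b \<circ> r1"] ab by auto
  define a' where "a' = (a \<circ> r1) \<circ> r2"
  define b' where "b' = (b \<circ> r1) \<circ> r2"
  have a': "fcauchy a'" "to_infinity a'" and b': "fcauchy b'" "to_infinity b'"
    unfolding a'_def b'_def
    by (intro fcauchy_subseq to_infinity_subseq r1 r2 abinf)+
  have ns: "\<not> fsim a' b'"
  proof
    assume "fsim a' b'"
    from fsimD[OF this \<delta>(1)] obtain n where "fd \<one> (a' n) (b' n) < \<delta>"
      using eventually_happens'[OF sequentially_bot] by blast
    then show False using ab(5)[of "r1 (r2 n)"] by (simp add: a'_def b'_def)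
  qed
  have "\<not> finite_orbit p" if p: "fcauchy p" for p
  proof
    assume fo: "finite_orbit p"
    have rs: "range p \<subseteq> carrier G" "range a' \<subseteq> carrier G" "range b' \<subseteq> carrier G"
      using fcauchyD p a' b' by auto
    \<comment> \<open>Otherwise \<open>a'\<close> and \<open>b'\<close> would have the same
      limit.\<close>
    have "\<not> fsim p a' \<or> \<not> fsim p b'"
      using ns fsim_trans[OF rs(2,1,3)] fsim_commute[OF rs(1,2)] by blast
    then show False
      using finite_orbit_imp_linear_growth[OF p a'(1) _ a'(2) fo]
        finite_orbit_imp_linear_growth[OF p b'(1) _ b'(2) fo] nolin by blast
  qed
  note no = this
  obtain r3 where r3: "strict_mono r3" "fcauchy ((\<lambda>n. inv (a' n)) \<circ> r3)"
    using fcauchy_subseq_ex[of "\<lambda>n. inv (a' n)"] fcauchyD[OF a'(1)] by auto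
  have "ping_pong G"
  proof (rule infinite_orbits_imp_ping_pong)
    show "fcauchy (a' \<circ> r3)" using a'(1) r3(1) by (rule fcauchy_subseq)
    then show "\<not> finite_orbit (a' \<circ> r3)" by (rule no)
    show "fcauchy (\<lambda>n. inv ((a' \<circ> r3) n))" using r3(2) by (simp add: o_def)
    then show "\<not> finite_orbit (\<lambda>n. inv ((a' \<circ> r3) n))" by (rule no)
    show "to_infinity (a' \<circ> r3)" using a'(2) r3(1) by (rule to_infinity_subseq)
  qed
  then show False using nopp by simp
qed

end

section \<open>Exponential decay of the transition probabilities\<close>

text \<open>The difference of the two sides without the term in \<open>c\<close> is the variance of
  \<open>X\<close>. Two atoms of mass at least \<open>c\<close> already contribute \<open>c\<close>
  times the sum of the squared deviations of \<open>X a\<close> and \<open>X b\<close> from the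
  mean, and that sum is at least half of \<open>(X a - X b)\<close> squared.\<close>

lemma pmf_variance_two_points:
  fixes X :: "'a \<Rightarrow> real"
  assumes X: "\<And>s. \<bar>X s\<bar> \<le> B" and c: "c \<ge> 0" "pmf A a \<ge> c" "pmf A b \<ge> c"
  shows "(\<integral>s. X s \<partial>measure_pmf A)\<^sup>2 + c / 2 * (X a - X b)\<^sup>2 \<le> (\<integral>s. (X s)\<^sup>2 \<partial>measure_pmf A)"
proof -
  define m where "m = (\<integral>s. X s \<partial>measure_pmf A)"
  have iX: "integrable (measure_pmf A) X"
    using X by (intro measure_pmf.integrable_const_bound[where B = B]) auto
  have "(X s)\<^sup>2 \<le> B\<^sup>2" for s using power_mono[OF X[of s], of 2] by simp
  then have iX2: "integrable (measure_pmf A) (\<lambda>s. (X s)\<^sup>2)"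
    by (intro measure_pmf.integrable_const_bound[where B = "B\<^sup>2"]) auto
  have iY: "integrable (measure_pmf A) (\<lambda>s. (X s - m)\<^sup>2)"
    using iX iX2 by (simp add: power2_diff)
  have var: "(\<integral>s. (X s - m)\<^sup>2 \<partial>measure_pmf A) = (\<integral>s. (X s)\<^sup>2 \<partial>measure_pmf A) - m\<^sup>2"
    using measure_pmf.variance_eq[OF iX iX2] by (simp add: m_def)
  have "c / 2 * (X a - X b)\<^sup>2 \<le> (\<integral>s. (X s - m)\<^sup>2 \<partial>measure_pmf A)"
  \<comment> \<open>For equal atoms the same mass would be counted twice, but then the left-hand
    side vanishes.\<close>
  proof (cases "a = b")
    case True then show ?thesis by simp
  next
    case False
    have "c / 2 * (X a - X b)\<^sup>2 \<le> c * ((X a - m)\<^sup>2 + (X b - m)\<^sup>2)"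
    proof -
      have "(X a - X b)\<^sup>2 \<le> 2 * ((X a - m)\<^sup>2 + (X b - m)\<^sup>2)"
        using zero_le_power2[of "(X a - m) + (X b - m)"] by (simp add: power2_eq_square algebra_simps)
      then have "c / 2 * (X a - X b)\<^sup>2 \<le> c / 2 * (2 * ((X a - m)\<^sup>2 + (X b - m)\<^sup>2))"
        using c(1) by (intro mult_left_mono) auto
      then show ?thesis by (simp add: algebra_simps)
    qed
    also have "\<dots> \<le> (X a - m)\<^sup>2 * pmf A a + (X b - m)\<^sup>2 * pmf A b"
      using c by (simp add: distrib_left mult.commute[of c] add_mono mult_left_mono)
    also have "\<dots> = (\<Sum>s\<in>{a, b}. (X s - m)\<^sup>2 * indicator {a, b} s * pmf A s)"
      using False by simp
    also have "\<dots> = (\<integral>s. (X s - m)\<^sup>2 * indicator {a, b} s \<partial>measure_pmf A)"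
      by (rule integral_measure_pmf_real[symmetric]) (auto simp: indicator_def split: if_splits)
    also have "\<dots> \<le> (\<integral>s. (X s - m)\<^sup>2 \<partial>measure_pmf A)"
      by (rule integral_mono[OF _ iY])
        (auto split: split_indicator intro!: integrable_real_mult_indicator iY)
    finally show ?thesis .
  qed
  then show ?thesis using var by (simp add: m_def)
qed

section \<open>Convolution powers, lazy walks and contraction of the l^2 norm\<close>

context group
begin

definition conv :: "'a pmf \<Rightarrow> 'a pmf \<Rightarrow> 'a pmf" where
  "conv A B = bind_pmf A (\<lambda>s. map_pmf (\<lambda>x. s \<otimes> x) B)"

primrec conv_pow :: "'a pmf \<Rightarrow> nat \<Rightarrow> 'a pmf" where
  "conv_pow A 0 = return_pmf \<one>"
| "conv_pow A (Suc n) = conv A (conv_pow A n)"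

lemma set_conv: "set_pmf (conv A B) = {s \<otimes> x |s x. s \<in> set_pmf A \<and> x \<in> set_pmf B}"
  by (auto simp: conv_def)

lemma set_conv_sub:
  "\<lbrakk>set_pmf A \<subseteq> carrier G; set_pmf B \<subseteq> carrier G\<rbrakk> \<Longrightarrow> set_pmf (conv A B) \<subseteq> carrier G"
  by (auto simp: set_conv)

lemma set_conv_pow_sub: "set_pmf A \<subseteq> carrier G \<Longrightarrow> set_pmf (conv_pow A n) \<subseteq> carrier G"
  by (induction n) (simp_all add: set_conv_sub)

lemma conv_assoc:
  assumes "set_pmf A \<subseteq> carrier G" "set_pmf B \<subseteq> carrier G" "set_pmf C \<subseteq> carrier G"
  shows "conv (conv A B) C = conv A (conv B C)"
proof -
  have "conv (conv A B) C = bind_pmf A (\<lambda>s. bind_pmf B (\<lambda>t. map_pmf (\<lambda>x. (s \<otimes> t) \<otimes> x) C))"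
    by (simp add: conv_def bind_assoc_pmf bind_map_pmf)
  also have "\<dots> = bind_pmf A (\<lambda>s. bind_pmf B (\<lambda>t. map_pmf (\<lambda>x. s \<otimes> (t \<otimes> x)) C))"
    using assms by (intro bind_pmf_cong refl map_pmf_cong) (simp add: subset_iff m_assoc)
  also have "\<dots> = conv A (conv B C)"
    by (simp add: conv_def map_bind_pmf pmf.map_comp o_def)
  finally show ?thesis .
qed

lemma conv_one: "set_pmf B \<subseteq> carrier G \<Longrightarrow> conv (return_pmf \<one>) B = B"
proof -
  assume "set_pmf B \<subseteq> carrier G"
  then have "map_pmf (\<lambda>x. \<one> \<otimes> x) B = map_pmf (\<lambda>x. x) B" by (intro map_pmf_cong refl) auto
  then show ?thesis by (simp add: conv_def bind_return_pmf)
qed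

lemma conv_pow_add:
  assumes "set_pmf A \<subseteq> carrier G"
  shows "conv_pow A (m + n) = conv (conv_pow A m) (conv_pow A n)"
  by (induction m) (use assms in \<open>simp_all add: conv_one set_conv_pow_sub conv_assoc\<close>)

lemma pmf_map_left:
  assumes "s \<in> carrier G" "x \<in> carrier G" "set_pmf B \<subseteq> carrier G"
  shows "pmf (map_pmf (\<lambda>x. s \<otimes> x) B) x = pmf B (inv s \<otimes> x)"
proof (cases "inv s \<otimes> x \<in> set_pmf B")
  case True
  have "inj_on (\<lambda>x. s \<otimes> x) (set_pmf B)" using assms by (auto intro!: inj_onI simp: subset_iff)
  from pmf_map_inj[OF this True] show ?thesis using assms by (simp add: mult_cancel_inv)
next
  case False
  then have "x \<notin> (\<lambda>x. s \<otimes> x) ` set_pmf B" using assms by (auto simp: mult_cancel_inv subset_iff)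
  then show ?thesis using False by (simp add: pmf_map_outside pmf_eq_0_set_pmf)
qed

lemma pmf_conv:
  assumes "x \<in> carrier G" "set_pmf A \<subseteq> carrier G" "set_pmf B \<subseteq> carrier G"
  shows "pmf (conv A B) x = (\<integral>s. pmf B (inv s \<otimes> x) \<partial>measure_pmf A)"
  unfolding conv_def pmf_bind
  by (intro integral_cong_AE) (use assms in \<open>auto simp: AE_measure_pmf_iff pmf_map_left subset_iff\<close>)

lemma pmf_conv_mono:
  assumes "x \<in> carrier G" "set_pmf A \<subseteq> carrier G" "set_pmf B \<subseteq> carrier G" "set_pmf C \<subseteq> carrier G"
    and le: "\<And>y. y \<in> carrier G \<Longrightarrow> c * pmf B y \<le> pmf C y"
  shows "c * pmf (conv A B) x \<le> pmf (conv A C) x"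
proof -
  have int: "integrable (measure_pmf A) (\<lambda>s. pmf D (inv s \<otimes> x))" for D :: "'a pmf"
    by (intro measure_pmf.integrable_const_bound[where B = 1]) (auto simp: pmf_le_1)
  have "c * pmf (conv A B) x = (\<integral>s. c * pmf B (inv s \<otimes> x) \<partial>measure_pmf A)"
    using assms by (simp add: pmf_conv)
  also have "\<dots> \<le> (\<integral>s. pmf C (inv s \<otimes> x) \<partial>measure_pmf A)"
    by (intro integral_mono_AE integrable_mult_right int)
      (use assms in \<open>auto simp: AE_measure_pmf_iff subset_iff\<close>)
  finally show ?thesis using assms by (simp add: pmf_conv)
qed

text \<open>Laziness removes periodicity: one power of the lazy walk charges all elements that
  \<open>A\<close> reaches at any time up to the exponent.\<close>

definition lazy :: "'a pmf \<Rightarrow> 'a pmf" where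
  "lazy A = bind_pmf (bernoulli_pmf (1 / 2)) (\<lambda>b. if b then A else return_pmf \<one>)"

lemma set_lazy: "set_pmf A \<subseteq> carrier G \<Longrightarrow> set_pmf (lazy A) \<subseteq> carrier G"
  by (auto simp: lazy_def split: if_splits)

lemma pmf_conv_lazy:
  assumes "set_pmf B \<subseteq> carrier G"
  shows "pmf (conv (lazy A) B) x = (pmf (conv A B) x + pmf B x) / 2"
proof -
  have "conv (lazy A) B = bind_pmf (bernoulli_pmf (1 / 2)) (\<lambda>b. if b then conv A B else conv (return_pmf \<one>) B)"
    unfolding lazy_def conv_def bind_assoc_pmf by (intro bind_pmf_cong) auto
  then show ?thesis using assms by (simp add: pmf_bind conv_one)
qed

text \<open>With probability \<open>(k choose j) / 2 ^ k\<close> exactly \<open>j\<close> of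
  \<open>k\<close> lazy steps are genuine, and then the position is distributed as
  \<open>conv_pow A j\<close>. The inequality keeps this one term of the binomial mixture; the
  induction is Pascal's rule.\<close>

lemma pmf_lazy_conv_pow:
  assumes A: "set_pmf A \<subseteq> carrier G" and "x \<in> carrier G"
  shows "real (k choose j) / 2 ^ k * pmf (conv_pow A j) x \<le> pmf (conv_pow (lazy A) k) x"
  using assms(2)
proof (induction k arbitrary: j x)
  case 0
  then show ?case by (cases j) auto
next
  case (Suc k)
  note sub = set_conv_pow_sub[OF A] set_conv_pow_sub[OF set_lazy[OF A]]
  have eq: "pmf (conv_pow (lazy A) (Suc k)) x =
      (pmf (conv A (conv_pow (lazy A) k)) x + pmf (conv_pow (lazy A) k) x) / 2"
    using sub by (simp add: pmf_conv_lazy)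
  show ?case
  proof (cases j)
    case 0
    have "real (Suc k choose 0) / 2 ^ Suc k * pmf (conv_pow A 0) x =
        (real (k choose 0) / 2 ^ k * pmf (conv_pow A 0) x) / 2" by simp
    also have "\<dots> \<le> pmf (conv_pow (lazy A) k) x / 2"
      using Suc.IH[OF Suc.prems, of 0] by (intro divide_right_mono) auto
    also have "\<dots> \<le> pmf (conv_pow (lazy A) (Suc k)) x" unfolding eq by (simp add: pmf_nonneg)
    finally show ?thesis using 0 by blast
  next
    case (Suc i)
    have "real (k choose i) / 2 ^ k * pmf (conv A (conv_pow A i)) x \<le> pmf (conv A (conv_pow (lazy A) k)) x"
      using Suc.IH Suc.prems A sub by (intro pmf_conv_mono) auto
    moreover have "real (k choose Suc i) / 2 ^ k * pmf (conv_pow A (Suc i)) x \<le> pmf (conv_pow (lazy A) k) x"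
      using Suc.IH Suc.prems by blast
    ultimately show ?thesis unfolding eq Suc by (simp add: field_simps)
  qed
qed

lemma word_prod_in_conv_pow: "set xs \<subseteq> set_pmf A \<Longrightarrow> word_prod G xs \<in> set_pmf (conv_pow A (length xs))"
  by (induction xs) (auto simp: set_conv)

text \<open>The squared l^2 norm on the group; for a distribution supported in the carrier it is the
  probability that two independent samples agree.\<close>

definition collision :: "'a pmf \<Rightarrow> ennreal" where
  "collision A = (\<integral>\<^sup>+x. ennreal ((pmf A x)\<^sup>2) \<partial>count_space (carrier G))"

lemma collision_le_1: "collision A \<le> 1"
proof -
  have "collision A \<le> (\<integral>\<^sup>+x. ennreal (pmf A x) \<partial>count_space (carrier G))"
    unfolding collision_def
    by (intro nn_integral_mono ennreal_leI) (simp add: power2_eq_square mult_left_le pmf_le_1)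
  also have "\<dots> \<le> 1" by (simp add: nn_integral_pmf measure_pmf.emeasure_le_1)
  finally show ?thesis .
qed

lemma pmf_le_collision: "x \<in> carrier G \<Longrightarrow> ennreal ((pmf A x)\<^sup>2) \<le> collision A"
  unfolding collision_def by (rule nn_integral_ge_point)

lemma nn_integral_left:
  assumes "g \<in> carrier G"
  shows "(\<integral>\<^sup>+x. F (g \<otimes> x) \<partial>count_space (carrier G)) = (\<integral>\<^sup>+x. F x \<partial>count_space (carrier G))"
proof (rule nn_integral_bij_count_space)
  show "bij_betw (\<lambda>x. g \<otimes> x) (carrier G) (carrier G)"
    by (rule bij_betwI[where g = "\<lambda>x. inv g \<otimes> x"]) (use assms in \<open>auto simp: mult_cancel_inv\<close>)
qed

text \<open>At each \<open>x\<close>, the convolution is the mean over \<open>s\<close> of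
  \<open>pmf B (inv s \<otimes> x)\<close>, so its square falls short of the mean square by a
  variance. The atoms \<open>\<one>\<close> and \<open>inv h\<close> bound this variance from below,
  and by translation invariance the mean squares add up to \<open>collision B\<close>.\<close>

lemma collision_conv:
  assumes countable_carrier: "countable (carrier G)"
    and A: "set_pmf A \<subseteq> carrier G" and B: "set_pmf B \<subseteq> carrier G"
    and c: "c \<ge> 0" "pmf A \<one> \<ge> c" "pmf A (inv h) \<ge> c" and h: "h \<in> carrier G"
  shows "collision (conv A B) + ennreal (c / 2) *
    (\<integral>\<^sup>+x. ennreal ((pmf B x - pmf B (h \<otimes> x))\<^sup>2) \<partial>count_space (carrier G)) \<le> collision B"
proof -
  have comb: "ennreal a + ennreal b * ennreal d = ennreal (a + b * d)" if "a \<ge> 0" "b \<ge> 0" "d \<ge> 0" for a b d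
    using that by (simp add: ennreal_mult ennreal_plus)
  have "collision (conv A B) + ennreal (c / 2) *
      (\<integral>\<^sup>+x. ennreal ((pmf B x - pmf B (h \<otimes> x))\<^sup>2) \<partial>count_space (carrier G)) =
      (\<integral>\<^sup>+x. ennreal ((pmf (conv A B) x)\<^sup>2 + c / 2 * (pmf B x - pmf B (h \<otimes> x))\<^sup>2) \<partial>count_space (carrier G))"
    unfolding collision_def using c(1)
    by (subst nn_integral_cmult[symmetric], simp, subst nn_integral_add[symmetric], simp, simp)
      (intro nn_integral_cong comb, simp_all)
  also have "\<dots> \<le> (\<integral>\<^sup>+x. ennreal (\<integral>s. (pmf B (inv s \<otimes> x))\<^sup>2 \<partial>measure_pmf A) \<partial>count_space (carrier G))"
  proof (intro nn_integral_mono ennreal_leI)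
    fix x assume "x \<in> space (count_space (carrier G))"
    then have x: "x \<in> carrier G" by simp
    have "\<bar>pmf B (inv s \<otimes> x)\<bar> \<le> 1" for s by (simp add: pmf_le_1)
    from pmf_variance_two_points[where X = "\<lambda>s. pmf B (inv s \<otimes> x)", OF this c]
    show "(pmf (conv A B) x)\<^sup>2 + c / 2 * (pmf B x - pmf B (h \<otimes> x))\<^sup>2 \<le>
        (\<integral>s. (pmf B (inv s \<otimes> x))\<^sup>2 \<partial>measure_pmf A)"
      using h x by (simp add: pmf_conv[OF x A B])
  qed
  also have "\<dots> = (\<integral>\<^sup>+x. \<integral>\<^sup>+s. ennreal ((pmf B (inv s \<otimes> x))\<^sup>2) \<partial>measure_pmf A \<partial>count_space (carrier G))"
    by (intro nn_integral_cong nn_integral_eq_integral[symmetric]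
        measure_pmf.integrable_const_bound[where B = 1]) (auto simp: pmf_le_1 power_le_one)
  also have "\<dots> = (\<integral>\<^sup>+s. \<integral>\<^sup>+x. ennreal ((pmf B (inv s \<otimes> x))\<^sup>2) \<partial>count_space (carrier G) \<partial>measure_pmf A)"
    by (rule nn_integral_count_space_nn_integral[symmetric]) (auto intro: countable_carrier)
  also have "\<dots> = (\<integral>\<^sup>+s. collision B \<partial>measure_pmf A)"
    using nn_integral_left[of "inv s" "\<lambda>x. ennreal ((pmf B x)\<^sup>2)" for s] A
    by (intro nn_integral_cong_AE) (auto simp: AE_measure_pmf_iff collision_def subset_iff)
  also have "\<dots> = collision B" by simp
  finally show ?thesis .
qed

text \<open>One of three disjoint sets carries at most a third of the mass of the square of \<open>B\<close>, so that
  the element moving its complement into it moves \<open>B\<close> substantially.\<close>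

lemma ping_pong_displacement:
  assumes disj: "disjoint_family_on V {..<3::nat}"
    and V: "\<And>i. i < 3 \<Longrightarrow> V i \<subseteq> carrier G" and h: "\<And>i. i < 3 \<Longrightarrow> h i \<in> carrier G"
    and pp: "\<And>i x. \<lbrakk>i < 3; x \<in> carrier G - V i\<rbrakk> \<Longrightarrow> h i \<otimes> x \<in> V i"
  obtains i where "i < 3"
    "collision B \<le> 18 * (\<integral>\<^sup>+x. ennreal ((pmf B x - pmf B (h i \<otimes> x))\<^sup>2) \<partial>count_space (carrier G))"
proof -
  define m where "m U = (\<integral>\<^sup>+x. ennreal ((pmf B x)\<^sup>2) \<partial>count_space U)" for U
  have m_density: "m U = emeasure (density (count_space UNIV) (\<lambda>x. ennreal ((pmf B x)\<^sup>2))) U" for U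
    by (simp add: m_def emeasure_density nn_integral_count_space_indicator)
  have "(\<Sum>i<3. m (V i)) = m (\<Union>i<3. V i)"
    unfolding m_density using disj by (intro sum_emeasure) auto
  also have "\<dots> \<le> m (carrier G)"
    unfolding m_density using V by (intro emeasure_mono) auto
  finally have sum3: "(\<Sum>i<3. m (V i)) \<le> m (carrier G)" .
  have N: "m (carrier G) = collision B" by (simp add: m_def collision_def)
  have fin: "m (carrier G) < \<top>" using collision_le_1[of B] unfolding N by (simp add: order_le_less_trans)
  have "\<exists>i<3. 3 * m (V i) \<le> m (carrier G)"
  proof (rule ccontr)
    assume "\<not> ?thesis"
    then have gt: "m (carrier G) < 3 * m (V i)" if "i < 3" for i using that by (auto simp: not_le)
    have le: "m (V i) \<le> m (carrier G)" if "i < 3" for i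
      unfolding m_density using V[OF that] by (intro emeasure_mono) auto
    obtain a where a: "m (carrier G) = ennreal a" "a \<ge> 0" using fin by (cases "m (carrier G)") auto
    have "\<exists>b\<ge>0. m (V i) = ennreal b" if "i < 3" for i
      using le[OF that] fin by (cases "m (V i)") (auto simp: top_unique)
    then obtain b where b: "\<And>i. i < 3 \<Longrightarrow> b i \<ge> 0" "\<And>i. i < 3 \<Longrightarrow> m (V i) = ennreal (b i)" by metis
    have "a < 3 * b i" if "i < 3" for i
      using gt[OF that] a b[OF that] by (simp add: ennreal_mult'[symmetric] ennreal_less_iff
          flip: ennreal_numeral)
    moreover have "b 0 + b 1 + b 2 \<le> a"
      using sum3 a b by (simp add: eval_nat_numeral ennreal_plus[symmetric] del: ennreal_plus)
    ultimately show False using a(2) by (smt (verit) numeral_less_iff of_nat_numeral semiring_norm zero_less_numeral one_less_numeral_iff)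
  qed
  then obtain i where i: "i < 3" "3 * m (V i) \<le> m (carrier G)" by blast
  define D where "D = (\<integral>\<^sup>+x. ennreal ((pmf B x - pmf B (h i \<otimes> x))\<^sup>2) \<partial>count_space (carrier G))"
  let ?W = "carrier G - V i"
  have "m (V i \<union> ?W) = m (V i) + m ?W"
    unfolding m_density by (subst plus_emeasure) auto
  then have split: "m (carrier G) = m (V i) + m ?W" using V[OF i(1)] by (simp add: Un_absorb1)
  have comb: "ennreal (a * b + 3 * d) = ennreal a * ennreal b + 3 * ennreal d"
    if "a \<ge> 0" "b \<ge> 0" "d \<ge> 0" for a b d :: real
    using that by (simp add: ennreal_mult ennreal_plus)
  have "m ?W \<le> (\<integral>\<^sup>+x. (ennreal (3/2) * ennreal ((pmf B (h i \<otimes> x))\<^sup>2) +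
        3 * ennreal ((pmf B x - pmf B (h i \<otimes> x))\<^sup>2)) \<partial>count_space ?W)"
    unfolding m_def
  proof (intro nn_integral_mono)
    fix x
    \<comment> \<open>The weight 3/2 leaves room. The complement of \<open>V i\<close> carries at
      least 2/3 of the total and its image at most 1/3, which becomes 1/2 after weighting. The
      missing 1/6 is at most \<open>3 * D\<close>, whence the constant 18.\<close>
    let ?u = "pmf B x" and ?v = "pmf B (h i \<otimes> x)"
    have "?u\<^sup>2 \<le> 3/2 * ?v\<^sup>2 + 3 * (?u - ?v)\<^sup>2"
      using zero_le_power2[of "2 * ?u - 3 * ?v"] by (simp add: power2_eq_square algebra_simps)
    then have "ennreal (?u\<^sup>2) \<le> ennreal (3/2 * ?v\<^sup>2 + 3 * (?u - ?v)\<^sup>2)" by (rule ennreal_leI)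
    also have "\<dots> = ennreal (3/2) * ennreal (?v\<^sup>2) + 3 * ennreal ((?u - ?v)\<^sup>2)"
      using comb[of "3/2" "?v\<^sup>2" "(?u - ?v)\<^sup>2"] by simp
    finally show "ennreal (?u\<^sup>2) \<le> ennreal (3/2) * ennreal (?v\<^sup>2) + 3 * ennreal ((?u - ?v)\<^sup>2)" .
  qed
  also have "\<dots> = ennreal (3/2) * (\<integral>\<^sup>+x. ennreal ((pmf B (h i \<otimes> x))\<^sup>2) \<partial>count_space ?W) +
      3 * (\<integral>\<^sup>+x. ennreal ((pmf B x - pmf B (h i \<otimes> x))\<^sup>2) \<partial>count_space ?W)"
    by (simp add: nn_integral_add nn_integral_cmult)
  also have "(\<integral>\<^sup>+x. ennreal ((pmf B (h i \<otimes> x))\<^sup>2) \<partial>count_space ?W) = m ((\<lambda>x. h i \<otimes> x) ` ?W)"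
    unfolding m_def
    by (rule nn_integral_bij_count_space) (use h[OF i(1)] in \<open>auto simp: bij_betw_def intro!: inj_onI\<close>)
  also have "\<dots> \<le> m (V i)"
    unfolding m_density using pp[OF i(1)] by (intro emeasure_mono) auto
  also have "(\<integral>\<^sup>+x. ennreal ((pmf B x - pmf B (h i \<otimes> x))\<^sup>2) \<partial>count_space ?W) \<le> D"
    unfolding D_def by (subst (1 2) nn_integral_count_space_indicator)
      (auto intro!: nn_integral_mono split: split_indicator)
  finally have W: "m ?W \<le> ennreal (3/2) * m (V i) + 3 * D" by (simp add: add_left_mono add_right_mono mult_left_mono)
  have "collision B \<le> 18 * D"
  proof (cases "D = \<top>")
    case False
    then obtain d where d: "D = ennreal d" "d \<ge> 0" by (cases D) auto
    have "m (V i) \<noteq> \<top>" "m ?W \<noteq> \<top>" using fin split by auto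
    then obtain u w where uw: "m (V i) = ennreal u" "m ?W = ennreal w" "u \<ge> 0" "w \<ge> 0"
      by (metis ennreal_cases)
    have eq: "m (carrier G) = ennreal (u + w)" using uw split by (simp add: ennreal_plus)
    have "3 * ennreal u = ennreal (3 * u)" using uw by (simp add: ennreal_mult)
    then have "3 * u \<le> u + w"
      using i(2) uw unfolding eq uw(1) by (metis add_nonneg_nonneg ennreal_le_iff)
    moreover have "w \<le> 3/2 * u + 3 * d"
    proof -
      have "ennreal w \<le> ennreal (3/2) * ennreal u + 3 * ennreal d" using W uw d by simp
      also have "\<dots> = ennreal (3/2 * u + 3 * d)" by (rule comb[symmetric]) (use uw d in auto)
      finally show ?thesis using uw d by (subst (asm) ennreal_le_iff) auto
    qed
    ultimately have "u + w \<le> 18 * d" by linarith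
    then show ?thesis unfolding N[symmetric] eq d using d
      by (simp add: ennreal_mult'[symmetric] ennreal_leI flip: ennreal_numeral)
  qed simp
  then show ?thesis using that i(1) by (simp add: D_def)
qed

text \<open>A block of \<open>J\<close> lazy steps shrinks \<open>collision\<close> by the factor
  \<open>\<theta>\<close>, whichever of the three elements displaces the current distribution. In
  \<open>2 * n\<close> lazy steps exactly \<open>n\<close> are genuine with probability at least
  \<open>1 / (2 * n)\<close>, so the decay passes to \<open>A\<close> up to a linear factor.\<close>

lemma exponential_decay:
  assumes countable_carrier: "countable (carrier G)"
    and A: "set_pmf A \<subseteq> carrier G" and sg: "generates_as_semigroup G (set_pmf A)"
    and pp: "ping_pong G"
  obtains C \<rho> where "C > 0" "0 < \<rho>" "\<rho> < 1"
    "\<And>n x. x \<in> carrier G \<Longrightarrow> pmf (conv_pow A n) x \<le> C * \<rho> ^ n"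
proof -
  obtain V h where Vh': "disjoint_family_on V {..<3::nat} \<and> (\<forall>i<3. V i \<subseteq> carrier G \<and>
      h i \<in> carrier G \<and> (\<forall>x\<in>carrier G - V i. h i \<otimes> x \<in> V i))"
    using pp unfolding ping_pong_def by (elim exE) (rule that)
  then have Vh: "disjoint_family_on V {..<3::nat}"
    "\<And>i. i < 3 \<Longrightarrow> V i \<subseteq> carrier G" "\<And>i. i < 3 \<Longrightarrow> h i \<in> carrier G"
    "\<And>i x. \<lbrakk>i < 3; x \<in> carrier G - V i\<rbrakk> \<Longrightarrow> h i \<otimes> x \<in> V i"
    by simp_all
  have reach: "\<exists>j. pmf (conv_pow A j) g > 0" if g: "g \<in> carrier G" for g
  proof -
    have "g \<in> {word_prod G xs |xs. xs \<noteq> [] \<and> set xs \<subseteq> set_pmf A}"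
      using equalityD1[OF sg[unfolded generates_as_semigroup_def]] g by (rule subsetD)
    then obtain xs where "set xs \<subseteq> set_pmf A" "word_prod G xs = g" by blast
    then show ?thesis using word_prod_in_conv_pow[of xs A] by (auto simp: pmf_positive_iff)
  qed
  \<comment> \<open>The atoms demanded by \<open>collision_conv\<close>, for all three possible
    displacements at once.\<close>
  define T where "T = insert \<one> ((\<lambda>i. inv (h i)) ` {..<3})"
  have T: "finite T" "T \<noteq> {}" "T \<subseteq> carrier G" using Vh(3) by (auto simp: T_def)
  obtain j where j: "\<And>g. g \<in> T \<Longrightarrow> pmf (conv_pow A (j g)) g > 0" using reach T(3) by (metis subsetD)
  \<comment> \<open>The successor makes \<open>J\<close> positive, as division by \<open>J\<close>
    and the \<open>J\<close>-th root require.\<close>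
  define J where "J = Suc (Max (j ` T))"
  define L where "L = conv_pow (lazy A) J"
  have lsub: "set_pmf (conv_pow (lazy A) n) \<subseteq> carrier G" for n by (intro set_conv_pow_sub set_lazy A)
  have Lsub: "set_pmf L \<subseteq> carrier G" by (simp add: L_def lsub)
  have Lpos: "pmf L g > 0" if g: "g \<in> T" for g
  proof -
    have "j g \<le> J" using T(1) g by (simp add: J_def le_SucI)
    then have "0 < real (J choose j g) / 2 ^ J * pmf (conv_pow A (j g)) g"
      using j[OF g] by (simp add: zero_less_binomial_iff)
    also have "\<dots> \<le> pmf L g" unfolding L_def using g T(3) by (intro pmf_lazy_conv_pow A) auto
    finally show ?thesis .
  qed
  define c where "c = Min (pmf L ` T)"
  have c: "c > 0" "\<And>g. g \<in> T \<Longrightarrow> c \<le> pmf L g" using T Lpos by (auto simp: c_def)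
  have c1: "c \<le> 1" using c(2)[of \<one>] pmf_le_1[of L \<one>] by (simp add: T_def)
  \<comment> \<open>The drop is at least \<open>c / 2 * D\<close>, and the displacement bound gives
    \<open>D\<close> at least 1/18 of the collision.\<close>
  define \<theta> where "\<theta> = 1 - c / 36"
  have \<theta>: "0 < \<theta>" "\<theta> < 1" using c(1) c1 by (auto simp: \<theta>_def)
  have fin: "\<exists>b\<ge>0. collision B = ennreal b" for B
    using collision_le_1[of B] by (cases "collision B") (auto simp: top_unique)
  have step: "collision (conv L B) \<le> ennreal \<theta> * collision B" if B: "set_pmf B \<subseteq> carrier G" for B
  proof -
    obtain i where i: "i < 3"
      "collision B \<le> 18 * (\<integral>\<^sup>+x. ennreal ((pmf B x - pmf B (h i \<otimes> x))\<^sup>2) \<partial>count_space (carrier G))"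
      using ping_pong_displacement[OF Vh] by blast
    define D where "D = (\<integral>\<^sup>+x. ennreal ((pmf B x - pmf B (h i \<otimes> x))\<^sup>2) \<partial>count_space (carrier G))"
    have le: "collision (conv L B) + ennreal (c / 2) * D \<le> collision B"
      unfolding D_def using c i(1) Vh(3) by (intro collision_conv countable_carrier Lsub B) (auto simp: T_def)
    obtain b v where b: "b \<ge> 0" "collision B = ennreal b" and v: "v \<ge> 0" "collision (conv L B) = ennreal v"
      using fin by metis
    have "D \<noteq> \<top>" using le b c(1) by (auto simp: ennreal_mult_top top_unique)
    then obtain d where d: "D = ennreal d" "d \<ge> 0" by (cases D) auto
    have "ennreal (v + c / 2 * d) \<le> ennreal b"
      using le b v d c(1) by (simp add: ennreal_mult ennreal_plus del: times_divide_eq_left)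
    then have "v + c / 2 * d \<le> b" using b by (simp add: ennreal_le_iff)
    moreover have "b \<le> 18 * d"
    proof -
      have "ennreal b \<le> ennreal (18 * d)" using i(2) b d unfolding D_def[symmetric] by (simp add: ennreal_mult)
      then show ?thesis using d by (simp add: ennreal_le_iff)
    qed
    then have "c / 36 * b \<le> c / 36 * (18 * d)" using c(1) by (intro mult_left_mono) auto
    ultimately have "v \<le> \<theta> * b" by (simp add: \<theta>_def algebra_simps)
    then show ?thesis using b v \<theta>(1) by (simp add: ennreal_mult[symmetric] ennreal_leI)
  qed
  have pow: "collision (conv_pow (lazy A) (J * k)) \<le> ennreal (\<theta> ^ k)" for k
  proof (induction k)
    case 0 then show ?case using collision_le_1 by simp
  next
    case (Suc k)
    have "collision (conv_pow (lazy A) (J * Suc k)) = collision (conv L (conv_pow (lazy A) (J * k)))"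
      by (simp add: L_def conv_pow_add set_lazy A)
    also have "\<dots> \<le> ennreal \<theta> * collision (conv_pow (lazy A) (J * k))" by (intro step lsub)
    also have "\<dots> \<le> ennreal \<theta> * ennreal (\<theta> ^ k)" using Suc by (intro mult_left_mono) auto
    finally show ?case using \<theta>(1) by (simp add: ennreal_mult)
  qed
  \<comment> \<open>The square root because \<open>collision\<close> bounds squares of point masses;
    the \<open>J\<close>-th root below turns the rate per block into a rate per step.\<close>
  define \<tau> where "\<tau> = sqrt \<theta>"
  have \<tau>: "0 < \<tau>" "\<tau> < 1" "\<tau>\<^sup>2 = \<theta>" using \<theta> by (auto simp: \<tau>_def)
  define \<rho> where "\<rho> = root J \<tau>"
  have J: "J > 0" by (simp add: J_def)
  have \<rho>: "0 < \<rho>" "\<rho> < 1" "\<rho> ^ J = \<tau>"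
    using \<tau> J by (auto simp: \<rho>_def real_root_pow_pos2)
  have lz: "pmf (conv_pow (lazy A) m) x \<le> \<rho> ^ m / \<tau>" if x: "x \<in> carrier G" for m x
  proof -
    let ?k = "m div J"
    have "conv_pow (lazy A) m = conv (conv_pow (lazy A) (m mod J)) (conv_pow (lazy A) (J * ?k))"
      by (simp add: conv_pow_add[symmetric] set_lazy A)
    then have "collision (conv_pow (lazy A) m) \<le> collision (conv_pow (lazy A) (J * ?k))"
      using collision_conv[OF countable_carrier lsub lsub, of 0 "m mod J" \<one> "J * ?k"] by simp
    then have "ennreal ((pmf (conv_pow (lazy A) m) x)\<^sup>2) \<le> ennreal (\<theta> ^ ?k)"
      using pmf_le_collision[OF x] pow[of ?k] by (meson order_trans)
    then have "(pmf (conv_pow (lazy A) m) x)\<^sup>2 \<le> (\<tau> ^ ?k)\<^sup>2"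
      using \<theta>(1) by (simp add: ennreal_le_iff \<tau>(3)[symmetric] power_mult[symmetric] mult.commute)
    then have "pmf (conv_pow (lazy A) m) x \<le> \<tau> ^ ?k" by (rule power2_le_imp_le) (use \<tau>(1) in auto)
    \<comment> \<open>The incomplete last block is paid for by the extra factor
      \<open>1 / \<tau>\<close>.\<close>
    also have "\<tau> ^ ?k = \<rho> ^ (J * ?k + J) / \<tau>" using \<rho> \<tau> by (simp add: power_add power_mult)
    also have "\<dots> \<le> \<rho> ^ m / \<tau>"
    proof (intro divide_right_mono power_decreasing)
      show "m \<le> J * ?k + J" using J by (metis add_le_cancel_left less_imp_le mod_less_divisor mult_div_mod_eq)
    qed (use \<rho> \<tau> in auto)
    finally show ?thesis .
  qed
  have "(\<lambda>n. real n * \<rho> ^ n) \<longlonglongrightarrow> 0" using powser_times_n_limit_0[of \<rho>] \<rho> by simp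
  then have "Bseq (\<lambda>n. real n * \<rho> ^ n)" by (intro convergent_imp_Bseq convergentI)
  then obtain M where M: "M > 0" "\<And>n. norm (real n * \<rho> ^ n) \<le> M" by (auto elim: BseqE)
  \<comment> \<open>Of the two factors \<open>\<rho> ^ n\<close> available at time
    \<open>2 * n\<close>, one absorbs the linear factor through \<open>M\<close>. The 1 in the
    maximum serves \<open>n = 0\<close>, where the central binomial bound says nothing.\<close>
  show ?thesis
  proof (rule that[of "max 1 (2 * M / \<tau>)" \<rho>])
    fix n x assume x: "x \<in> carrier G"
    show "pmf (conv_pow A n) x \<le> max 1 (2 * M / \<tau>) * \<rho> ^ n"
    proof (cases "n = 0")
      case True
      have "pmf (conv_pow A 0) x \<le> 1" by (rule pmf_le_1)
      also have "1 \<le> max 1 (2 * M / \<tau>)" by (rule max.cobounded1)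
      finally show ?thesis unfolding True power_0 mult_1_right .
    next
      case False
      have "1 / (2 * real n) * pmf (conv_pow A n) x = 4 ^ n / (2 * real n) / 2 ^ (2 * n) * pmf (conv_pow A n) x"
        by (simp add: power_mult)
      also have "\<dots> \<le> real (2 * n choose n) / 2 ^ (2 * n) * pmf (conv_pow A n) x"
        using central_binomial_lower_bound[of n] False by (intro mult_right_mono divide_right_mono) auto
      also have "\<dots> \<le> pmf (conv_pow (lazy A) (2 * n)) x" by (intro pmf_lazy_conv_pow A x)
      also have "\<dots> \<le> \<rho> ^ (2 * n) / \<tau>" by (intro lz x)
      finally have "2 * real n * (1 / (2 * real n) * pmf (conv_pow A n) x) \<le> 2 * real n * (\<rho> ^ (2 * n) / \<tau>)"
        by (rule mult_left_mono) simp
      then have "pmf (conv_pow A n) x \<le> 2 * real n * (\<rho> ^ (2 * n) / \<tau>)" using False by simp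
      also have "\<rho> ^ (2 * n) = \<rho> ^ n * \<rho> ^ n" unfolding mult_2 power_add ..
      also have "2 * real n * (\<rho> ^ n * \<rho> ^ n / \<tau>) = 2 / \<tau> * (real n * \<rho> ^ n) * \<rho> ^ n" by simp
      also have "\<dots> \<le> 2 / \<tau> * M * \<rho> ^ n" using M(2)[of n] \<rho> \<tau> by (intro mult_right_mono mult_left_mono) auto
      also have "\<dots> \<le> max 1 (2 * M / \<tau>) * \<rho> ^ n" using \<rho> by (intro mult_right_mono) auto
      finally show ?thesis .
    qed
  qed (use \<rho> in auto)
qed

end

section \<open>Trajectories and the Green function\<close>

lemma nn_integral_count_space_subset:
  "A \<subseteq> B \<Longrightarrow> (\<integral>\<^sup>+x. F x \<partial>count_space A) \<le> (\<integral>\<^sup>+x. F x \<partial>count_space B)"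
  by (subst (1 2) nn_integral_count_space_indicator)
    (auto intro!: nn_integral_mono split: split_indicator)

text \<open>For a map that need not be injective, selecting one preimage of each point keeps only
  part of the right-hand sum.\<close>

lemma nn_integral_count_space_image_le:
  "(\<integral>\<^sup>+y. F y \<partial>count_space (f ` A)) \<le> (\<integral>\<^sup>+x. F (f x) \<partial>count_space A)"
proof -
  have "(\<integral>\<^sup>+y. F y \<partial>count_space (f ` A)) = (\<integral>\<^sup>+y. F (f (inv_into A f y)) \<partial>count_space (f ` A))"
    by (intro nn_integral_cong) (simp add: f_inv_into_f)
  also have "\<dots> = (\<integral>\<^sup>+x. F (f x) \<partial>count_space (inv_into A f ` f ` A))"
    by (rule nn_integral_bij_count_space[where f = "\<lambda>x. F (f x)"])
      (auto simp: bij_betw_def intro: inj_on_inv_into)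
  also have "\<dots> \<le> (\<integral>\<^sup>+x. F (f x) \<partial>count_space A)"
    by (intro nn_integral_count_space_subset) (auto intro: inv_into_into)
  finally show ?thesis .
qed

lemma nn_integral_count_space_Times:
  assumes "countable A" "countable B"
  shows "(\<integral>\<^sup>+x. F (fst x) * H (snd x) \<partial>count_space (A \<times> B)) =
    (\<integral>\<^sup>+x. F x \<partial>count_space A) * (\<integral>\<^sup>+y. H y \<partial>count_space B :: ennreal)"
proof -
  interpret sigma_finite_measure "count_space B"
    using assms(2) by (rule sigma_finite_measure_count_space_countable)
  have "(\<integral>\<^sup>+x. F (fst x) * H (snd x) \<partial>count_space (A \<times> B)) =
      (\<integral>\<^sup>+x. \<integral>\<^sup>+y. F x * H y \<partial>count_space B \<partial>count_space A)"
    using nn_integral_fst[of "\<lambda>x. F (fst x) * H (snd x)" "count_space A"] assms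
    by (simp add: pair_measure_countable)
  also have "\<dots> = (\<integral>\<^sup>+x. F x * (\<integral>\<^sup>+y. H y \<partial>count_space B) \<partial>count_space A)"
    by (simp add: nn_integral_cmult)
  also have "\<dots> = (\<integral>\<^sup>+x. F x \<partial>count_space A) * (\<integral>\<^sup>+y. H y \<partial>count_space B)"
    by (simp add: nn_integral_multc)
  finally show ?thesis .
qed

lemma emeasure_UN_le_nn_integral:
  assumes "countable I" "\<And>i. i \<in> I \<Longrightarrow> X i \<in> sets M"
  shows "emeasure M (\<Union>i\<in>I. X i) \<le> (\<integral>\<^sup>+i. emeasure M (X i) \<partial>count_space I)"
proof -
  have "emeasure M (\<Union>i\<in>I. X i) = (\<integral>\<^sup>+x. indicator (\<Union>i\<in>I. X i) x \<partial>M)"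
    using assms by (intro nn_integral_indicator[symmetric] sets.countable_UN') auto
  also have "\<dots> \<le> (\<integral>\<^sup>+x. \<integral>\<^sup>+i. indicator (X i) x \<partial>count_space I \<partial>M)"
  proof (intro nn_integral_mono)
    fix x
    show "indicator (\<Union>i\<in>I. X i) x \<le> (\<integral>\<^sup>+i. indicator (X i) x \<partial>count_space I :: ennreal)"
    proof (cases "x \<in> (\<Union>i\<in>I. X i)")
      case True
      then have "indicator (\<Union>i\<in>I. X i) x = (1 :: ennreal)" by (rule indicator_simps(1))
      moreover obtain i where "i \<in> I" "x \<in> X i" using True by blast
      ultimately show ?thesis using nn_integral_ge_point[of i I "\<lambda>i. indicator (X i) x"] by simp
    qed simp
  qed
  also have "\<dots> = (\<integral>\<^sup>+i. \<integral>\<^sup>+x. indicator (X i) x \<partial>M \<partial>count_space I)"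
    using assms by (intro nn_integral_count_space_nn_integral) auto
  also have "\<dots> = (\<integral>\<^sup>+i. emeasure M (X i) \<partial>count_space I)"
    using assms by (intro nn_integral_cong nn_integral_indicator) auto
  finally show ?thesis .
qed

section \<open>Weights of sets of trajectories under translation and concatenation\<close>

locale transient_group_walk = marked_group +
  fixes \<mu> :: "'a pmf"
  assumes supp: "set_pmf \<mu> \<subseteq> carrier G"
    and semigroup: "generates_as_semigroup G (set_pmf \<mu>)"
    and transient: "transient_walk G \<mu>"
begin

abbreviation wt :: "'a list \<Rightarrow> real" where "wt \<equiv> traj_weight G \<mu>"
abbreviation T :: "'a \<Rightarrow> 'a \<Rightarrow> 'a list set" where "T \<equiv> Traj G \<mu>"

definition W :: "'a list set \<Rightarrow> ennreal" where
  "W A = (\<integral>\<^sup>+\<alpha>. ennreal (wt \<alpha>) \<partial>count_space A)"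

lemma Green_W: "Green G \<mu> x y = W (T x y)"
  by (simp add: Green_def W_def)

lemma W_mono: "A \<subseteq> B \<Longrightarrow> W A \<le> W B"
  unfolding W_def by (rule nn_integral_count_space_subset)

lemma wt_simps [simp]:
  "wt [x] = 1" "wt (x # y # p) = pmf \<mu> (inv x \<otimes> y) * wt (y # p)"
  by (simp_all add: traj_weight_def prod.lessThan_Suc_shift del: prod.lessThan_Suc)

lemma wt_nonneg [simp]: "wt \<alpha> \<ge> 0"
  unfolding traj_weight_def by (intro prod_nonneg) simp

lemma wt_append: "wt (xs @ a # ys) = wt (xs @ [a]) * wt (a # ys)"
proof (induction xs)
  case (Cons x xs)
  then show ?case by (cases xs) auto
qed simp

lemma Traj_split: "xs @ a # ys \<in> T x y \<longleftrightarrow> xs @ [a] \<in> T x a \<and> a # ys \<in> T a y"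
  by (cases xs) (auto simp: Traj_def successively_append_iff successively_Cons hd_append split: if_splits)

lemma countable_lists_carrier: "countable (lists (carrier G))"
  by (intro countable_lists countable_carrier)

lemma Traj_lists: "T x y \<subseteq> lists (carrier G)"
  by (auto simp: Traj_def)

lemma countable_Traj: "countable (T x y)"
  using Traj_lists countable_lists_carrier by (rule countable_subset)

lemma W_left_le:
  assumes g: "g \<in> carrier G" and xy: "x \<in> carrier G" "y \<in> carrier G"
  shows "W (T x y) \<le> W (T (g \<otimes> x) (g \<otimes> y))"
proof -
  have sub: "map (\<lambda>z. g \<otimes> z) ` T x y \<subseteq> T (g \<otimes> x) (g \<otimes> y)"
    using g by (auto simp: Traj_def hd_map last_map successively_map inv_mult_left subset_iff
        elim!: successively_mono)
  have wt: "wt (map (\<lambda>z. g \<otimes> z) \<alpha>) = wt \<alpha>" if "set \<alpha> \<subseteq> carrier G" "\<alpha> \<noteq> []" for \<alpha>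
    unfolding traj_weight_def length_map
  proof (rule prod.cong)
    fix i assume "i \<in> {..<length \<alpha> - 1}"
    then have "i < length \<alpha>" "Suc i < length \<alpha>" "\<alpha> ! i \<in> carrier G" "\<alpha> ! Suc i \<in> carrier G"
      using that by (auto simp: subset_iff)
    then show "pmf \<mu> (inv (map (\<lambda>z. g \<otimes> z) \<alpha> ! i) \<otimes> map (\<lambda>z. g \<otimes> z) \<alpha> ! Suc i) =
        pmf \<mu> (inv (\<alpha> ! i) \<otimes> \<alpha> ! Suc i)"
      using g by (simp add: inv_mult_left)
  qed simp
  have "inj_on (map (\<lambda>z. g \<otimes> z)) (T x y)"
    by (rule inj_on_subset[OF inj_on_mapI[of _ "lists (carrier G)"]])
      (use g in \<open>auto simp: Traj_def intro!: inj_onI\<close>)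
  then have "(\<integral>\<^sup>+\<alpha>. ennreal (wt (map (\<lambda>z. g \<otimes> z) \<alpha>)) \<partial>count_space (T x y)) =
      W (map (\<lambda>z. g \<otimes> z) ` T x y)"
    unfolding W_def by (intro nn_integral_bij_count_space) (simp add: bij_betw_def)
  moreover have "(\<integral>\<^sup>+\<alpha>. ennreal (wt (map (\<lambda>z. g \<otimes> z) \<alpha>)) \<partial>count_space (T x y)) = W (T x y)"
    unfolding W_def by (intro nn_integral_cong) (simp add: wt Traj_def)
  ultimately show ?thesis using W_mono[OF sub] by simp
qed

lemma W_left:
  assumes g: "g \<in> carrier G" and xy: "x \<in> carrier G" "y \<in> carrier G"
  shows "W (T (g \<otimes> x) (g \<otimes> y)) = W (T x y)"
  using W_left_le[OF assms] W_left_le[of "inv g" "g \<otimes> x" "g \<otimes> y"] assms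
  by (simp add: mult_cancel_inv)

lemma W_base:
  assumes "x \<in> carrier G" "y \<in> carrier G"
  shows "W (T x y) = W (T \<one> (inv x \<otimes> y))"
  using W_left[of x \<one> "inv x \<otimes> y"] assms by (simp add: mult_cancel_inv)

lemma W_finite: "\<lbrakk>x \<in> carrier G; y \<in> carrier G\<rbrakk> \<Longrightarrow> W (T x y) < \<top>"
  using transient by (simp add: transient_walk_def Green_W)

text \<open>Cutting the first factor at its first visit to \<open>a\<close> and moving the remaining loop to the
  other side makes concatenation injective.\<close>

lemma W_concat_le:
  assumes "x \<in> carrier G" "a \<in> carrier G" "y \<in> carrier G"
  shows "W (T x a) * W (T a y) \<le> W (T x y) * W (T a a)"
proof -
  define \<phi> where "\<phi> p = (takeWhile (\<lambda>z. z \<noteq> a) (fst p) @ snd p, dropWhile (\<lambda>z. z \<noteq> a) (fst p))" for p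
  let ?F = "\<lambda>p. ennreal (wt (fst p)) * ennreal (wt (snd p))"
  let ?P = "T x a \<times> T a y"
  have form: "\<exists>xs ys zs. p = (xs @ a # ys, a # zs) \<and> a \<notin> set xs" if p: "p \<in> ?P" for p
  proof -
    have "fst p \<noteq> []" "last (fst p) = a" using p by (auto simp: Traj_def)
    then have "a \<in> set (fst p)" by (metis last_in_set)
    then obtain xs ys where "fst p = xs @ a # ys" "a \<notin> set xs" by (meson split_list_first)
    moreover obtain zs where "snd p = a # zs" using p by (cases "snd p") (auto simp: Traj_def)
    ultimately show ?thesis by (metis prod.collapse)
  qed
  have \<phi>: "\<phi> (xs @ a # ys, a # zs) = (xs @ a # zs, a # ys)" if "a \<notin> set xs" for xs ys zs
    using that by (auto simp: \<phi>_def takeWhile_tail dropWhile_append)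
  have wtp: "?F (\<phi> p) = ?F p" if pP: "p \<in> ?P" for p
  proof -
    obtain xs ys zs where p: "p = (xs @ a # ys, a # zs)" "a \<notin> set xs" using form[OF pP] by blast
    show ?thesis unfolding p(1) \<phi>[OF p(2)] fst_conv snd_conv
      by (subst (1 2) wt_append) (simp add: ennreal_mult mult_ac)
  qed
  have sub: "\<phi> ` ?P \<subseteq> T x y \<times> T a a"
  proof (rule image_subsetI)
    fix p assume p': "p \<in> ?P"
    obtain xs ys zs where p: "p = (xs @ a # ys, a # zs)" "a \<notin> set xs" using form[OF p'] by blast
    have "xs @ a # ys \<in> T x a" "a # zs \<in> T a y" using p' p(1) by simp_all
    then have "xs @ a # zs \<in> T x y" "a # ys \<in> T a a"
      using Traj_split[of xs a ys x a] Traj_split[of xs a zs x y] by blast+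
    then show "\<phi> p \<in> T x y \<times> T a a" unfolding p(1) \<phi>[OF p(2)] by simp
  qed
  have "inj_on \<phi> ?P"
  proof (rule inj_onI)
    fix p q assume p': "p \<in> ?P" and q': "q \<in> ?P" and eq: "\<phi> p = \<phi> q"
    obtain xs ys zs where p: "p = (xs @ a # ys, a # zs)" "a \<notin> set xs" using form[OF p'] by blast
    obtain xs' ys' zs' where q: "q = (xs' @ a # ys', a # zs')" "a \<notin> set xs'" using form[OF q'] by blast
    have e: "xs @ a # zs = xs' @ a # zs'" "ys = ys'" using eq unfolding p(1) q(1) by (simp_all add: \<phi> p q)
    have "takeWhile (\<lambda>z. z \<noteq> a) (xs @ a # zs) = xs" "takeWhile (\<lambda>z. z \<noteq> a) (xs' @ a # zs') = xs'"
      using p(2) q(2) by (auto simp: takeWhile_tail)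
    then have "xs = xs'" using e by simp
    then show "p = q" using e p q by simp
  qed
  then have eq: "(\<integral>\<^sup>+p. ?F (\<phi> p) \<partial>count_space ?P) = (\<integral>\<^sup>+p. ?F p \<partial>count_space (\<phi> ` ?P))"
    by (intro nn_integral_bij_count_space) (simp add: bij_betw_def)
  have "W (T x a) * W (T a y) = (\<integral>\<^sup>+p. ?F p \<partial>count_space ?P)"
    unfolding W_def by (rule nn_integral_count_space_Times[symmetric]) (rule countable_Traj)+
  also have "\<dots> = (\<integral>\<^sup>+p. ?F (\<phi> p) \<partial>count_space ?P)" by (intro nn_integral_cong) (simp add: wtp)
  also have "\<dots> \<le> (\<integral>\<^sup>+p. ?F p \<partial>count_space (T x y \<times> T a a))"
    unfolding eq by (rule nn_integral_count_space_subset[OF sub])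
  also have "\<dots> = W (T x y) * W (T a a)"
    unfolding W_def by (rule nn_integral_count_space_Times) (rule countable_Traj)+
  finally show ?thesis .
qed

text \<open>Gluing a prefix, a segment and a suffix at their common end points covers the event. A
  trajectory with several such segments arises several times, hence only an inequality.\<close>

lemma W_infix_le:
  assumes c: "x \<in> carrier G" "a \<in> carrier G" "b \<in> carrier G" "y \<in> carrier G"
    and U: "U \<subseteq> lists (carrier G)" "\<And>\<beta>. \<beta> \<in> U \<Longrightarrow> \<beta> \<noteq> [] \<and> hd \<beta> = a \<and> last \<beta> = b"
  shows "W {\<gamma> \<in> T x y. \<exists>xs \<beta> zs. \<gamma> = xs @ \<beta> @ zs \<and> \<beta> \<in> U} \<le> W (T x a) * W U * W (T b y)"
proof -
  let ?bad = "{\<gamma> \<in> T x y. \<exists>xs \<beta> zs. \<gamma> = xs @ \<beta> @ zs \<and> \<beta> \<in> U}"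
  define \<psi> where "\<psi> p = butlast (fst p) @ fst (snd p) @ tl (snd (snd p))" for p :: "'a list \<times> 'a list \<times> 'a list"
  let ?P = "T x a \<times> U \<times> T b y"
  have split: "\<exists>\<beta>' \<beta>''. \<beta> = a # \<beta>' \<and> \<beta> = \<beta>'' @ [b]" if "\<beta> \<in> U" for \<beta>
    using U(2)[OF that] by (metis append_butlast_last_id list.collapse)
  have wt: "wt (xs @ \<beta> @ zs) = wt (xs @ [a]) * (wt \<beta> * wt (b # zs))" if bU: "\<beta> \<in> U" for xs \<beta> zs
  proof -
    obtain \<beta>' \<beta>'' where b: "\<beta> = a # \<beta>'" "\<beta> = \<beta>'' @ [b]" using split[OF bU] by blast
    have "wt (xs @ \<beta> @ zs) = wt (xs @ [a]) * wt (\<beta> @ zs)" using wt_append[of xs a "\<beta>' @ zs"] by (simp add: b(1))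
    moreover have "wt (\<beta> @ zs) = wt \<beta> * wt (b # zs)" using wt_append[of \<beta>'' b zs] by (simp add: b(2))
    ultimately show ?thesis by simp
  qed
  have "?bad \<subseteq> \<psi> ` ?P"
  proof
    fix \<gamma> assume "\<gamma> \<in> ?bad"
    then obtain xs \<beta> zs where g: "\<gamma> \<in> T x y" "\<gamma> = xs @ \<beta> @ zs" "\<beta> \<in> U" by blast
    obtain \<beta>' \<beta>'' where b: "\<beta> = a # \<beta>'" "\<beta> = \<beta>'' @ [b]" using split[OF g(3)] by blast
    have "xs @ [a] \<in> T x a" using g Traj_split[of xs a "\<beta>' @ zs" x y] by (simp add: b(1))
    moreover have "b # zs \<in> T b y" using g Traj_split[of "xs @ \<beta>''" b zs x y] by (simp add: b(2))
    ultimately have "(xs @ [a], \<beta>, b # zs) \<in> ?P" using g(3) by simp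
    moreover have "\<gamma> = \<psi> (xs @ [a], \<beta>, b # zs)" using g by (simp add: \<psi>_def)
    ultimately show "\<gamma> \<in> \<psi> ` ?P" by (rule rev_image_eqI)
  qed
  then have "W ?bad \<le> W (\<psi> ` ?P)" by (rule W_mono)
  also have "\<dots> \<le> (\<integral>\<^sup>+p. ennreal (wt (\<psi> p)) \<partial>count_space ?P)"
    unfolding W_def by (rule nn_integral_count_space_image_le)
  also have "\<dots> = (\<integral>\<^sup>+p. ennreal (wt (fst p)) * (ennreal (wt (fst (snd p))) * ennreal (wt (snd (snd p)))) \<partial>count_space ?P)"
  proof (rule nn_integral_cong)
    fix p assume "p \<in> space (count_space ?P)"
    then obtain \<alpha> \<beta> \<zeta> where p: "p = (\<alpha>, \<beta>, \<zeta>)" "\<alpha> \<in> T x a" "\<beta> \<in> U" "\<zeta> \<in> T b y" by auto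
    have "\<alpha> = butlast \<alpha> @ [a]" using p(2) unfolding Traj_def mem_Collect_eq by (metis append_butlast_last_id)
    moreover have "\<zeta> = b # tl \<zeta>" using p(4) unfolding Traj_def mem_Collect_eq by (metis list.collapse)
    ultimately have "wt (\<psi> p) = wt \<alpha> * (wt \<beta> * wt \<zeta>)" using wt[OF p(3), of "butlast \<alpha>" "tl \<zeta>"] by (simp add: \<psi>_def p(1))
    then show "ennreal (wt (\<psi> p)) = ennreal (wt (fst p)) * (ennreal (wt (fst (snd p))) * ennreal (wt (snd (snd p))))"
      by (simp add: p(1) ennreal_mult)
  qed
  also have "\<dots> = W (T x a) * (\<integral>\<^sup>+p. ennreal (wt (fst p)) * ennreal (wt (snd p)) \<partial>count_space (U \<times> T b y))"
    unfolding W_def using countable_subset[OF U(1) countable_lists_carrier] countable_Traj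
    by (intro nn_integral_count_space_Times[where H = "\<lambda>p. ennreal (wt (fst p)) * ennreal (wt (snd p))"]) auto
  also have "(\<integral>\<^sup>+p. ennreal (wt (fst p)) * ennreal (wt (snd p)) \<partial>count_space (U \<times> T b y)) = W U * W (T b y)"
    unfolding W_def using countable_subset[OF U(1) countable_lists_carrier] countable_Traj
    by (intro nn_integral_count_space_Times) auto
  finally show ?thesis by (simp add: mult.assoc)
qed

section \<open>Real-valued Green function and its lower bound\<close>

definition green :: "'a \<Rightarrow> 'a \<Rightarrow> real" where "green x y = enn2real (W (T x y))"

lemma W_green: "\<lbrakk>x \<in> carrier G; y \<in> carrier G\<rbrakk> \<Longrightarrow> W (T x y) = ennreal (green x y)"
  using W_finite by (simp add: green_def)

lemma green_nonneg [simp]: "green x y \<ge> 0"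
  by (simp add: green_def)

lemma green_diag: "a \<in> carrier G \<Longrightarrow> green a a = green \<one> \<one>"
  using W_base[of a a] by (simp add: green_def)

lemma green_one_ge: "green \<one> \<one> \<ge> 1"
proof -
  have "[\<one>] \<in> T \<one> \<one>" by (simp add: Traj_def)
  then have "ennreal (wt [\<one>]) \<le> W (T \<one> \<one>)" unfolding W_def by (rule nn_integral_ge_point)
  then show ?thesis by (simp add: W_green)
qed

lemma green_concat:
  assumes "x \<in> carrier G" "a \<in> carrier G" "y \<in> carrier G"
  shows "green x a * green a y \<le> green \<one> \<one> * green x y"
proof -
  have "ennreal (green x a * green a y) \<le> ennreal (green x y * green a a)"
    using W_concat_le[OF assms] assms by (simp add: W_green ennreal_mult)
  then have "green x a * green a y \<le> green x y * green a a" by simp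
  then show ?thesis unfolding green_diag[OF assms(2)] by (simp only: mult.commute)
qed

lemma green_left: "\<lbrakk>g \<in> carrier G; x \<in> carrier G; y \<in> carrier G\<rbrakk> \<Longrightarrow> green (g \<otimes> x) (g \<otimes> y) = green x y"
  by (simp add: green_def W_left)

lemma Traj_word:
  assumes "set ss \<subseteq> set_pmf \<mu>" "x \<in> carrier G"
  shows "\<exists>\<alpha>. \<alpha> \<in> T x (x \<otimes> word_prod G ss) \<and> wt \<alpha> > 0"
  using assms
proof (induction ss arbitrary: x)
  case Nil
  then show ?case by (intro exI[of _ "[x]"]) (simp add: Traj_def)
next
  case (Cons s ss)
  have s: "s \<in> carrier G" "pmf \<mu> s > 0" using Cons.prems supp by (auto simp: pmf_positive_iff)
  have ssc: "set ss \<subseteq> carrier G" using Cons.prems supp by auto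
  obtain \<alpha> where \<alpha>: "\<alpha> \<in> T (x \<otimes> s) (x \<otimes> s \<otimes> word_prod G ss)" "wt \<alpha> > 0"
    using Cons.IH[of "x \<otimes> s"] Cons.prems s by auto
  then obtain \<alpha>' where a': "\<alpha> = (x \<otimes> s) # \<alpha>'" by (cases \<alpha>) (auto simp: Traj_def)
  have "x # \<alpha> \<in> T x (x \<otimes> word_prod G (s # ss))"
    using \<alpha> Cons.prems s ssc by (auto simp: Traj_def a' mult_cancel_inv m_assoc)
  moreover have "wt (x # \<alpha>) > 0" using \<alpha>(2) Cons.prems s by (simp add: a' mult_cancel_inv)
  ultimately show ?case by blast
qed

lemma green_pos:
  assumes "x \<in> carrier G" "y \<in> carrier G" shows "green x y > 0"
proof -
  have "inv x \<otimes> y \<in> {word_prod G xs |xs. xs \<noteq> [] \<and> set xs \<subseteq> set_pmf \<mu>}"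
    by (rule subsetD[OF equalityD1[OF semigroup[unfolded generates_as_semigroup_def]]]) (use assms in simp)
  then obtain ss where ss: "set ss \<subseteq> set_pmf \<mu>" "word_prod G ss = inv x \<otimes> y" by auto
  obtain \<alpha> where "\<alpha> \<in> T x (x \<otimes> word_prod G ss)" and wt: "wt \<alpha> > 0" using Traj_word[OF ss(1) assms(1)] by blast
  then have "\<alpha> \<in> T x y" using ss(2) assms by (simp add: mult_cancel_inv)
  then have "ennreal (wt \<alpha>) \<le> W (T x y)" unfolding W_def by (rule nn_integral_ge_point)
  then have "wt \<alpha> \<le> green x y" using assms by (simp add: W_green)
  then show ?thesis using wt by simp
qed

text \<open>Walking along a shortest word, each letter costs a factor \<open>c\<close> for the
  letter and \<open>1 / green \<one> \<one>\<close> for one use of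
  \<open>green_concat\<close>.\<close>

lemma green_lower:
  obtains q where "0 < q" "q \<le> 1" "\<And>x y. \<lbrakk>x \<in> carrier G; y \<in> carrier G\<rbrakk> \<Longrightarrow> q ^ wd x y \<le> green x y"
proof -
  \<comment> \<open>The 1 covers an empty \<open>S\<close> and gives \<open>c \<le> 1\<close>, hence
    \<open>q \<le> 1\<close>.\<close>
  define c where "c = Min (insert 1 (green \<one> ` S))"
  have c: "c > 0" "\<And>s. s \<in> S \<Longrightarrow> c \<le> green \<one> s"
    using finite_S S_carrier green_pos by (auto simp: c_def)
  let ?K = "green \<one> \<one>"
  define q where "q = c / ?K"
  have K: "?K \<ge> 1" by (rule green_one_ge)
  have "c \<le> 1" using finite_S by (simp add: c_def)
  then have q: "0 < q" "q \<le> 1" using c(1) K by (auto simp: q_def divide_le_eq)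
  have word: "q ^ length ss \<le> green \<one> (word_prod G ss)" if "set ss \<subseteq> S" for ss
    using that
  proof (induction ss)
    case Nil then show ?case using K by simp
  next
    case (Cons s ss)
    have s: "s \<in> S" "s \<in> carrier G" and w: "word_prod G ss \<in> carrier G"
      using Cons.prems S_carrier by (auto simp: subset_trans[OF _ S_sub])
    have "c * q ^ length ss \<le> green \<one> s * green s (s \<otimes> word_prod G ss)"
      using Cons c q s w green_left[of s \<one> "word_prod G ss"] by (intro mult_mono) auto
    also have "\<dots> \<le> ?K * green \<one> (s \<otimes> word_prod G ss)"
      using s w by (intro green_concat) auto
    finally have "c * q ^ length ss / ?K \<le> green \<one> (s \<otimes> word_prod G ss)"
      using K by (simp add: divide_le_eq mult.commute)
    then show ?case by (simp add: q_def)
  qed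
  have "q ^ wd x y \<le> green x y" if xy: "x \<in> carrier G" "y \<in> carrier G" for x y
  proof -
    obtain ss where ss: "length ss = wd x y" "set ss \<subseteq> S" "word_prod G ss = inv x \<otimes> y"
      using len_word[of "inv x \<otimes> y"] xy by (auto simp: word_dist_def)
    have "green x y = green \<one> (inv x \<otimes> y)" using green_left[of x \<one> "inv x \<otimes> y"] xy by (simp add: mult_cancel_inv)
    then show ?thesis using word[OF ss(2)] ss by simp
  qed
  then show ?thesis using that q by blast
qed

section \<open>Probability that a trajectory contains a given segment\<close>

abbreviation P :: "'a \<Rightarrow> 'a \<Rightarrow> 'a list measure" where "P \<equiv> traj_measure G \<mu>"

lemma sets_P [simp]: "sets (P x y) = Pow (T x y)" and space_P [simp]: "space (P x y) = T x y"
  by (simp_all add: traj_measure_def sets_point_measure space_point_measure)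

lemma emeasure_P: "V \<subseteq> T x y \<Longrightarrow> emeasure (P x y) V = W V / W (T x y)"
  by (simp add: emeasure_traj_measure W_def Green_def)

text \<open>Using \<open>green_concat\<close> at \<open>a\<close> and at \<open>b\<close> cancels
  the normalisation, so the bound no longer involves \<open>x\<close> and \<open>y\<close>. All
  later estimates owe their uniformity in the end points to this.\<close>

lemma emeasure_P_infix:
  assumes c: "x \<in> carrier G" "a \<in> carrier G" "b \<in> carrier G" "y \<in> carrier G"
    and U: "U \<subseteq> lists (carrier G)" "\<And>\<beta>. \<beta> \<in> U \<Longrightarrow> \<beta> \<noteq> [] \<and> hd \<beta> = a \<and> last \<beta> = b"
  shows "emeasure (P x y) {\<gamma> \<in> T x y. \<exists>xs \<beta> zs. \<gamma> = xs @ \<beta> @ zs \<and> \<beta> \<in> U} \<le>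
    ennreal ((green \<one> \<one>)\<^sup>2 / green a b) * W U"
proof -
  let ?bad = "{\<gamma> \<in> T x y. \<exists>xs \<beta> zs. \<gamma> = xs @ \<beta> @ zs \<and> \<beta> \<in> U}" and ?K = "green \<one> \<one>"
  have gp: "green x y > 0" "green a b > 0" using c green_pos by auto
  have "green x a * green a b * green b y \<le> ?K * green x b * green b y"
    using green_concat[of x a b] c by (intro mult_right_mono) auto
  also have "\<dots> \<le> ?K * (?K * green x y)"
    using green_concat[of x b y] c by (simp add: mult.assoc mult_left_mono)
  finally have "green x a * green b y / green x y \<le> ?K\<^sup>2 / green a b"
    using gp by (simp add: field_simps power2_eq_square)
  then have le: "ennreal (green x a * green b y / green x y) \<le> ennreal (?K\<^sup>2 / green a b)" by (rule ennreal_leI)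
  have "emeasure (P x y) ?bad = W ?bad / W (T x y)" by (rule emeasure_P) auto
  also have "\<dots> \<le> (W (T x a) * W U * W (T b y)) / W (T x y)"
    by (intro divide_right_mono_ennreal W_infix_le c U)
  also have "\<dots> = ennreal (green x a * green b y / green x y) * W U"
    using c gp by (simp add: W_green divide_ennreal_def inverse_ennreal ennreal_mult divide_inverse mult_ac)
  also have "\<dots> \<le> ennreal (?K\<^sup>2 / green a b) * W U" by (intro mult_right_mono le) simp
  finally show ?thesis .
qed

text \<open>Unlike in \<open>Traj\<close>, lists of weight zero are kept: they do not affect
  \<open>W\<close>, and the recursion on the first step then needs no positivity condition.\<close>

definition paths :: "nat \<Rightarrow> 'a \<Rightarrow> 'a \<Rightarrow> 'a list set" where
  "paths n a b = {\<alpha>. length \<alpha> = Suc n \<and> set \<alpha> \<subseteq> carrier G \<and> hd \<alpha> = a \<and> last \<alpha> = b}"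

text \<open>Chapman-Kolmogorov, by splitting off the first step. It lets decay of convolution powers
  bound weights of long segments.\<close>

lemma W_paths:
  assumes "a \<in> carrier G" "b \<in> carrier G"
  shows "W (paths n a b) = ennreal (pmf (conv_pow \<mu> n) (inv a \<otimes> b))"
  using assms(1)
proof (induction n arbitrary: a)
  case 0
  show ?case
  proof (cases "a = b")
    case True
    then have "paths 0 a b = {[a]}" using 0 by (auto simp: paths_def length_Suc_conv)
    then show ?thesis using True 0 by (simp add: W_def nn_integral_count_space_finite)
  next
    case False
    then have "paths 0 a b = {}" by (auto simp: paths_def length_Suc_conv)
    moreover have "inv a \<otimes> b \<noteq> \<one>"
    proof
      assume "inv a \<otimes> b = \<one>"
      then have "a = a \<otimes> (inv a \<otimes> b)" using 0 by simp
      also have "\<dots> = b" using 0 assms(2) by (rule mult_cancel_inv)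
      finally show False using False by simp
    qed
    ultimately show ?thesis by (simp add: W_def nn_integral_count_space_finite)
  qed
next
  case (Suc n)
  define B where "B = {\<beta>. length \<beta> = Suc n \<and> set \<beta> \<subseteq> carrier G \<and> last \<beta> = b}"
  have eq: "paths (Suc n) a b = (\<lambda>\<beta>. a # \<beta>) ` B"
    using Suc.prems by (auto simp: paths_def B_def length_Suc_conv image_iff)
  have hdB: "hd \<beta> \<in> carrier G" "\<beta> = hd \<beta> # tl \<beta>" if "\<beta> \<in> B" for \<beta>
    using that by (cases \<beta>; auto simp: B_def)+
  have "W (paths (Suc n) a b) = (\<integral>\<^sup>+\<beta>. ennreal (wt (a # \<beta>)) \<partial>count_space B)"
    unfolding W_def eq by (rule nn_integral_bij_count_space[symmetric]) (auto simp: bij_betw_def)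
  also have "\<dots> = (\<integral>\<^sup>+\<beta>. \<integral>\<^sup>+c. ennreal (pmf \<mu> (inv a \<otimes> c)) * (ennreal (wt \<beta>) * indicator {\<beta>. hd \<beta> = c} \<beta>)
      \<partial>count_space (carrier G) \<partial>count_space B)"
  proof (rule nn_integral_cong)
    fix \<beta> assume "\<beta> \<in> space (count_space B)"
    then have \<beta>: "\<beta> \<in> B" by simp
    have "(\<integral>\<^sup>+c. ennreal (pmf \<mu> (inv a \<otimes> c)) * (ennreal (wt \<beta>) * indicator {\<beta>. hd \<beta> = c} \<beta>) \<partial>count_space (carrier G)) =
        (\<Sum>c\<in>{hd \<beta>}. ennreal (pmf \<mu> (inv a \<otimes> c)) * (ennreal (wt \<beta>) * indicator {\<beta>. hd \<beta> = c} \<beta>))"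
      using hdB(1)[OF \<beta>] by (intro nn_integral_count_space') (auto simp: indicator_def)
    also have "\<dots> = ennreal (wt (a # \<beta>))"
      using wt_simps(2)[of a "hd \<beta>" "tl \<beta>"] hdB(2)[OF \<beta>, symmetric] by (simp add: ennreal_mult)
    finally show "ennreal (wt (a # \<beta>)) = (\<integral>\<^sup>+c. ennreal (pmf \<mu> (inv a \<otimes> c)) *
        (ennreal (wt \<beta>) * indicator {\<beta>. hd \<beta> = c} \<beta>) \<partial>count_space (carrier G))" by simp
  qed
  also have "\<dots> = (\<integral>\<^sup>+c. \<integral>\<^sup>+\<beta>. ennreal (pmf \<mu> (inv a \<otimes> c)) * (ennreal (wt \<beta>) * indicator {\<beta>. hd \<beta> = c} \<beta>)
      \<partial>count_space B \<partial>count_space (carrier G))"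
    by (rule nn_integral_count_space_nn_integral) (auto intro: countable_carrier)
  also have "\<dots> = (\<integral>\<^sup>+c. ennreal (pmf \<mu> (inv a \<otimes> c)) * W (paths n c b) \<partial>count_space (carrier G))"
  proof (rule nn_integral_cong)
    fix c
    have "(\<integral>\<^sup>+\<beta>. ennreal (wt \<beta>) * indicator {\<beta>. hd \<beta> = c} \<beta> \<partial>count_space B) = W (paths n c b)"
      unfolding W_def by (subst (1 2) nn_integral_count_space_indicator)
        (auto intro!: nn_integral_cong simp: B_def paths_def split: split_indicator)
    then show "(\<integral>\<^sup>+\<beta>. ennreal (pmf \<mu> (inv a \<otimes> c)) * (ennreal (wt \<beta>) * indicator {\<beta>. hd \<beta> = c} \<beta>)
      \<partial>count_space B) = ennreal (pmf \<mu> (inv a \<otimes> c)) * W (paths n c b)"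
      by (simp add: nn_integral_cmult)
  qed
  also have "\<dots> = (\<integral>\<^sup>+c. ennreal (pmf \<mu> (inv a \<otimes> c)) *
      ennreal (pmf (conv_pow \<mu> n) (inv (inv a \<otimes> c) \<otimes> (inv a \<otimes> b))) \<partial>count_space (carrier G))"
    using Suc assms(2) by (intro nn_integral_cong) (simp add: inv_mult_left)
  also have "\<dots> = (\<integral>\<^sup>+s. ennreal (pmf \<mu> s) * ennreal (pmf (conv_pow \<mu> n) (inv s \<otimes> (inv a \<otimes> b))) \<partial>count_space (carrier G))"
    using Suc.prems by (intro nn_integral_left[where F = "\<lambda>s. ennreal (pmf \<mu> s) * ennreal (pmf (conv_pow \<mu> n) (inv s \<otimes> (inv a \<otimes> b)))"]) simp
  also have "\<dots> = (\<integral>\<^sup>+s. ennreal (pmf \<mu> s) * ennreal (pmf (conv_pow \<mu> n) (inv s \<otimes> (inv a \<otimes> b))) \<partial>count_space UNIV)"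
    using supp by (intro nn_integral_count_space_eq) (auto simp: set_pmf_iff)
  also have "\<dots> = (\<integral>\<^sup>+s. ennreal (pmf (conv_pow \<mu> n) (inv s \<otimes> (inv a \<otimes> b))) \<partial>measure_pmf \<mu>)"
    by (rule nn_integral_measure_pmf[symmetric])
  also have "\<dots> = ennreal (\<integral>s. pmf (conv_pow \<mu> n) (inv s \<otimes> (inv a \<otimes> b)) \<partial>measure_pmf \<mu>)"
    by (intro nn_integral_eq_integral measure_pmf.integrable_const_bound[where B = 1]) (auto simp: pmf_le_1)
  also have "\<dots> = ennreal (pmf (conv_pow \<mu> (Suc n)) (inv a \<otimes> b))"
    using Suc.prems assms(2) supp by (simp add: pmf_conv set_conv_pow_sub)
  finally show ?case .
qed

lemma W_long_paths:
  assumes ab: "a \<in> carrier G" "b \<in> carrier G" and C: "C > 0" and \<rho>: "0 < \<rho>" "\<rho> < 1"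
    and decay: "\<And>n x. x \<in> carrier G \<Longrightarrow> pmf (conv_pow \<mu> n) x \<le> C * \<rho> ^ n"
  shows "W (\<Union>n. paths (n + L) a b) \<le> ennreal (C * \<rho> ^ L / (1 - \<rho>))"
proof -
  have dens: "W A = emeasure (density (count_space UNIV) (\<lambda>\<alpha>. ennreal (wt \<alpha>))) A" for A
    by (simp add: W_def emeasure_density nn_integral_count_space_indicator)
  have "W (\<Union>n. paths (n + L) a b) \<le> (\<Sum>n. W (paths (n + L) a b))"
    unfolding dens by (rule emeasure_subadditive_countably) auto
  also have "\<dots> \<le> (\<Sum>n. ennreal (C * \<rho> ^ L * \<rho> ^ n))"
  proof (rule suminf_le)
    fix n
    show "W (paths (n + L) a b) \<le> ennreal (C * \<rho> ^ L * \<rho> ^ n)"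
      using decay[of "inv a \<otimes> b" "n + L"] ab by (simp add: W_paths ennreal_leI power_add mult_ac)
  qed auto
  also have "\<dots> = ennreal (\<Sum>n. C * \<rho> ^ L * \<rho> ^ n)"
    using C \<rho> by (intro suminf_ennreal2 summable_mult summable_geometric) auto
  also have "(\<Sum>n. C * \<rho> ^ L * \<rho> ^ n) = C * \<rho> ^ L / (1 - \<rho>)"
    using \<rho> by (simp add: suminf_mult suminf_geometric summable_geometric)
  finally show ?thesis .
qed

end

section \<open>Trajectories avoiding a ball are short in the Floyd metric\<close>

lemma nn_integral_summable_on_finite:
  fixes F :: "'a \<Rightarrow> real"
  assumes A: "countable A" and nonneg: "\<And>x. F x \<ge> 0" and summ: "F summable_on A"
  shows "(\<integral>\<^sup>+x. ennreal (F x) \<partial>count_space A) < \<top>"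
proof (cases "finite A")
  case True
  then show ?thesis by (simp add: nn_integral_count_space_finite)
next
  case False
  note bij = bij_betw_from_nat_into[OF A False]
  have "(\<integral>\<^sup>+x. ennreal (F x) \<partial>count_space A) = (\<Sum>n. ennreal (F (from_nat_into A n)))"
    by (simp add: nn_integral_bij_count_space[OF bij, symmetric] nn_integral_count_space_nat)
  also have "\<dots> \<le> ennreal (infsum F A)"
  proof (rule suminf_le_const)
    fix n
    have "(\<Sum>i<n. F (from_nat_into A i)) = sum F (from_nat_into A ` {..<n})"
      using bij by (subst sum.reindex) (auto simp: bij_betw_def intro: inj_on_subset)
    also have "\<dots> \<le> infsum F A"
      using bij nonneg by (intro finite_sum_le_infsum summ) (auto simp: bij_betw_def)
    finally show "(\<Sum>i<n. ennreal (F (from_nat_into A i))) \<le> ennreal (infsum F A)"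
      using nonneg by (simp add: sum_ennreal ennreal_leI)
  qed simp
  finally show ?thesis by (simp add: order_le_less_trans)
qed

lemma emeasure_geometric_tail:
  assumes "\<And>n. E n \<in> sets M" "D \<ge> 0" "\<And>n. n \<ge> N \<Longrightarrow> emeasure M (E n) \<le> ennreal (D * (1 / 2) ^ n)"
  shows "emeasure M (\<Union>n\<in>{N..}. E n) \<le> ennreal (2 * D * (1 / 2) ^ N)"
proof -
  have "(\<Union>n\<in>{N..}. E n) = (\<Union>n. E (n + N))"
  proof (intro equalityI subsetI)
    fix x assume "x \<in> (\<Union>n\<in>{N..}. E n)"
    then obtain n where "n \<ge> N" "x \<in> E n" by auto
    then have "x \<in> E ((n - N) + N)" by simp
    then show "x \<in> (\<Union>n. E (n + N))" by blast
  qed force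
  then have "emeasure M (\<Union>n\<in>{N..}. E n) \<le> (\<Sum>n. emeasure M (E (n + N)))"
    using assms(1) by (simp add: emeasure_subadditive_countably image_subset_iff)
  also have "\<dots> \<le> (\<Sum>n. ennreal (D * (1 / 2) ^ N * (1 / 2) ^ n))"
  proof (rule suminf_le)
    fix n
    show "emeasure M (E (n + N)) \<le> ennreal (D * (1 / 2) ^ N * (1 / 2) ^ n)"
      using assms(3)[of "n + N"] by (simp add: power_add mult_ac)
  qed auto
  also have "\<dots> = ennreal (\<Sum>n. D * (1 / 2) ^ N * (1 / 2) ^ n)"
    using assms(2) by (intro suminf_ennreal2 summable_mult summable_geometric) auto
  also have "(\<Sum>n. D * (1 / 2) ^ N * (1 / 2) ^ n) = 2 * D * (1 / 2) ^ N"
    by (simp add: suminf_mult suminf_geometric summable_geometric)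
  finally show ?thesis .
qed

lemma geometric_small:
  fixes D \<epsilon> :: real
  assumes "\<epsilon> > 0"
  obtains N0 where "N0 \<ge> 1" "\<And>N. N \<ge> N0 \<Longrightarrow> D * (1 / 2) ^ N \<le> \<epsilon>"
proof -
  have "(\<lambda>N. D * (1 / 2) ^ N) \<longlonglongrightarrow> 0" by (intro tendsto_mult_right_zero LIMSEQ_power_zero) simp
  from LIMSEQ_D[OF this assms] obtain N0 where N0: "\<And>N. N \<ge> N0 \<Longrightarrow> norm (D * (1 / 2) ^ N) < \<epsilon>" by auto
  show ?thesis
  proof (rule that[of "Suc N0"])
    fix N assume "N \<ge> Suc N0"
    then have "norm (D * (1 / 2) ^ N) < \<epsilon>" by (intro N0) simp
    then show "D * (1 / 2) ^ N \<le> \<epsilon>" by simp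
  qed simp
qed

text \<open>The segment from the first to the last visit of \<open>X\<close> contains all visits, so
  it is at least as long as the number of distinct points visited.\<close>

lemma sublist_hull:
  assumes "card (set \<gamma> \<inter> X) > L"
  obtains xs \<beta> zs where "\<gamma> = xs @ \<beta> @ zs" "\<beta> \<noteq> []" "hd \<beta> \<in> X" "last \<beta> \<in> X" "length \<beta> > L"
proof -
  define r where "r = dropWhile (\<lambda>z. z \<notin> X) \<gamma>"
  define \<beta> where "\<beta> = rev (dropWhile (\<lambda>z. z \<notin> X) (rev r))"
  have ne: "set \<gamma> \<inter> X \<noteq> {}" using assms by auto
  have g: "\<gamma> = takeWhile (\<lambda>z. z \<notin> X) \<gamma> @ r" by (simp add: r_def)
  have "r = rev (takeWhile (\<lambda>z. z \<notin> X) (rev r) @ dropWhile (\<lambda>z. z \<notin> X) (rev r))" by simp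
  also have "\<dots> = \<beta> @ rev (takeWhile (\<lambda>z. z \<notin> X) (rev r))" by (simp only: rev_append \<beta>_def)
  finally have r: "r = \<beta> @ rev (takeWhile (\<lambda>z. z \<notin> X) (rev r))" .
  have "set \<gamma> \<inter> X = set r \<inter> X" by (subst g) (auto dest: set_takeWhileD)
  also have "\<dots> = set \<beta> \<inter> X" by (subst r) (auto dest: set_takeWhileD)
  finally have eq: "set \<gamma> \<inter> X = set \<beta> \<inter> X" .
  have b: "\<beta> \<noteq> []" using ne eq by auto
  have "hd \<beta> = hd r" using b by (subst r) simp
  moreover have "hd r \<in> X" using hd_dropWhile[of "\<lambda>z. z \<notin> X" \<gamma>] b r by (auto simp: r_def[symmetric])
  moreover have "last \<beta> \<in> X" using hd_dropWhile[of "\<lambda>z. z \<notin> X" "rev r"] b by (simp add: \<beta>_def last_rev)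
  moreover have "L < length \<beta>"
  proof -
    have "card (set \<beta> \<inter> X) \<le> card (set \<beta>)" by (intro card_mono) auto
    then show ?thesis using assms eq card_length[of \<beta>] by simp
  qed
  moreover have "\<gamma> = takeWhile (\<lambda>z. z \<notin> X) \<gamma> @ \<beta> @ rev (takeWhile (\<lambda>z. z \<notin> X) (rev r))"
    using g r by simp
  ultimately show ?thesis using that b by metis
qed

text \<open>Summation by parts: as \<open>h\<close> decreases, the worst distribution allowed by the
  count has exactly \<open>K\<close> points on each level from 1 on.\<close>

lemma sum_by_counting:
  fixes h :: "nat \<Rightarrow> real" and l :: "'a \<Rightarrow> nat"
  assumes A: "finite A" and h: "antimono h" "\<And>n. h n \<ge> 0"
    and count: "\<And>n. card {a \<in> A. l a \<le> n} \<le> K * n" and m: "\<And>a. a \<in> A \<Longrightarrow> l a \<le> m"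
  shows "(\<Sum>a\<in>A. h (l a)) \<le> real K * (\<Sum>n=1..m. h n)"
proof -
  let ?c = "\<lambda>n. card {a \<in> A. l a \<le> n}"
  \<comment> \<open>The induction carries along the free places up to level \<open>n\<close>, priced
    at the current rate \<open>h n\<close>; points on the next level may use them up.\<close>
  have "(\<Sum>a\<in>{a \<in> A. l a \<le> n}. h (l a)) + (real (K * n) - real (?c n)) * h n \<le> real K * (\<Sum>i=1..n. h i)" for n
  proof (induction n)
    case 0
    have "{a \<in> A. l a \<le> 0} = {}" using count[of 0] A by simp
    then show ?case by simp
  next
    case (Suc n)
    let ?B = "{a \<in> A. l a = Suc n}"
    have split: "{a \<in> A. l a \<le> Suc n} = {a \<in> A. l a \<le> n} \<union> ?B" by auto
    have disj: "{a \<in> A. l a \<le> n} \<inter> ?B = {}" by auto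
    have c: "?c (Suc n) = ?c n + card ?B" unfolding split using A disj by (intro card_Un_disjoint) auto
    have "(\<Sum>a\<in>{a \<in> A. l a \<le> Suc n}. h (l a)) = (\<Sum>a\<in>{a \<in> A. l a \<le> n}. h (l a)) + (\<Sum>a\<in>?B. h (l a))"
      unfolding split using A disj by (intro sum.union_disjoint) auto
    also have "(\<Sum>a\<in>?B. h (l a)) = real (card ?B) * h (Suc n)" by simp
    finally have s: "(\<Sum>a\<in>{a \<in> A. l a \<le> Suc n}. h (l a)) =
        (\<Sum>a\<in>{a \<in> A. l a \<le> n}. h (l a)) + real (card ?B) * h (Suc n)" .
    have "real (?c n) \<le> real (K * n)" using count[of n] by (simp only: of_nat_le_iff)
    then have "(real (K * n) - real (?c n)) * h (Suc n) \<le> (real (K * n) - real (?c n)) * h n"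
      by (intro mult_left_mono antimonoD[OF h(1)]) auto
    then show ?case using Suc unfolding s c by (simp add: algebra_simps)
  qed
  from this[of m] have "(\<Sum>a\<in>{a \<in> A. l a \<le> m}. h (l a)) + (real (K * m) - real (?c m)) * h m \<le> real K * (\<Sum>i=1..m. h i)" .
  moreover have "(real (K * m) - real (?c m)) * h m \<ge> 0"
  proof -
    have "real (?c m) \<le> real (K * m)" using count[of m] by (simp only: of_nat_le_iff)
    then show ?thesis using h(2) by simp
  qed
  moreover have "{a \<in> A. l a \<le> m} = A" using m by auto
  ultimately show ?thesis by simp
qed

context floyd_group
begin

text \<open>Loops of \<open>\<gamma>\<close> are cut out, so that every vertex is paid for only once.\<close>

lemma fd_chain:
  assumes "\<gamma> \<noteq> []" "set \<gamma> \<subseteq> carrier G" "\<And>a. H a \<ge> 0"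
    and "\<And>a b xs ys. \<gamma> = xs @ a # b # ys \<Longrightarrow> fd w a b \<le> H a"
  shows "fd w (hd \<gamma>) (last \<gamma>) \<le> (\<Sum>a\<in>set \<gamma>. H a)"
  using assms(1,2,4)
proof (induction "length \<gamma>" arbitrary: \<gamma> rule: less_induct)
  case less
  \<comment> \<open>After the last visit to its starting vertex the list never returns there, so
    that vertex is charged only for the step that leaves it for good.\<close>
  obtain ys zs where g: "\<gamma> = ys @ hd \<gamma> # zs" "hd \<gamma> \<notin> set zs"
    using split_list_last[of "hd \<gamma>" \<gamma>] less.prems(1) by auto
  have x: "hd \<gamma> \<in> carrier G" using less.prems by auto
  show ?case
  proof (cases zs)
    case Nil
    then have "last \<gamma> = hd \<gamma>" by (subst g(1)) simp
    then show ?thesis using x assms(3) by (simp add: sum_nonneg)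
  next
    case (Cons b zs')
    have zc: "set zs \<subseteq> carrier G" using less.prems(2) by (subst (asm) g(1)) auto
    have "length zs < length \<gamma>" by (subst g(1)) simp
    moreover have "fd w a b \<le> H a" if "zs = xs @ a # b # us" for a b xs us
      using less.prems(3)[of "ys @ hd \<gamma> # xs" a b us] that g(1) by simp
    ultimately have IH: "fd w (hd zs) (last zs) \<le> (\<Sum>a\<in>set zs. H a)"
      using less.hyps[of zs] Cons zc by simp
    have "fd w (hd \<gamma>) b \<le> H (hd \<gamma>)" using less.prems(3)[of ys "hd \<gamma>" b zs'] g(1) Cons by simp
    moreover have "last \<gamma> = last zs" using Cons by (subst g(1)) simp
    moreover have "last zs \<in> carrier G" "b \<in> carrier G" using zc Cons by auto
    ultimately have "fd w (hd \<gamma>) (last \<gamma>) \<le> H (hd \<gamma>) + (\<Sum>a\<in>set zs. H a)"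
      using fd_triangle[of "hd \<gamma>" b "last zs" w] x IH Cons by simp
    also have "\<dots> = (\<Sum>a\<in>insert (hd \<gamma>) (set zs). H a)" using g(2) by simp
    also have "\<dots> \<le> (\<Sum>a\<in>set \<gamma>. H a)"
    proof (rule sum_mono2)
      show "insert (hd \<gamma>) (set zs) \<subseteq> set \<gamma>" by (subst (2) g(1)) auto
    qed (use assms(3) in auto)
    finally show ?thesis .
  qed
qed

text \<open>Each vertex is charged \<open>h\<close> of its distance to \<open>w\<close>. The linear
  bound on visits turns the sum over vertices into one over radii, and avoiding the ball leaves only
  a tail and the boundary term \<open>N * h N\<close>.\<close>

lemma fd_avoiding:
  assumes \<gamma>: "\<gamma> \<noteq> []" "set \<gamma> \<subseteq> carrier G" and h: "antimono h" "\<And>n. h n \<ge> 0"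
    and far: "\<And>g. g \<in> set \<gamma> \<Longrightarrow> wd w g \<ge> N"
    and count: "\<And>n. n \<ge> N \<Longrightarrow> card (set \<gamma> \<inter> {g \<in> carrier G. wd w g \<le> n}) \<le> K * n"
    and step: "\<And>xs a b ys. \<gamma> = xs @ a # b # ys \<Longrightarrow> fd w a b \<le> h (wd w a)"
  obtains m where "fd w (hd \<gamma>) (last \<gamma>) \<le> real K * (real N * h N + sum h {N..<m})"
proof -
  \<comment> \<open>Freezing \<open>h\<close> below radius \<open>N\<close> changes no charge. Below
    \<open>N\<close> the bound on visits is not assumed, but there are no vertices to count.\<close>
  define h' where "h' n = h (max N n)" for n
  obtain m where m: "\<And>a. a \<in> set \<gamma> \<Longrightarrow> wd w a \<le> m"
    using finite_nat_set_iff_bounded_le[of "wd w ` set \<gamma>"] by auto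
  have "fd w (hd \<gamma>) (last \<gamma>) \<le> (\<Sum>a\<in>set \<gamma>. h (wd w a))" by (rule fd_chain[OF \<gamma> h(2) step])
  also have "\<dots> = (\<Sum>a\<in>set \<gamma>. h' (wd w a))"
    using far by (intro sum.cong) (auto simp: h'_def max_def)
  also have "\<dots> \<le> real K * (\<Sum>n=1..m. h' n)"
  proof (rule sum_by_counting)
    show "antimono h'" using h(1) by (auto simp: h'_def monotone_def max.coboundedI2)
    fix n
    have eq: "{a \<in> set \<gamma>. wd w a \<le> n} = set \<gamma> \<inter> {g \<in> carrier G. wd w g \<le> n}" using \<gamma>(2) by auto
    show "card {a \<in> set \<gamma>. wd w a \<le> n} \<le> K * n"
    proof (cases "n \<ge> N")
      case True
      then show ?thesis using count[of n] eq by simp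
    next
      case False
      have "wd w a > n" if "a \<in> set \<gamma>" for a using far[OF that] False by simp
      then have "{a \<in> set \<gamma>. wd w a \<le> n} = {}" by (auto simp: not_le)
      then show ?thesis by (simp only: card.empty zero_le)
    qed
  qed (use h m in \<open>auto simp: h'_def\<close>)
  also have "\<dots> \<le> real K * (real N * h N + sum h {N..<Suc m})"
  proof (intro mult_left_mono)
    have "(\<Sum>n=1..m. h' n) \<le> (\<Sum>n\<in>{..<N} \<union> {N..<Suc m}. h' n)"
      using h by (intro sum_mono2) (auto simp: h'_def)
    also have "\<dots> = (\<Sum>n<N. h' n) + (\<Sum>n=N..<Suc m. h' n)"
      by (rule sum.union_disjoint) auto
    also have "(\<Sum>n<N. h' n) = real N * h N" by (simp add: h'_def max_def)
    also have "(\<Sum>n=N..<Suc m. h' n) = sum h {N..<Suc m}"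
      by (intro sum.cong) (auto simp: h'_def max_def)
    finally show "(\<Sum>n=1..m. h' n) \<le> real N * h N + sum h {N..<Suc m}" .
  qed simp
  finally show ?thesis using that by blast
qed

end

section \<open>The deviation inequality and its reduction to two bad events\<close>

locale floyd_walk = floyd_group G S f + transient_group_walk G S \<mu>
  for G :: "('a, 'b) monoid_scheme" (structure) and S :: "'a set" and f :: "real \<Rightarrow> real" and \<mu> :: "'a pmf"
begin

definition meets :: "'a \<Rightarrow> real \<Rightarrow> 'a list set" where
  "meets w r = {\<gamma>. set \<gamma> \<inter> {g \<in> carrier G. real (wd g w) \<le> r} \<noteq> {}}"

text \<open>An inequality of Ancona type. Taking \<open>\<delta>\<close> as a lower bound instead of
  the exact distance makes it monotone in all three parameters.\<close>

definition ancona :: "real \<Rightarrow> real \<Rightarrow> real \<Rightarrow> bool" where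
  "ancona \<epsilon> \<delta> r \<longleftrightarrow> (\<forall>x\<in>carrier G. \<forall>y\<in>carrier G. \<forall>w\<in>carrier G. fd w x y \<ge> \<delta> \<longrightarrow>
     measure (P x y) {\<gamma> \<in> T x y. \<gamma> \<in> meets w r} > 1 - \<epsilon>)"

abbreviation crowded :: "nat \<Rightarrow> nat \<Rightarrow> 'a \<Rightarrow> 'a \<Rightarrow> 'a \<Rightarrow> 'a list set" where
  "crowded K N x y w \<equiv>
     {\<gamma> \<in> T x y. \<exists>n\<ge>N. card (set \<gamma> \<inter> {g \<in> carrier G. wd w g \<le> n}) > K * n}"

abbreviation costly :: "(nat \<Rightarrow> real) \<Rightarrow> nat \<Rightarrow> 'a \<Rightarrow> 'a \<Rightarrow> 'a \<Rightarrow> 'a list set" where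
  "costly h N x y w \<equiv>
     {\<gamma> \<in> T x y. \<exists>xs a b ys. \<gamma> = xs @ a # b # ys \<and> wd w a \<ge> N \<and> fd w a b > h (wd w a)}"

text \<open>A step of at most half the distance from its start to \<open>w\<close> can be filled in
  at no less than half that distance, where \<open>f\<close> is under control; the longer steps are
  collected here.\<close>

abbreviation jumping :: "nat \<Rightarrow> 'a \<Rightarrow> 'a \<Rightarrow> 'a \<Rightarrow> 'a list set" where
  "jumping N x y w \<equiv>
     {\<gamma> \<in> T x y. \<exists>xs a b ys. \<gamma> = xs @ a # b # ys \<and> wd w a \<ge> N \<and> 2 * wd a b > wd w a}"

definition sparse :: "nat \<Rightarrow> bool" where
  "sparse K \<longleftrightarrow> (\<forall>\<epsilon>>0. \<exists>N0. \<forall>N\<ge>N0. \<forall>x\<in>carrier G. \<forall>y\<in>carrier G. \<forall>w\<in>carrier G.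
     emeasure (P x y) (crowded K N x y w) \<le> ennreal \<epsilon>)"

definition short_steps :: "(nat \<Rightarrow> real) \<Rightarrow> bool" where
  "short_steps h \<longleftrightarrow> (\<forall>\<epsilon>>0. \<exists>N0. \<forall>N\<ge>N0. \<forall>x\<in>carrier G. \<forall>y\<in>carrier G. \<forall>w\<in>carrier G.
     emeasure (P x y) (costly h N x y w)
       \<le> ennreal \<epsilon>)"

lemma prob_P: assumes "x \<in> carrier G" "y \<in> carrier G" shows "prob_space (P x y)"
proof
  show "emeasure (P x y) (space (P x y)) = 1"
    using assms green_pos[of x y] by (simp add: emeasure_P W_green divide_ennreal)
qed

text \<open>A trajectory that misses the ball and lies in neither bad event satisfies the hypotheses
  of \<open>fd_avoiding\<close>, which would make \<open>fd w x y\<close> smaller than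
  \<open>\<delta>\<close>. So missing the ball is no likelier than the two bad events
  together.\<close>

lemma ancona_of_sparse:
  assumes K: "sparse K" and h: "short_steps h" "antimono h" "\<And>n. h n \<ge> 0" "summable h"
    and "\<epsilon> > 0" "\<delta> > 0"
  shows "\<exists>r. ancona \<epsilon> \<delta> r"
proof -
  have e: "\<epsilon> / 4 > 0" using \<open>\<epsilon> > 0\<close> by simp
  from K[unfolded sparse_def, THEN spec, THEN mp, OF e]
  obtain N1 where N1: "\<forall>N\<ge>N1. \<forall>x\<in>carrier G. \<forall>y\<in>carrier G. \<forall>w\<in>carrier G. emeasure (P x y) (crowded K N x y w) \<le> ennreal (\<epsilon> / 4)" ..
  from h(1)[unfolded short_steps_def, THEN spec, THEN mp, OF e]
  obtain N2 where N2: "\<forall>N\<ge>N2. \<forall>x\<in>carrier G. \<forall>y\<in>carrier G. \<forall>w\<in>carrier G. emeasure (P x y) (costly h N x y w)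
      \<le> ennreal (\<epsilon> / 4)" ..
  \<comment> \<open>The summand 1 gives \<open>K * (2 * d) < \<delta>\<close> strictly, also for
    \<open>K = 0\<close>.\<close>
  define d where "d = \<delta> / (2 * (real K + 1))"
  have d: "d > 0" using \<open>\<delta> > 0\<close> by (simp add: d_def)
  obtain N3 where N3: "\<And>m n. m \<ge> N3 \<Longrightarrow> norm (sum h {m..<n}) < d"
    using h(4) d unfolding summable_Cauchy by meson
  obtain N4 where N4: "\<And>m. m \<ge> N4 \<Longrightarrow> norm (real m * h m - 0) < d"
    using LIMSEQ_D[OF antimono_summable_imp_mult_tendsto_0[OF h(2,3,4)] d] by auto
  define N where "N = N1 + N2 + N3 + N4"
  have N: "N \<ge> N1" "N \<ge> N2" "N \<ge> N3" "N \<ge> N4" by (simp_all add: N_def)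
  have "ancona \<epsilon> \<delta> (real N)"
    unfolding ancona_def
  proof (intro ballI impI)
    fix x y w assume c: "x \<in> carrier G" "y \<in> carrier G" "w \<in> carrier G" and \<delta>: "fd w x y \<ge> \<delta>"
    interpret prob_space "P x y" using prob_P c by blast
    let ?A = "crowded K N x y w"
    let ?B = "costly h N x y w"
    let ?M = "{\<gamma> \<in> T x y. \<gamma> \<in> meets w (real N)}"
    have "T x y - ?M \<subseteq> ?A \<union> ?B"
    proof
      fix \<gamma> assume "\<gamma> \<in> T x y - ?M"
      then have g: "\<gamma> \<in> T x y" "\<gamma> \<notin> meets w (real N)" by auto
      then have \<gamma>: "\<gamma> \<noteq> []" "set \<gamma> \<subseteq> carrier G" "hd \<gamma> = x" "last \<gamma> = y" by (auto simp: Traj_def)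
      have far: "wd w a \<ge> N" if "a \<in> set \<gamma>" for a
        using g(2) that \<gamma>(2) wd_commute[of a w] c(3) by (force simp: meets_def)
      show "\<gamma> \<in> ?A \<union> ?B"
      proof (rule ccontr)
        assume nAB: "\<gamma> \<notin> ?A \<union> ?B"
        have count: "card (set \<gamma> \<inter> {g \<in> carrier G. wd w g \<le> n}) \<le> K * n" if "n \<ge> N" for n
          using nAB g(1) that by (auto simp: not_less)
        have step: "fd w a b \<le> h (wd w a)" if eq: "\<gamma> = xs @ a # b # ys" for xs a b ys
        proof (rule ccontr)
          assume "\<not> ?thesis"
          moreover have "wd w a \<ge> N" using eq by (intro far) simp
          ultimately have "\<gamma> \<in> ?B" using g(1) eq by (intro CollectI conjI exI[of _ xs] exI[of _ a] exI[of _ b] exI[of _ ys]) auto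
          then show False using nAB by blast
        qed
        obtain m where m: "fd w (hd \<gamma>) (last \<gamma>) \<le> real K * (real N * h N + sum h {N..<m})"
        proof (rule fd_avoiding[OF \<gamma>(1,2) h(2,3), where w = w and N = N and K = K])
          show "\<And>g. g \<in> set \<gamma> \<Longrightarrow> N \<le> wd w g" by (rule far)
          show "\<And>n. N \<le> n \<Longrightarrow> card (set \<gamma> \<inter> {g \<in> carrier G. wd w g \<le> n}) \<le> K * n" by (rule count)
          show "\<And>xs a b ys. \<gamma> = xs @ a # b # ys \<Longrightarrow> fd w a b \<le> h (wd w a)" by (rule step)
        qed (rule that)
        have "real N * h N < d" "sum h {N..<m} < d"
          using N3[OF N(3), of m] N4[OF N(4)] by (auto simp: abs_less_iff)
        then have "real K * (real N * h N + sum h {N..<m}) \<le> real K * (2 * d)"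
          by (intro mult_left_mono) auto
        also have "\<dots> < \<delta>" using \<open>\<delta> > 0\<close> by (simp add: d_def field_simps)
        finally show False using m \<delta> \<gamma> by simp
      qed
    qed
    then have "emeasure (P x y) (T x y - ?M) \<le> emeasure (P x y) (?A \<union> ?B)"
      by (intro emeasure_mono) auto
    also have "\<dots> \<le> emeasure (P x y) ?A + emeasure (P x y) ?B"
      by (intro emeasure_subadditive) auto
    also have "\<dots> \<le> ennreal (\<epsilon> / 4) + ennreal (\<epsilon> / 4)"
      by (intro add_mono N1[rule_format] N2[rule_format] N c)
    also have "\<dots> = ennreal (\<epsilon> / 2)" using e by (simp flip: ennreal_plus)
    finally have "prob (T x y - ?M) \<le> \<epsilon> / 2" using \<open>\<epsilon> > 0\<close> by (simp add: emeasure_eq_measure)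
    moreover have "prob (space (P x y) - ?M) = 1 - prob ?M" by (rule prob_compl) auto
    ultimately show "prob ?M > 1 - \<epsilon>" using \<open>\<epsilon> > 0\<close> by simp
  qed
  then show ?thesis by blast
qed

text \<open>One end point must lie within \<open>N\<close> of \<open>w\<close>, since otherwise the
  Floyd distance would be below \<open>\<delta>\<close>; and every trajectory contains both end
  points.\<close>

lemma ancona_of_thin_boundary:
  assumes "\<forall>\<delta>>0. \<exists>N. \<forall>x\<in>carrier G. \<forall>y\<in>carrier G. len x \<ge> N \<longrightarrow> len y \<ge> N \<longrightarrow> fd \<one> x y < \<delta>"
    and "\<epsilon> > 0" "\<delta> > 0"
  shows "\<exists>r. ancona \<epsilon> \<delta> r"
proof -
  obtain N where N: "\<And>x y. \<lbrakk>x \<in> carrier G; y \<in> carrier G; len x \<ge> N; len y \<ge> N\<rbrakk> \<Longrightarrow> fd \<one> x y < \<delta>"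
    using assms(1,3) by blast
  have "ancona \<epsilon> \<delta> (real N)"
    unfolding ancona_def
  proof (intro ballI impI)
    fix x y w assume c: "x \<in> carrier G" "y \<in> carrier G" "w \<in> carrier G" and \<delta>: "fd w x y \<ge> \<delta>"
    interpret prob_space "P x y" using prob_P c by blast
    have "wd x w \<le> N \<or> wd y w \<le> N"
    proof (rule ccontr)
      assume "\<not> ?thesis"
      then have "len (inv w \<otimes> x) \<ge> N" "len (inv w \<otimes> y) \<ge> N"
        using wd_commute[of x w] wd_commute[of y w] c by (auto simp: word_dist_def)
      then have "fd \<one> (inv w \<otimes> x) (inv w \<otimes> y) < \<delta>" using c by (intro N) auto
      then show False using \<delta> fd_translate[of w x y] c by simp
    qed
    moreover have "x \<in> set \<gamma> \<and> y \<in> set \<gamma>" if "\<gamma> \<in> T x y" for \<gamma>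
      using that by (auto simp: Traj_def)
    ultimately have "{\<gamma> \<in> T x y. \<gamma> \<in> meets w (real N)} = space (P x y)"
      using c by (auto simp: meets_def)
    then show "prob {\<gamma> \<in> T x y. \<gamma> \<in> meets w (real N)} > 1 - \<epsilon>" using prob_space \<open>\<epsilon> > 0\<close> by simp
  qed
  then show ?thesis by blast
qed

text \<open>The balls themselves are small enough, so the bad event is empty. It starts at radius 1
  because the ball of radius 0 already has one element.\<close>

lemma sparse_of_linear_growth:
  assumes "\<forall>k\<ge>1. card (wball k) \<le> C * k" shows "sparse C"
  unfolding sparse_def
proof (intro allI impI exI[of _ 1] ballI)
  fix \<epsilon> :: real and N x y w assume N: "N \<ge> (1::nat)" and w: "w \<in> carrier G"
  have "card (set \<gamma> \<inter> {g \<in> carrier G. wd w g \<le> n}) \<le> C * n" if "n \<ge> N" for \<gamma> n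
  proof -
    have "card (set \<gamma> \<inter> {g \<in> carrier G. wd w g \<le> n}) \<le> card {g \<in> carrier G. wd w g \<le> n}"
      using w by (intro card_mono) auto
    also have "\<dots> \<le> C * n" using assms that N w by (simp add: card_wball_around)
    finally show ?thesis .
  qed
  then have "crowded C N x y w = {}"
    by (auto simp: not_less[symmetric])
  then show "emeasure (P x y) (crowded C N x y w) \<le> ennreal \<epsilon>"
    by (simp only: emeasure_empty zero_le)
qed

text \<open>More than \<open>K * n\<close> visited points of a ball force a segment of at least
  \<open>K * n\<close> steps between two of its points. A union bound over these pairs of end points
  is beaten by the decay in time.\<close>

lemma sparse_of_ping_pong:
  assumes "ping_pong G" shows "\<exists>K. sparse K"
proof -
  obtain C \<rho> where C: "C > 0" and \<rho>: "0 < \<rho>" "\<rho> < 1"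
    and decay: "\<And>n x. x \<in> carrier G \<Longrightarrow> pmf (conv_pow \<mu> n) x \<le> C * \<rho> ^ n"
    using exponential_decay[OF countable_carrier supp semigroup assms] by blast
  obtain q where q: "0 < q" "q \<le> 1" "\<And>x y. \<lbrakk>x \<in> carrier G; y \<in> carrier G\<rbrakk> \<Longrightarrow> q ^ wd x y \<le> green x y"
    using green_lower by blast
  define s where "s = real (card S + 1)"
  have s: "s \<ge> 1" by (simp add: s_def)
  \<comment> \<open>Per unit of radius, \<open>s\<close> squared pays for the pairs of end points,
    \<open>q\<close> squared for the Green function between points at most \<open>2 * n\<close>
    apart, and 2 for a summable tail.\<close>
  have "(\<lambda>K. \<rho> ^ K) \<longlonglongrightarrow> 0" using \<rho> by (intro LIMSEQ_power_zero) simp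
  moreover have "q\<^sup>2 / (2 * s\<^sup>2) > 0" using q s by simp
  ultimately have "\<forall>\<^sub>F K in sequentially. \<rho> ^ K < q\<^sup>2 / (2 * s\<^sup>2)" by (rule order_tendstoD)
  then obtain K where "\<rho> ^ K < q\<^sup>2 / (2 * s\<^sup>2)" using eventually_happens'[OF sequentially_bot] by blast
  then have K: "s\<^sup>2 * \<rho> ^ K / q\<^sup>2 \<le> 1 / 2" using q s by (simp add: field_simps)
  define D where "D = (green \<one> \<one>)\<^sup>2 * C / (1 - \<rho>)"
  have D: "D \<ge> 0" using C \<rho> by (simp add: D_def)
  have main: "emeasure (P x y) {\<gamma> \<in> T x y. card (set \<gamma> \<inter> {g \<in> carrier G. wd w g \<le> n}) > K * n}
      \<le> ennreal (D * (1 / 2) ^ n)" if c: "x \<in> carrier G" "y \<in> carrier G" "w \<in> carrier G" for x y w n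
  proof -
    let ?B = "{g \<in> carrier G. wd w g \<le> n}"
    let ?U = "\<lambda>a b. \<Union>m. paths (m + K * n) a b"
    let ?E = "\<lambda>a b. {\<gamma> \<in> T x y. \<exists>xs \<beta> zs. \<gamma> = xs @ \<beta> @ zs \<and> \<beta> \<in> ?U a b}"
    have B: "finite ?B" "real (card ?B) \<le> s ^ n"
    proof -
      show "finite ?B" using c by simp
      have "real (card (wball n)) \<le> real ((card S + 1) ^ n)" using wball_card[of n] by (simp only: of_nat_le_iff)
      then show "real (card ?B) \<le> s ^ n" using c by (simp add: card_wball_around s_def)
    qed
    have E: "emeasure (P x y) (?E a b) \<le> ennreal (D * (\<rho> ^ K / q\<^sup>2) ^ n)" if ab: "a \<in> ?B" "b \<in> ?B" for a b
    proof -
      have cab: "a \<in> carrier G" "b \<in> carrier G" using ab by auto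
      have "wd a b \<le> 2 * n" using wd_triangle[of a w b] wd_commute[of a w] ab c by simp
      then have "q ^ (2 * n) \<le> q ^ wd a b" using q by (intro power_decreasing) auto
      also have "\<dots> \<le> green a b" using q cab by simp
      finally have g: "q ^ (2 * n) \<le> green a b" .
      have "emeasure (P x y) (?E a b) \<le> ennreal ((green \<one> \<one>)\<^sup>2 / green a b) * W (?U a b)"
        by (rule emeasure_P_infix) (use c cab in \<open>auto simp: paths_def\<close>)
      also have "\<dots> \<le> ennreal ((green \<one> \<one>)\<^sup>2 / q ^ (2 * n)) * ennreal (C * \<rho> ^ (K * n) / (1 - \<rho>))"
        using g q green_pos[OF cab] by (intro mult_mono W_long_paths[OF cab C \<rho> decay] ennreal_leI divide_left_mono) auto
      also have "\<dots> = ennreal ((green \<one> \<one>)\<^sup>2 / q ^ (2 * n) * (C * \<rho> ^ (K * n) / (1 - \<rho>)))"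
        using C \<rho> q by (intro ennreal_mult[symmetric]) auto
      also have "(green \<one> \<one>)\<^sup>2 / q ^ (2 * n) * (C * \<rho> ^ (K * n) / (1 - \<rho>)) = D * (\<rho> ^ K / q\<^sup>2) ^ n"
        by (simp only: D_def power_divide power_mult) (simp add: mult_ac)
      finally show ?thesis .
    qed
    have "{\<gamma> \<in> T x y. card (set \<gamma> \<inter> ?B) > K * n} \<subseteq> (\<Union>a\<in>?B. \<Union>b\<in>?B. ?E a b)"
    proof
      fix \<gamma> assume "\<gamma> \<in> {\<gamma> \<in> T x y. card (set \<gamma> \<inter> ?B) > K * n}"
      then have g: "\<gamma> \<in> T x y" "card (set \<gamma> \<inter> ?B) > K * n" by auto
      obtain xs \<beta> zs where b: "\<gamma> = xs @ \<beta> @ zs" "\<beta> \<noteq> []" "hd \<beta> \<in> ?B" "last \<beta> \<in> ?B" "length \<beta> > K * n"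
        using sublist_hull[OF g(2)] by blast
      have "set \<beta> \<subseteq> carrier G" using g(1) b(1) by (auto simp: Traj_def)
      \<comment> \<open>More than \<open>K * n\<close> vertices mean at least \<open>K * n\<close>
        steps.\<close>
      then have "\<beta> \<in> paths ((length \<beta> - Suc (K * n)) + K * n) (hd \<beta>) (last \<beta>)"
        using b(5) by (simp add: paths_def)
      then have E: "\<gamma> \<in> ?E (hd \<beta>) (last \<beta>)" using g(1) b(1) by blast
      show "\<gamma> \<in> (\<Union>a\<in>?B. \<Union>b\<in>?B. ?E a b)" by (rule UN_I[OF b(3)], rule UN_I[OF b(4)], rule E)
    qed
    then have "emeasure (P x y) {\<gamma> \<in> T x y. card (set \<gamma> \<inter> ?B) > K * n} \<le>
        emeasure (P x y) (\<Union>a\<in>?B. \<Union>b\<in>?B. ?E a b)" by (intro emeasure_mono) auto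
    also have "\<dots> \<le> (\<Sum>a\<in>?B. emeasure (P x y) (\<Union>b\<in>?B. ?E a b))"
      using B(1) by (intro emeasure_subadditive_finite) auto
    also have "\<dots> \<le> (\<Sum>a\<in>?B. \<Sum>b\<in>?B. emeasure (P x y) (?E a b))"
      using B(1) by (intro sum_mono emeasure_subadditive_finite) auto
    also have "\<dots> \<le> (\<Sum>a\<in>?B. \<Sum>b\<in>?B. ennreal (D * (\<rho> ^ K / q\<^sup>2) ^ n))"
      using E by (intro sum_mono) auto
    also have "\<dots> = ennreal (real (card ?B) * (real (card ?B) * (D * (\<rho> ^ K / q\<^sup>2) ^ n)))"
      using D \<rho> by (simp add: ennreal_mult ennreal_of_nat_eq_real_of_nat)
    also have "\<dots> \<le> ennreal (s ^ n * (s ^ n * (D * (\<rho> ^ K / q\<^sup>2) ^ n)))"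
      using B(2) D \<rho> s by (intro ennreal_leI mult_mono) auto
    also have "s ^ n * (s ^ n * (D * (\<rho> ^ K / q\<^sup>2) ^ n)) = D * (s\<^sup>2 * \<rho> ^ K / q\<^sup>2) ^ n"
      by (simp add: power_mult_distrib power_divide power2_eq_square mult_ac)
    also have "ennreal \<dots> \<le> ennreal (D * (1 / 2) ^ n)"
      using D K \<rho> s by (intro ennreal_leI mult_left_mono power_mono) auto
    finally show ?thesis .
  qed
  have "sparse K"
    unfolding sparse_def
  proof (intro allI impI)
    fix \<epsilon> :: real assume "\<epsilon> > 0"
    then obtain N0 where N0: "\<And>N. N \<ge> N0 \<Longrightarrow> 2 * D * (1 / 2) ^ N \<le> \<epsilon>" using geometric_small by metis
    have "emeasure (P x y) (crowded K N x y w) \<le> ennreal \<epsilon>"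
      if N: "N \<ge> N0" and c: "x \<in> carrier G" "y \<in> carrier G" "w \<in> carrier G" for N x y w
    proof -
      let ?E = "\<lambda>n. {\<gamma> \<in> T x y. card (set \<gamma> \<inter> {g \<in> carrier G. wd w g \<le> n}) > K * n}"
      have "crowded K N x y w = (\<Union>n\<in>{N..}. ?E n)"
        by auto
      also have "emeasure (P x y) \<dots> \<le> ennreal (2 * D * (1 / 2) ^ N)"
        by (rule emeasure_geometric_tail) (use main[OF c] D in auto)
      also have "\<dots> \<le> ennreal \<epsilon>" using N0[OF N] by (rule ennreal_leI)
      finally show ?thesis .
    qed
    then show "\<exists>N0. \<forall>N\<ge>N0. \<forall>x\<in>carrier G. \<forall>y\<in>carrier G. \<forall>w\<in>carrier G.
      emeasure (P x y) (crowded K N x y w) \<le> ennreal \<epsilon>"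
      by blast
  qed
  then show ?thesis ..
qed

text \<open>Steps have length at most \<open>M\<close>, so by \<open>fd_near\<close> and a shift of
  the argument by \<open>M\<close> their Floyd length is at most a constant times \<open>fn\<close>.
  Beyond radius \<open>M\<close> the bad event is empty.\<close>

lemma short_steps_of_finite_support:
  assumes "finite (set_pmf \<mu>)"
  obtains h where "short_steps h" "antimono h" "\<And>n. h n \<ge> 0" "summable h"
proof -
  obtain M where M: "\<And>s. s \<in> set_pmf \<mu> \<Longrightarrow> len s \<le> M"
    using assms by (metis finite_imageI finite_nat_set_iff_bounded_le imageI)
  obtain \<kappa> where \<kappa>: "\<kappa> \<ge> 1" "\<And>n k. fn n \<le> \<kappa> ^ k * fn (n + k)" using fn_shift by blast
  define h where "h n = real M * \<kappa> ^ M * fn n" for n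
  have "short_steps h"
    unfolding short_steps_def
  proof (intro allI impI exI[of _ M] ballI)
    fix \<epsilon> :: real and N x y w assume N: "N \<ge> M" and w: "w \<in> carrier G"
    have "fd w a b \<le> h (wd w a)" if g: "xs @ a # b # ys \<in> T x y" and a: "wd w a \<ge> N" for xs a b ys
    proof -
      have c: "a \<in> carrier G" "b \<in> carrier G" and "pmf \<mu> (inv a \<otimes> b) > 0"
        using g by (auto simp: Traj_def successively_append_iff)
      then have d: "wd a b \<le> M" using M by (simp add: word_dist_def pmf_positive_iff)
      have "fd w a b \<le> real (wd a b) * fn (wd w a - wd a b)" using fd_near c w by blast
      also have "\<dots> \<le> real M * fn (wd w a - M)" using d by (intro mult_mono fn_antimono) auto
      also have "\<dots> \<le> real M * (\<kappa> ^ M * fn (wd w a - M + M))" using \<kappa>(2) by (intro mult_left_mono) auto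
      also have "\<dots> = h (wd w a)" using N a by (simp add: h_def)
      finally show ?thesis .
    qed
    then have "costly h N x y w = {}"
      by (auto simp: not_less[symmetric])
    then show "emeasure (P x y) (costly h N x y w) \<le> ennreal \<epsilon>"
      by (simp only: emeasure_empty zero_le)
  qed
  moreover have "antimono h"
    using \<kappa>(1) by (auto simp: h_def monotone_def intro!: mult_left_mono fn_antimono)
  moreover have "h n \<ge> 0" for n using \<kappa>(1) by (simp add: h_def)
  moreover have "summable h" unfolding h_def by (intro summable_mult fn_summable)
  ultimately show ?thesis by (rule that)
qed

text \<open>A union bound over the steps from \<open>a\<close> to \<open>b\<close>. If
  \<open>a\<close> is at distance \<open>n\<close> from \<open>w\<close>, the step is longer than
  \<open>n / 2\<close>, so an exponential moment of large base outweighs the number of starting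
  points and the loss through the Green function.\<close>

lemma long_jumps:
  assumes moment: "superexponential_moment G S \<mu>"
  obtains D where "D \<ge> 0" "\<And>x y w N. \<lbrakk>x \<in> carrier G; y \<in> carrier G; w \<in> carrier G\<rbrakk> \<Longrightarrow>
    emeasure (P x y) (jumping N x y w)
      \<le> ennreal (2 * D * (1 / 2) ^ N)"
proof -
  obtain q where q: "0 < q" "q \<le> 1" "\<And>x y. \<lbrakk>x \<in> carrier G; y \<in> carrier G\<rbrakk> \<Longrightarrow> q ^ wd x y \<le> green x y"
    using green_lower by blast
  define s where "s = real (card S + 1)"
  have s: "s \<ge> 1" by (simp add: s_def)
  \<comment> \<open>Chosen so that \<open>(c * q) ^ wd a b\<close> is
    \<open>(2 * s) ^ (2 * wd a b)\<close>, which is at least \<open>(2 * s) ^ n\<close>: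
    \<open>s ^ n\<close> for the starting points at distance \<open>n\<close>, \<open>2 ^ n\<close>
    for a geometric tail.\<close>
  define c where "c = (2 * s)\<^sup>2 / q"
  have "(2 * s)\<^sup>2 \<ge> 2\<^sup>2" using s by (intro power_mono) auto
  then have "(2 * s)\<^sup>2 > q" using q by simp
  then have c: "c > 1" using q by (simp add: c_def)
  have "(\<lambda>g. c ^ wd \<one> g * pmf \<mu> g) summable_on carrier G"
    using moment c unfolding superexponential_moment_def by blast
  then have "(\<integral>\<^sup>+g. ennreal (c ^ wd \<one> g * pmf \<mu> g) \<partial>count_space (carrier G)) < \<top>"
    using c by (intro nn_integral_summable_on_finite countable_carrier) auto
  then obtain M where M: "M \<ge> 0" "(\<integral>\<^sup>+g. ennreal (c ^ wd \<one> g * pmf \<mu> g) \<partial>count_space (carrier G)) = ennreal M"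
    by (cases "(\<integral>\<^sup>+g. ennreal (c ^ wd \<one> g * pmf \<mu> g) \<partial>count_space (carrier G))") auto
  define K where "K = (green \<one> \<one>)\<^sup>2"
  have K: "K \<ge> 0" by (simp add: K_def)
  define D where "D = K * M"
  have D: "D \<ge> 0" using K M by (simp add: D_def)
  have "emeasure (P x y) (jumping N x y w)
      \<le> ennreal (2 * D * (1 / 2) ^ N)" if xyw: "x \<in> carrier G" "y \<in> carrier G" "w \<in> carrier G" for x y w N
  proof -
    \<comment> \<open>A single step is a segment with two vertices, which puts it in the form of
      \<open>emeasure_P_infix\<close>.\<close>
    let ?E = "\<lambda>a b. {\<gamma> \<in> T x y. \<exists>xs \<beta> ys. \<gamma> = xs @ \<beta> @ ys \<and> \<beta> \<in> {[a, b]}}"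
    let ?J = "\<lambda>a. {b \<in> carrier G. 2 * wd a b > wd w a}"
    let ?A = "\<lambda>n. {a \<in> carrier G. wd w a = n}"
    have E: "emeasure (P x y) (?E a b) \<le> ennreal (K / (2 * s) ^ n * (c ^ wd a b * pmf \<mu> (inv a \<otimes> b)))"
      if a: "a \<in> ?A n" and b: "b \<in> ?J a" for a b n
    proof -
      have ab: "a \<in> carrier G" "b \<in> carrier G" "n \<le> 2 * wd a b" using a b by auto
      have "emeasure (P x y) (?E a b) \<le> ennreal (K / green a b) * W {[a, b]}"
        unfolding K_def by (rule emeasure_P_infix) (use xyw ab in auto)
      also have "W {[a, b]} = ennreal (pmf \<mu> (inv a \<otimes> b))" by (simp add: W_def nn_integral_count_space_finite)
      also have "ennreal (K / green a b) * ennreal (pmf \<mu> (inv a \<otimes> b)) = ennreal (K / green a b * pmf \<mu> (inv a \<otimes> b))"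
        using K by (intro ennreal_mult[symmetric]) auto
      also have "\<dots> \<le> ennreal (K / (2 * s) ^ n * (c ^ wd a b * pmf \<mu> (inv a \<otimes> b)))"
      proof (rule ennreal_leI)
        have "(2 * s) ^ n \<le> (2 * s) ^ (2 * wd a b)" using s ab by (intro power_increasing) auto
        also have "\<dots> = (c * q) ^ wd a b" using q by (simp add: c_def power_mult)
        also have "\<dots> = c ^ wd a b * q ^ wd a b" by (rule power_mult_distrib)
        also have "\<dots> \<le> c ^ wd a b * green a b" using c q ab by (intro mult_left_mono) auto
        finally have "K * (2 * s) ^ n \<le> K * (c ^ wd a b * green a b)" using K by (rule mult_left_mono)
        then have "K / green a b \<le> K / (2 * s) ^ n * c ^ wd a b"
          using green_pos[OF ab(1,2)] s by (simp add: field_simps)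
        then have "K / green a b * pmf \<mu> (inv a \<otimes> b) \<le> K / (2 * s) ^ n * c ^ wd a b * pmf \<mu> (inv a \<otimes> b)"
          by (intro mult_right_mono) auto
        then show "K / green a b * pmf \<mu> (inv a \<otimes> b) \<le> K / (2 * s) ^ n * (c ^ wd a b * pmf \<mu> (inv a \<otimes> b))"
          by (simp only: mult.assoc)
      qed
      finally show ?thesis .
    qed
    have EJ: "emeasure (P x y) (\<Union>b\<in>?J a. ?E a b) \<le> ennreal (D / (2 * s) ^ n)" if a: "a \<in> ?A n" for a n
    proof -
      have ac: "a \<in> carrier G" using a by simp
      have "emeasure (P x y) (\<Union>b\<in>?J a. ?E a b) \<le> (\<integral>\<^sup>+b. emeasure (P x y) (?E a b) \<partial>count_space (?J a))"
        by (rule emeasure_UN_le_nn_integral) (auto intro: countable_subset[OF _ countable_carrier])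
      also have "\<dots> \<le> (\<integral>\<^sup>+b. ennreal (K / (2 * s) ^ n * (c ^ wd a b * pmf \<mu> (inv a \<otimes> b))) \<partial>count_space (?J a))"
        using E[OF a] by (intro nn_integral_mono) simp
      also have "\<dots> \<le> (\<integral>\<^sup>+b. ennreal (K / (2 * s) ^ n * (c ^ wd a b * pmf \<mu> (inv a \<otimes> b))) \<partial>count_space (carrier G))"
        by (rule nn_integral_count_space_subset) auto
      also have "\<dots> = (\<integral>\<^sup>+g. ennreal (K / (2 * s) ^ n * (c ^ wd \<one> g * pmf \<mu> g)) \<partial>count_space (carrier G))"
      proof -
        have "wd \<one> (inv a \<otimes> b) = wd a b" if "b \<in> carrier G" for b
          using that ac by (simp add: word_dist_def)
        then have "(\<integral>\<^sup>+b. ennreal (K / (2 * s) ^ n * (c ^ wd a b * pmf \<mu> (inv a \<otimes> b))) \<partial>count_space (carrier G)) =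
          (\<integral>\<^sup>+b. ennreal (K / (2 * s) ^ n * (c ^ wd \<one> (inv a \<otimes> b) * pmf \<mu> (inv a \<otimes> b))) \<partial>count_space (carrier G))"
          by (intro nn_integral_cong) simp
        also have "\<dots> = (\<integral>\<^sup>+g. ennreal (K / (2 * s) ^ n * (c ^ wd \<one> g * pmf \<mu> g)) \<partial>count_space (carrier G))"
          using ac by (intro nn_integral_left[where F = "\<lambda>g. ennreal (K / (2 * s) ^ n * (c ^ wd \<one> g * pmf \<mu> g))"]) simp
        finally show ?thesis .
      qed
      also have "\<dots> = (\<integral>\<^sup>+g. ennreal (K / (2 * s) ^ n) * ennreal (c ^ wd \<one> g * pmf \<mu> g) \<partial>count_space (carrier G))"
        using K c s by (intro nn_integral_cong ennreal_mult) auto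
      also have "\<dots> = ennreal (K / (2 * s) ^ n) * ennreal M" unfolding M(2)[symmetric] by (rule nn_integral_cmult) simp
      also have "\<dots> = ennreal (D / (2 * s) ^ n)" using K M s by (simp add: D_def ennreal_mult[symmetric])
      finally show ?thesis .
    qed
    have En: "emeasure (P x y) (\<Union>a\<in>?A n. \<Union>b\<in>?J a. ?E a b) \<le> ennreal (D * (1 / 2) ^ n)" for n
    proof -
      have sub: "?A n \<subseteq> {g \<in> carrier G. wd w g \<le> n}" by auto
      have fin: "finite (?A n)" by (rule finite_subset[OF sub]) (use xyw in simp)
      have "card (?A n) \<le> (card S + 1) ^ n"
        using card_mono[OF finite_wball_around[OF xyw(3)] sub] wball_card[of n] xyw by (simp add: card_wball_around)
      then have "real (card (?A n)) \<le> real ((card S + 1) ^ n)" by (simp only: of_nat_le_iff)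
      then have card: "real (card (?A n)) \<le> s ^ n" by (simp add: s_def)
      have "emeasure (P x y) (\<Union>a\<in>?A n. \<Union>b\<in>?J a. ?E a b) \<le> (\<Sum>a\<in>?A n. emeasure (P x y) (\<Union>b\<in>?J a. ?E a b))"
        using fin by (intro emeasure_subadditive_finite) auto
      also have "\<dots> \<le> (\<Sum>a\<in>?A n. ennreal (D / (2 * s) ^ n))" by (intro sum_mono EJ)
      also have "\<dots> = ennreal (real (card (?A n))) * ennreal (D / (2 * s) ^ n)"
        by (simp add: ennreal_of_nat_eq_real_of_nat)
      also have "\<dots> = ennreal (real (card (?A n)) * (D / (2 * s) ^ n))"
        using D s by (intro ennreal_mult[symmetric]) auto
      also have "\<dots> \<le> ennreal (s ^ n * (D / (2 * s) ^ n))"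
        using card D s by (intro ennreal_leI mult_right_mono) auto
      also have "s ^ n * (D / (2 * s) ^ n) = D * (1 / 2) ^ n"
        using s by (simp add: power_mult_distrib power_divide)
      finally show ?thesis .
    qed
    have "jumping N x y w \<subseteq>
        (\<Union>n\<in>{N..}. \<Union>a\<in>?A n. \<Union>b\<in>?J a. ?E a b)"
    proof
      fix \<gamma> assume "\<gamma> \<in> jumping N x y w"
      then obtain xs a b ys where g: "\<gamma> \<in> T x y" "\<gamma> = xs @ [a, b] @ ys" "wd w a \<ge> N" "2 * wd a b > wd w a" by auto
      then have ab: "wd w a \<in> {N..}" "a \<in> ?A (wd w a)" "b \<in> ?J a" by (auto simp: Traj_def)
      have E: "\<gamma> \<in> ?E a b" using g(1,2) by blast
      show "\<gamma> \<in> (\<Union>n\<in>{N..}. \<Union>a\<in>?A n. \<Union>b\<in>?J a. ?E a b)"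
        by (rule UN_I[OF ab(1)], rule UN_I[OF ab(2)], rule UN_I[OF ab(3)], rule E)
    qed
    then have "emeasure (P x y) (jumping N x y w) \<le>
        emeasure (P x y) (\<Union>n\<in>{N..}. \<Union>a\<in>?A n. \<Union>b\<in>?J a. ?E a b)" by (intro emeasure_mono) auto
    also have "\<dots> \<le> ennreal (2 * D * (1 / 2) ^ N)"
      by (rule emeasure_geometric_tail) (use En D in auto)
    finally show ?thesis .
  qed
  then show ?thesis using that D by blast
qed

text \<open>Unless the step is a long jump, its Floyd length is at most
  \<open>n / 2 * f (n / 2)\<close> where \<open>n = wd w a\<close>. The decay of \<open>f\<close>
  bounds this by the power \<open>- 1 - \<alpha>\<close> of \<open>n / 2\<close>, which is
  summable.\<close>

lemma short_steps_of_moment: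
  assumes moment: "superexponential_moment G S \<mu>"
    and \<alpha>: "\<alpha> > 0" "((\<lambda>x. x powr (2 + \<alpha>) * f x) \<longlongrightarrow> 0) at_top"
  obtains h where "short_steps h" "antimono h" "\<And>n. h n \<ge> 0" "summable h"
proof -
  have "\<forall>\<^sub>F x in at_top. x powr (2 + \<alpha>) * f x < 1" using \<alpha>(2) by (rule order_tendstoD) simp
  then obtain X where X: "\<And>x. x \<ge> X \<Longrightarrow> x powr (2 + \<alpha>) * f x < 1" unfolding eventually_at_top_linorder by blast
  have f_le: "f x \<le> x powr - (2 + \<alpha>)" if "x \<ge> X" "x > 0" for x
  proof -
    have "x powr (2 + \<alpha>) > 0" using that(2) by simp
    then have "f x \<le> 1 / x powr (2 + \<alpha>)"
      using X[OF that(1)] by (simp add: pos_le_divide_eq mult.commute less_imp_le)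
    then show ?thesis by (simp only: powr_minus_divide)
  qed
  \<comment> \<open>The maximum with 1 keeps \<open>h\<close> nonincreasing at 0, where
    \<open>0 powr _\<close> is 0.\<close>
  define h where "h n = (real (max 1 n) / 2) powr (- 1 - \<alpha>)" for n :: nat
  obtain D where D: "D \<ge> 0" "\<And>x y w N. \<lbrakk>x \<in> carrier G; y \<in> carrier G; w \<in> carrier G\<rbrakk> \<Longrightarrow>
    emeasure (P x y) (jumping N x y w)
      \<le> ennreal (2 * D * (1 / 2) ^ N)" using long_jumps[OF moment] by blast
  obtain N1 :: nat where N1: "real N1 \<ge> 2 * X" using real_arch_simple by blast
  have short: "fd w a b \<le> h (wd w a)"
    if c: "a \<in> carrier G" "b \<in> carrier G" "w \<in> carrier G" and n: "wd w a \<ge> Suc N1" and d: "2 * wd a b \<le> wd w a" for a b w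
  proof -
    let ?n = "wd w a"
    have n2: "real ?n / 2 \<ge> X" "real ?n / 2 > 0" using n N1 by auto
    have "fd w a b \<le> real (wd a b) * fn (?n - wd a b)" using fd_near c by blast
    also have "\<dots> \<le> real ?n / 2 * f (real ?n / 2)"
    proof (intro mult_mono)
      have "antimono_on {0..} f" using floyd_f by (simp add: floyd_function_def)
      moreover have "real ?n / 2 \<le> real (?n - wd a b)" using d by (simp add: of_nat_diff)
      ultimately show "fn (?n - wd a b) \<le> f (real ?n / 2)"
        by (auto simp: monotone_on_def)
      show "0 \<le> fn (?n - wd a b)" by (rule fn_nonneg)
    qed (use d in auto)
    also have "\<dots> \<le> real ?n / 2 * (real ?n / 2) powr - (2 + \<alpha>)"
      using f_le[OF n2] n2 by (intro mult_left_mono) auto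
    also have "\<dots> = (real ?n / 2) powr (1 + - (2 + \<alpha>))"
      unfolding powr_add using n2 by simp
    also have "\<dots> = h ?n" using n by (simp add: h_def max_def)
    finally show ?thesis .
  qed
  have "short_steps h"
    unfolding short_steps_def
  proof (intro allI impI)
    fix \<epsilon> :: real assume "\<epsilon> > 0"
    then obtain N0 where N0: "\<And>N. N \<ge> N0 \<Longrightarrow> 2 * D * (1 / 2) ^ N \<le> \<epsilon>" using geometric_small by metis
    have "emeasure (P x y) (costly h N x y w) \<le> ennreal \<epsilon>"
      if N: "N \<ge> N0 + Suc N1" and c: "x \<in> carrier G" "y \<in> carrier G" "w \<in> carrier G" for N x y w
    proof -
      have "costly h N x y w \<subseteq>
         jumping N x y w"
      proof
        fix \<gamma> assume "\<gamma> \<in> costly h N x y w"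
        then obtain xs a b ys where g: "\<gamma> \<in> T x y" "\<gamma> = xs @ a # b # ys" "wd w a \<ge> N" "fd w a b > h (wd w a)" by blast
        have "a \<in> carrier G" "b \<in> carrier G" using g(1,2) by (auto simp: Traj_def)
        then have "2 * wd a b > wd w a" using short[of a b w] g N c(3) by (intro not_le_imp_less notI) simp
        then show "\<gamma> \<in> jumping N x y w"
          using g by blast
      qed
      then have "emeasure (P x y) (costly h N x y w) \<le>
         emeasure (P x y) (jumping N x y w)"
        by (rule emeasure_mono) auto
      also have "\<dots> \<le> ennreal (2 * D * (1 / 2) ^ N)" by (rule D(2)[OF c])
      also have "\<dots> \<le> ennreal \<epsilon>" using N by (intro ennreal_leI N0) simp
      finally show ?thesis .
    qed
    then show "\<exists>N0. \<forall>N\<ge>N0. \<forall>x\<in>carrier G. \<forall>y\<in>carrier G. \<forall>w\<in>carrier G.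
      emeasure (P x y) (costly h N x y w) \<le> ennreal \<epsilon>"
      by blast
  qed
  moreover have "antimono h"
    unfolding h_def monotone_def using \<alpha>(1) by (auto intro!: powr_mono2')
  moreover have "h n \<ge> 0" for n by (simp add: h_def)
  moreover have "summable h"
  proof -
    have "summable (\<lambda>n. (1 / 2) powr (- 1 - \<alpha>) * real n powr (- 1 - \<alpha>))"
      using \<alpha>(1) by (intro summable_mult) (simp add: summable_real_powr_iff)
    moreover have "\<forall>\<^sub>F n in sequentially. h n = (1 / 2) powr (- 1 - \<alpha>) * real n powr (- 1 - \<alpha>)"
      using eventually_ge_at_top[of 1]
    proof (rule eventually_mono)
      fix n :: nat assume "n \<ge> 1"
      then show "h n = (1 / 2) powr (- 1 - \<alpha>) * real n powr (- 1 - \<alpha>)"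
        by (simp add: h_def max_def powr_mult[symmetric] del: powr_mult)
    qed
    ultimately show ?thesis by (simp add: summable_cong)
  qed
  ultimately show ?thesis by (rule that)
qed

lemma ancona_ex:
  assumes "finite (set_pmf \<mu>) \<or> (superexponential_moment G S \<mu> \<and>
      (\<exists>\<alpha>>0. ((\<lambda>x. x powr (2 + \<alpha>) * f x) \<longlongrightarrow> 0) at_top))"
    and \<epsilon>\<delta>: "\<epsilon> > 0" "\<delta> > 0"
  shows "\<exists>r. ancona \<epsilon> \<delta> r"
proof -
  obtain h where h: "short_steps h" "antimono h" "\<And>n. h n \<ge> 0" "summable h"
    using assms(1) short_steps_of_finite_support short_steps_of_moment by metis
  consider (thin) "\<forall>\<delta>>0. \<exists>N. \<forall>x\<in>carrier G. \<forall>y\<in>carrier G. len x \<ge> N \<longrightarrow> len y \<ge> N \<longrightarrow> fd \<one> x y < \<delta>"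
    | (lin) "\<exists>C. \<forall>k\<ge>1. card (wball k) \<le> C * k" | (pp) "ping_pong G"
    using trichotomy by blast
  then show ?thesis
  proof cases
    case thin
    then show ?thesis using \<epsilon>\<delta> by (rule ancona_of_thin_boundary)
  next
    case lin
    then obtain C where "sparse C" using sparse_of_linear_growth by blast
    then show ?thesis using h \<epsilon>\<delta> by (rule ancona_of_sparse)
  next
    case pp
    then obtain K where "sparse K" using sparse_of_ping_pong by blast
    then show ?thesis using h \<epsilon>\<delta> by (rule ancona_of_sparse)
  qed
qed

end

section \<open>Choice of the radius function\<close>

theorem theorem1p2:
  fixes G :: "('a, 'b) monoid_scheme" and S :: "'a set"
    and f :: "real \<Rightarrow> real" and \<mu> :: "'a pmf"
  assumes "group G" and "infinite (carrier G)"
    and "finite S" and "symmetric_generating_set G S"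
    and "floyd_function f"
    and "set_pmf \<mu> \<subseteq> carrier G"
    and "generates_as_semigroup G (set_pmf \<mu>)"
    and "transient_walk G \<mu>"
    and "finite (set_pmf \<mu>) \<or>
         (superexponential_moment G S \<mu> \<and>
          (\<exists>\<alpha>>0. ((\<lambda>x. x powr (2 + \<alpha>) * f x) \<longlongrightarrow> 0) at_top))"
  shows "\<exists>R :: real \<Rightarrow> real \<Rightarrow> real.
     (\<forall>\<epsilon>>0. \<forall>\<delta>>0. R \<epsilon> \<delta> > 0) \<and>
     (\<forall>\<delta>>0. strict_antimono_on {0<..} (\<lambda>\<epsilon>. R \<epsilon> \<delta>)) \<and>
     (\<forall>\<epsilon>>0. strict_antimono_on {0<..} (\<lambda>\<delta>. R \<epsilon> \<delta>)) \<and>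
     (\<forall>\<epsilon>>0. \<forall>x\<in>carrier G. \<forall>y\<in>carrier G. \<forall>w\<in>carrier G. x \<noteq> y \<longrightarrow>
        measure (traj_measure G \<mu> x y)
          {\<gamma> \<in> Traj G \<mu> x y.
             set \<gamma> \<inter> {g \<in> carrier G. real (word_dist G S g w) \<le> R \<epsilon> (floyd_dist G S f w x y)} \<noteq> {}}
        > 1 - \<epsilon>)"
proof -
  interpret floyd_walk G S f \<mu>
    by (intro floyd_walk.intro floyd_group.intro transient_group_walk.intro marked_group.intro
        marked_group_axioms.intro floyd_group_axioms.intro transient_group_walk_axioms.intro assms)
  define Q where "Q \<epsilon> \<delta> n \<longleftrightarrow> ancona \<epsilon> \<delta> (real n)" for \<epsilon> \<delta> and n :: nat
  have mono: "ancona \<epsilon>' \<delta>' r'" if le: "\<epsilon> \<le> \<epsilon>'" "\<delta> \<le> \<delta>'" "r \<le> r'" and a: "ancona \<epsilon> \<delta> r" for \<epsilon> \<epsilon>' \<delta> \<delta>' r r'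
    unfolding ancona_def
  proof (intro ballI impI)
    fix x y w assume c: "x \<in> carrier G" "y \<in> carrier G" "w \<in> carrier G" and \<delta>: "fd w x y \<ge> \<delta>'"
    interpret prob_space "P x y" using prob_P c by blast
    have "1 - \<epsilon>' \<le> 1 - \<epsilon>" using le by simp
    also have "\<dots> < prob {\<gamma> \<in> T x y. \<gamma> \<in> meets w r}" using a c \<delta> le unfolding ancona_def by force
    also have "\<dots> \<le> prob {\<gamma> \<in> T x y. \<gamma> \<in> meets w r'}"
      using le by (intro finite_measure_mono) (auto simp: meets_def)
    finally show "1 - \<epsilon>' < prob {\<gamma> \<in> T x y. \<gamma> \<in> meets w r'}" .
  qed
  have Qex: "\<exists>n. Q \<epsilon> \<delta> n" if pos: "\<epsilon> > 0" "\<delta> > 0" for \<epsilon> \<delta>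
  proof -
    obtain r where r: "ancona \<epsilon> \<delta> r" using ancona_ex[OF assms(9) pos] by blast
    obtain n where "r \<le> real n" using real_arch_simple by blast
    then have "Q \<epsilon> \<delta> n" unfolding Q_def using mono[OF order_refl order_refl _ r] by blast
    then show ?thesis ..
  qed
  \<comment> \<open>Choosing the least admissible natural number makes the radius monotone: larger
    \<open>\<epsilon>\<close> or \<open>\<delta>\<close> admit more values.\<close>
  define N where "N \<epsilon> \<delta> = (LEAST n. Q \<epsilon> \<delta> n)" for \<epsilon> \<delta>
  have N: "Q \<epsilon> \<delta> (N \<epsilon> \<delta>)" if "\<epsilon> > 0" "\<delta> > 0" for \<epsilon> \<delta>
    unfolding N_def using Qex[OF that] by (rule LeastI_ex)
  have N_anti: "N \<epsilon>' \<delta>' \<le> N \<epsilon> \<delta>" if "0 < \<epsilon>" "0 < \<delta>" "\<epsilon> \<le> \<epsilon>'" "\<delta> \<le> \<delta>'" for \<epsilon> \<epsilon>' \<delta> \<delta>'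
    using mono[OF that(3,4) order_refl] N[OF that(1,2)] unfolding N_def[of \<epsilon>'] Q_def by (intro Least_le) blast
  \<comment> \<open>The added reciprocals turn weak into strict monotonicity and make
    \<open>R\<close> positive; enlarging the radius only helps.\<close>
  define R where "R \<epsilon> \<delta> = real (N \<epsilon> \<delta>) + 1 / \<epsilon> + 1 / \<delta>" for \<epsilon> \<delta>
  have R_anti: "R \<epsilon>' \<delta>' < R \<epsilon> \<delta>" if le: "0 < \<epsilon>" "0 < \<delta>" "\<epsilon> \<le> \<epsilon>'" "\<delta> \<le> \<delta>'" and "\<epsilon> < \<epsilon>' \<or> \<delta> < \<delta>'" for \<epsilon> \<epsilon>' \<delta> \<delta>'
  proof -
    have "1 / \<epsilon>' \<le> 1 / \<epsilon>" "1 / \<delta>' \<le> 1 / \<delta>" using le by (auto intro!: divide_left_mono)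
    moreover have "1 / \<epsilon>' < 1 / \<epsilon> \<or> 1 / \<delta>' < 1 / \<delta>"
      using that by (auto intro!: divide_strict_left_mono)
    ultimately show ?thesis using N_anti[OF le] unfolding R_def by linarith
  qed
  show ?thesis
  proof (intro exI[of _ R] conjI allI impI ballI)
    fix \<epsilon> \<delta> :: real assume "\<epsilon> > 0" "\<delta> > 0"
    then show "R \<epsilon> \<delta> > 0" by (simp add: R_def add_nonneg_pos)
  next
    fix \<delta> :: real assume "\<delta> > 0"
    then show "strict_antimono_on {0<..} (\<lambda>\<epsilon>. R \<epsilon> \<delta>)" by (intro monotone_onI R_anti) auto
  next
    fix \<epsilon> :: real assume "\<epsilon> > 0"
    then show "strict_antimono_on {0<..} (\<lambda>\<delta>. R \<epsilon> \<delta>)" by (intro monotone_onI R_anti) auto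
  next
    fix \<epsilon> x y w assume \<epsilon>: "\<epsilon> > (0 :: real)" and c: "x \<in> carrier G" "y \<in> carrier G" "w \<in> carrier G" "x \<noteq> y"
    \<comment> \<open>Distinct points have positive Floyd distance, so it is an admissible value of
      \<open>\<delta>\<close>.\<close>
    have \<delta>: "fd w x y > 0" using fd_pos c by blast
    have "real (N \<epsilon> (fd w x y)) \<le> R \<epsilon> (fd w x y)" using \<epsilon> \<delta> by (simp add: R_def)
    from mono[OF order_refl order_refl this] N[OF \<epsilon> \<delta>]
    have "ancona \<epsilon> (fd w x y) (R \<epsilon> (fd w x y))" unfolding Q_def by blast
    then show "1 - \<epsilon> < measure (P x y) {\<gamma> \<in> T x y.
        set \<gamma> \<inter> {g \<in> carrier G. real (wd g w) \<le> R \<epsilon> (fd w x y)} \<noteq> {}}"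
      using c(1-3) unfolding ancona_def meets_def by simp
  qed
qed

end
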